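(* For any $3$-partite $3$-graph $F$ in which not all part sizes are equal and any $0<c_1,c_2<1$, there exist a real $\epsilon>0$ and positive integers $C,n_0$ such that the following holds. If $G$ is a $3$-graph on a set $V$ of $n>n_0$ vertices such that every vertex $v$ has degree $|G(v)|=(1\pm\epsilon)c_1n^2$ and every pair of distinct vertices $u,v$ has degree $|G(uv)|>c_2n$, then $G$ contains an $F$-packing that covers all but at most $C$ vertices.
   Context: A $3$-graph is a set of 3-element subsets (edges) of a vertex set. A $3$-partite $3$-graph $F$ has a vertex partition into three parts such that each edge meets each part in exactly one vertex; its part sizes are the sizes of these three parts. $G(v)=\{\{a,b\}:\{v,a,b\}\in G\}$ and $G(uv)=\{w:\{u,v,w\}\in G\}$. An $F$-packing is a collection of vertex-disjoint copies of $F$ in $G$; it covers the vertices lying in its copies. $a\pm b$ denotes a number in $[a-b,a+b]$. *)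

theory Defs
  imports Complex_Main "HOL-Library.Disjoint_Sets"
begin

definition three_graph :: "'a set \<Rightarrow> 'a set set \<Rightarrow> bool" where
  "three_graph V E \<longleftrightarrow> finite V \<and> (\<forall>e\<in>E. e \<subseteq> V \<and> card e = 3)"

definition three_partite ::
    "'a set \<Rightarrow> 'a set set \<Rightarrow> 'a set \<Rightarrow> 'a set \<Rightarrow> 'a set \<Rightarrow> bool" where
  "three_partite V E X Y Z \<longleftrightarrow>
     three_graph V E \<and>
     X \<union> Y \<union> Z = V \<and> X \<inter> Y = {} \<and> X \<inter> Z = {} \<and> Y \<inter> Z = {} \<and>
     (\<forall>e\<in>E. card (e \<inter> X) = 1 \<and> card (e \<inter> Y) = 1 \<and> card (e \<inter> Z) = 1)"

(* When all edges have three elements, {v, a, b} \<in> E forces v, a, b to be distinct,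
   so neither set below contains degenerate elements. *)
definition vertex_link :: "'a set set \<Rightarrow> 'a \<Rightarrow> 'a set set" where
  "vertex_link E v = {{a, b} | a b. {v, a, b} \<in> E}"

definition pair_link :: "'a set set \<Rightarrow> 'a \<Rightarrow> 'a \<Rightarrow> 'a set" where
  "pair_link E u v = {w. {u, v, w} \<in> E}"

(* K = (W, H) is a (not necessarily induced) subgraph of (V, G) isomorphic to (VF, F). *)
definition is_copy ::
    "'a set \<Rightarrow> 'a set set \<Rightarrow> 'b set \<Rightarrow> 'b set set \<Rightarrow> 'b set \<times> 'b set set \<Rightarrow> bool" where
  "is_copy VF F V G K \<longleftrightarrow>
     fst K \<subseteq> V \<and> snd K \<subseteq> G \<and>
     (\<exists>\<phi>. bij_betw \<phi> VF (fst K) \<and> snd K = (\<lambda>e. \<phi> ` e) ` F)"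

definition is_packing ::
    "'a set \<Rightarrow> 'a set set \<Rightarrow> 'b set \<Rightarrow> 'b set set \<Rightarrow> ('b set \<times> 'b set set) set \<Rightarrow> bool" where
  "is_packing VF F V G P \<longleftrightarrow>
     (\<forall>K\<in>P. is_copy VF F V G K) \<and> disjoint_family_on fst P"

definition covered :: "('b set \<times> 'b set set) set \<Rightarrow> 'b set" where
  "covered P = (\<Union>K\<in>P. fst K)"

end

theory Submission
  imports Defs
begin

text \<open>
  Only complete tripartite tiles with part sizes \<open>s > t\<close> and \<open>r\<close> have to be packed; put
  \<open>m = s + t + r\<close>.

  \<^emph>\<open>Almost perfect tilings.\<close> Let \<open>f \<ge> 0\<close> be a weight on the vertices with mean \<open>\<mu>\<close>. Averaging
  \<open>s f(x) + t f(y) + r f(z)\<close> over the edges, with the larger coefficient \<open>s\<close> on the lighter of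
  \<open>x, y\<close>, gives at most \<open>m \<mu>\<close>: irregular degrees cost \<open>O(\<epsilon>)\<close> times the mean deviation of \<open>f\<close>, while
  the pair degrees and \<open>s > t\<close> gain a constant times it. Hence a positive proportion of the edges are
  light, and they contain linearly many disjoint large blow-ups of the tile of mean weight at most
  \<open>(1 + o(1)) \<mu>\<close>. Repeating this with \<open>f\<close> the number of times a vertex has been covered so far keeps the
  second moment of \<open>f\<close> minimal, so a bounded number of rounds covers almost all vertices almost
  equally often; Hall's theorem then selects disjoint transversals of the blow-ups. The leftover
  proportion \<open>\<gamma>\<close> is arbitrarily small for a fixed \<open>\<epsilon>\<close>.

  \<^emph>\<open>From \<open>\<gamma> n\<close> to a constant.\<close> Suppose that a maximum tiling misses a large constant number of
  vertices. Add boundedly many random tiles to these vertices: the hypotheses pass to the resulting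
  vertex set of bounded size (second moments suffice, since they are only needed on average), and an
  almost perfect tiling of that set has more tiles than were sampled, a contradiction.
\<close>

section \<open>Complete tripartite subgraphs and systems of representatives\<close>

text \<open>The loss from irregular degrees and the gain from \<open>s > t\<close> are both
  proportional to the mean deviation of \<open>f\<close>, so a small fixed \<epsilon> is absorbed
  outright instead of being paid for in uncovered vertices. This leaves \<gamma> free, and the
  second stage needs that: passing to a sample perturbs degrees by a factor 1 + O(\<gamma>), so
  \<gamma> has to be chosen after \<epsilon> and well below it. Covering in rounds produces
  overlapping sets, in effect only a fractional tiling. Replacing each tile vertex by a class of
  \<open>M\<close> vertices repairs this: when most vertices are covered about \<kappa> times, with
  \<kappa> slightly below \<open>M\<close>, classes are larger than covering numbers, and every
  class can get a vertex of its own. The random set is made of whole tiles of the maximum tiling, so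
  it can be tiled anew without touching the other tiles. With \<open>C\<close> uncovered vertices
  added to \<open>p\<close> tiles, the new tiling misses at most a proportion \<gamma> of the
  \<open>p * m + C\<close> vertices; this is fewer than \<open>C\<close>, so it has more than
  \<open>p\<close> tiles.\<close>

lemma exists_subset_above_average:
  fixes f :: "'a \<Rightarrow> real"
  assumes "finite A" "N \<le> card A"
  shows "\<exists>B\<subseteq>A. card B = N \<and> real N * sum f A \<le> real (card A) * sum f B"
  using assms
proof (induction "card A - N" arbitrary: A)
  case 0
  then show ?case by (intro exI[of _ A]) auto
next
  case (Suc k)
  then have cA: "card A > N" by linarith
  then have ne: "A \<noteq> {}" by auto
  \<comment> \<open>Discarding a smallest value cannot lower the average, so the set is thinned one
    element at a time down to \<open>N\<close>.\<close>
  obtain a where a: "a \<in> A" "\<And>b. b \<in> A \<Longrightarrow> f a \<le> f b"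
    using ex_min_if_finite[of "f ` A"] Suc.prems(1) ne
    by (metis arg_min_if_finite(1) arg_min_least)
  have cd: "card (A - {a}) = card A - 1" using a Suc.prems by simp
  obtain B where B: "B \<subseteq> A - {a}" "card B = N"
     "real N * sum f (A - {a}) \<le> real (card (A - {a})) * sum f B"
  proof -
    have "k = card (A - {a}) - N" "N \<le> card (A - {a})" using Suc.hyps(2) cd cA by linarith+
    then show ?thesis using Suc.hyps(1)[of "A - {a}"] Suc.prems(1) that by blast
  qed
  have fB: "finite B" using B Suc.prems finite_subset by blast
  have 1: "real N * f a \<le> sum f B"
    using sum_bounded_below[of B "f a" f] a B by auto
  have 2: "sum f A = f a + sum f (A - {a})" using a Suc.prems by (simp add: sum.remove)
  have "real N * sum f A \<le> sum f B + (real (card A) - 1) * sum f B"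
    using 1 2 B(3) cd cA by (simp add: algebra_simps of_nat_diff)
  then have "real N * sum f A \<le> real (card A) * sum f B" by (simp add: algebra_simps)
  then show ?case using B by (intro exI[of _ B]) auto
qed

text \<open>The pigeonhole proof of the Kovari-Sos-Turan theorem. Keep only \<open>N\<close>
  elements of \<open>A\<close>, a number independent of \<open>A\<close>, on which the density is
  still at least \<delta>. A proportion \<delta>/2 of \<open>B\<close> is then related to at least
  \<open>M\<close> of them, and as there are at most \<open>2 ^ N\<close> subsets to choose from, a
  single \<open>M\<close>-set serves a fixed proportion of \<open>B\<close>.\<close>

lemma dense_relation_common_neighbours:
  fixes \<delta> :: real
  assumes "finite A" "finite B" "\<delta> > 0" "N \<ge> 1" "B \<noteq> {}" "real N \<ge> 2 * real M / \<delta>" "N \<le> card A"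
    and dense: "(\<Sum>a\<in>A. \<Sum>b\<in>B. of_bool (Q a b)) \<ge> \<delta> * real (card A) * real (card B)"
  shows "\<exists>X\<subseteq>A. card X = M \<and> real (card {b\<in>B. \<forall>a\<in>X. Q a b}) \<ge> \<delta> / 2 / 2 ^ N * real (card B)"
proof -
  define f where "f a = (\<Sum>b\<in>B. of_bool (Q a b) :: real)" for a
  obtain A0 where A0: "A0 \<subseteq> A" "card A0 = N" "real N * sum f A \<le> real (card A) * sum f A0"
    using exists_subset_above_average[of A N f] assms by blast
  have fin0: "finite A0" using A0 assms(1) finite_subset by blast
  have cA: "real (card A) > 0" using assms by simp
  have "real (card A) * (\<delta> * real N * real (card B)) \<le> real N * sum f A"
    using mult_left_mono[OF dense, of "real N"] unfolding f_def by (simp add: algebra_simps)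
  with A0(3) have "real (card A) * (\<delta> * real N * real (card B)) \<le> real (card A) * sum f A0" by linarith
  then have s0: "\<delta> * real N * real (card B) \<le> sum f A0" using cA by simp
  define n where "n b = {a\<in>A0. Q a b}" for b
  have s1: "sum f A0 = (\<Sum>b\<in>B. real (card (n b)))"
    unfolding f_def n_def by (subst sum.swap) (simp add: fin0 Int_def)
  define B' where "B' = {b\<in>B. M \<le> card (n b)}"
  have fB': "finite B'" using assms by (simp add: B'_def)
  have "(\<Sum>b\<in>B. real (card (n b))) \<le> (\<Sum>b\<in>B. real M + real N * of_bool (b \<in> B'))"
  proof (rule sum_mono)
    fix b assume "b \<in> B"
    have "card (n b) \<le> N" using A0 fin0 card_mono[of A0 "n b"] by (auto simp: n_def)
    then show "real (card (n b)) \<le> real M + real N * of_bool (b \<in> B')"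
      using \<open>b \<in> B\<close> by (auto simp: B'_def)
  qed
  also have "\<dots> = real M * real (card B) + real N * real (card B')"
    using assms(2) by (simp add: sum.distrib sum_distrib_left[symmetric] B'_def Int_def)
  finally have "\<delta> * real N * real (card B) \<le> real M * real (card B) + real N * real (card B')"
    using s0 s1 by linarith
  \<comment> \<open>The choice of \<open>N\<close> enters here: the contribution of those
    \<open>b\<close> that see fewer than \<open>M\<close> elements is at most half of the guaranteed
    incidences.\<close>
  moreover have "real M * real (card B) \<le> \<delta> / 2 * real N * real (card B)"
    using assms by (intro mult_right_mono) (auto simp: field_simps)
  ultimately have "real N * (\<delta> / 2 * real (card B)) \<le> real N * real (card B')" by (simp add: algebra_simps)
  then have cB': "\<delta> / 2 * real (card B) \<le> real (card B')" using assms(4) by simp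
  have "\<forall>b\<in>B'. \<exists>X. X \<subseteq> n b \<and> card X = M"
    by (metis B'_def mem_Collect_eq obtain_subset_with_card_n)
  then obtain g where g: "\<And>b. b \<in> B' \<Longrightarrow> g b \<subseteq> n b \<and> card (g b) = M" by metis
  have gim: "g ` B' \<subseteq> Pow A0" using g by (fastforce simp: n_def)
  have "B' \<noteq> {}"
    using cB' assms by (auto simp: mult_le_0_iff)
  then obtain X where X: "X \<in> g ` B'" "card B' \<le> card (g -` {X} \<inter> B') * card (g ` B')"
    using pigeonhole_card[of g B' "g ` B'"] fB' by auto
  have "g -` {X} \<inter> B' = {b\<in>B'. g b = X}" by auto
  with X(2) have X2: "real (card B') \<le> real (card (g ` B')) * real (card {b\<in>B'. g b = X})"
    by (metis mult.commute of_nat_le_iff of_nat_mult)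
  have "real (card (g ` B')) \<le> 2 ^ N"
  proof -
    have "card (g ` B') \<le> card (Pow A0)" using gim fin0 by (intro card_mono) auto
    then have "real (card (g ` B')) \<le> real (2 ^ N)" using A0 fin0 by (metis card_Pow of_nat_le_iff)
    then show ?thesis by simp
  qed
  then have "real (card B') \<le> 2 ^ N * real (card {b\<in>B'. g b = X})"
    using X2 by (elim order_trans) (simp add: mult_right_mono)
  also have "\<dots> \<le> 2 ^ N * real (card {b\<in>B. \<forall>a\<in>X. Q a b})"
  proof -
    have "{b\<in>B'. g b = X} \<subseteq> {b\<in>B. \<forall>a\<in>X. Q a b}" using g by (fastforce simp: B'_def n_def)
    then show ?thesis using assms(2) by (simp add: card_mono)
  qed
  finally have "\<delta> / 2 * real (card B) \<le> 2 ^ N * real (card {b\<in>B. \<forall>a\<in>X. Q a b})"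
    using cB' by linarith
  then have "\<delta> / 2 / 2 ^ N * real (card B) \<le> real (card {b\<in>B. \<forall>a\<in>X. Q a b})"
    by (simp add: field_simps)
  moreover have "X \<subseteq> A" using X(1) gim A0(1) by blast
  moreover have "card X = M" using X(1) g by auto
  ultimately show ?thesis by blast
qed


text \<open>Erdos's theorem for a relation without any symmetry. The two-sided statement for
  \<open>V\<close> against \<open>V \<times> V\<close> fixes \<open>X\<close> and leaves a dense
  relation between \<open>y\<close> and \<open>z\<close>; a second use fixes \<open>Y\<close> and
  leaves linearly many common \<open>z\<close>, any \<open>M\<close> of which will do. The three
  sets may still overlap; disjointness comes later from the irreflexivity of edges.\<close>

lemma dense_triples_complete_tripartite:
  fixes \<delta> :: real
  assumes "\<delta> > 0"
  shows "\<exists>n0. \<forall>(V :: 'a set) R. finite V \<and> card V \<ge> n0 \<and>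
      (\<Sum>x\<in>V. \<Sum>y\<in>V. \<Sum>z\<in>V. of_bool (R x y z)) \<ge> \<delta> * real (card V) ^ 3 \<longrightarrow>
      (\<exists>X Y Z. X \<subseteq> V \<and> Y \<subseteq> V \<and> Z \<subseteq> V \<and> card X = M \<and> card Y = M \<and> card Z = M \<and>
         (\<forall>x\<in>X. \<forall>y\<in>Y. \<forall>z\<in>Z. R x y z))"
proof -
  define N1 where "N1 = nat \<lceil>2 * real M / \<delta>\<rceil> + 1"
  define \<delta>1 where "\<delta>1 = \<delta> / 2 / 2 ^ N1"
  define N2 where "N2 = nat \<lceil>2 * real M / \<delta>1\<rceil> + 1"
  define \<delta>2 where "\<delta>2 = \<delta>1 / 2 / 2 ^ N2"
  define n0 where "n0 = N1 + N2 + nat \<lceil>real M / \<delta>2\<rceil> + 1"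
  have d1: "\<delta>1 > 0" and d2: "\<delta>2 > 0" using assms by (auto simp: \<delta>1_def \<delta>2_def)
  have N1: "real N1 \<ge> 2 * real M / \<delta>" "N1 \<ge> 1" unfolding N1_def by linarith+
  have N2: "real N2 \<ge> 2 * real M / \<delta>1" "N2 \<ge> 1" unfolding N2_def by linarith+
  show ?thesis
  proof (intro exI[of _ n0] allI impI, elim conjE)
    fix V :: "'a set" and R
    assume V: "finite V" "card V \<ge> n0"
      and dense: "(\<Sum>x\<in>V. \<Sum>y\<in>V. \<Sum>z\<in>V. of_bool (R x y z)) \<ge> \<delta> * real (card V) ^ 3"
    have n: "card V \<ge> N1" "card V \<ge> N2" "real (card V) \<ge> real M / \<delta>2" "V \<noteq> {}"
      using V(2) unfolding n0_def by (linarith | force)+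
    define Q where "Q x p = R x (fst p) (snd p)" for x and p :: "'a \<times> 'a"
    have "\<delta> * real (card V) * real (card (V \<times> V)) \<le> (\<Sum>x\<in>V. \<Sum>p\<in>V\<times>V. of_bool (Q x p))"
      using dense by (simp add: Q_def sum.cartesian_product card_cartesian_product power3_eq_cube
          mult.assoc case_prod_beta)
    then obtain X where X: "X \<subseteq> V" "card X = M"
      "real (card {p\<in>V\<times>V. \<forall>x\<in>X. Q x p}) \<ge> \<delta>1 * real (card (V \<times> V))"
      using dense_relation_common_neighbours[of V "V \<times> V" \<delta> N1 M Q] V n N1 assms
      unfolding \<delta>1_def by auto
    have "(\<Sum>y\<in>V. \<Sum>z\<in>V. of_bool (\<forall>x\<in>X. R x y z)) = (\<Sum>p\<in>V\<times>V. of_bool (\<forall>x\<in>X. Q x p) :: real)"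
      by (simp add: Q_def sum.cartesian_product case_prod_beta)
    also have "\<dots> = real (card {p\<in>V\<times>V. \<forall>x\<in>X. Q x p})"
      using V by (simp add: Int_def)
    finally have "\<delta>1 * real (card V) * real (card V) \<le> (\<Sum>y\<in>V. \<Sum>z\<in>V. of_bool (\<forall>x\<in>X. R x y z))"
      using X(3) by (simp add: card_cartesian_product mult.assoc)
    then obtain Y where Y: "Y \<subseteq> V" "card Y = M"
      "real (card {z\<in>V. \<forall>y\<in>Y. \<forall>x\<in>X. R x y z}) \<ge> \<delta>2 * real (card V)"
      using dense_relation_common_neighbours[of V V \<delta>1 N2 M "\<lambda>y z. \<forall>x\<in>X. R x y z"] V n N2 d1
      unfolding \<delta>2_def by auto
    have "real M \<le> \<delta>2 * real (card V)" using n(3) d2 by (simp add: field_simps)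
    then have "M \<le> card {z\<in>V. \<forall>y\<in>Y. \<forall>x\<in>X. R x y z}" using Y(3) by linarith
    then obtain Z where "Z \<subseteq> {z\<in>V. \<forall>y\<in>Y. \<forall>x\<in>X. R x y z}" "card Z = M"
      by (meson obtain_subset_with_card_n)
    then show "\<exists>X Y Z. X \<subseteq> V \<and> Y \<subseteq> V \<and> Z \<subseteq> V \<and> card X = M \<and> card Y = M \<and> card Z = M \<and>
         (\<forall>x\<in>X. \<forall>y\<in>Y. \<forall>z\<in>Z. R x y z)"
      using X Y by (intro exI[of _ X] exI[of _ Y] exI[of _ Z]) auto
  qed
qed

section \<open>Hall's theorem and its form for bounded degrees\<close>

lemma Hall:
  assumes "finite I" "\<And>i. i \<in> I \<Longrightarrow> finite (A i)"
    and "\<And>J. J \<subseteq> I \<Longrightarrow> card J \<le> card (\<Union>(A ` J))"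
  shows "\<exists>f. inj_on f I \<and> (\<forall>i\<in>I. f i \<in> A i)"
  using assms
proof (induction "\<Sum>i\<in>I. card (A i)" arbitrary: A rule: less_induct)
  case less
  note fin = less.prems(1,2) and hall = less.prems(3)
  show ?case
  proof (cases "\<exists>i\<in>I. card (A i) \<noteq> 1")
    case False
    then have "\<forall>i\<in>I. \<exists>x. A i = {x}" by (simp add: card_1_singleton_iff)
    then obtain f where f: "\<And>i. i \<in> I \<Longrightarrow> A i = {f i}" by metis
    have "inj_on f I"
    proof (rule inj_onI, rule ccontr)
      fix i j assume ij: "i \<in> I" "j \<in> I" "f i = f j" "i \<noteq> j"
      then have "card {i, j} \<le> card (\<Union>(A ` {i, j}))" by (intro hall) auto
      then show False using ij f by simp
    qed
    then show ?thesis using f by auto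
  next
    case True
    then obtain i where i: "i \<in> I" "card (A i) \<noteq> 1" by blast
    have "card (A i) \<ge> 1" using hall[of "{i}"] i by simp
    then have "card (A i) \<ge> 2" using i by linarith
    then obtain x y where xy: "x \<in> A i" "y \<in> A i" "x \<noteq> y"
      by (metis card_le_Suc0_iff_eq fin(2) i(1) not_less_eq_eq numeral_2_eq_2)
    \<comment> \<open>Rado: for one of any two elements of \<open>A i\<close>, removing it preserves Hall's condition.\<close>
    define B where "B u = A(i := A i - {u})" for u
    have Bsub: "B u j \<subseteq> A j" for u j by (auto simp: B_def)
    have step: "\<exists>f. inj_on f I \<and> (\<forall>i\<in>I. f i \<in> A i)"
      if u: "u \<in> A i" and H: "\<And>J. J \<subseteq> I \<Longrightarrow> card J \<le> card (\<Union>(B u ` J))" for u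
    proof -
      have "(\<Sum>j\<in>I. card (B u j)) < (\<Sum>j\<in>I. card (A j))"
      proof (rule sum_strict_mono_ex1)
        show "\<forall>j\<in>I. card (B u j) \<le> card (A j)" using Bsub fin(2) by (simp add: card_mono)
        have "card (B u i) < card (A i)"
          unfolding B_def using u fin(2)[OF i(1)] by (simp add: card_Diff1_less del: card_Diff_insert)
        then show "\<exists>j\<in>I. card (B u j) < card (A j)" using i by blast
      qed (use fin in auto)
      then have "\<exists>f. inj_on f I \<and> (\<forall>i\<in>I. f i \<in> B u i)"
        using H by (intro less.hyps[of "B u"]) (auto intro: finite_subset[OF Bsub] fin)
      then show ?thesis using Bsub by blast
    qed
    show ?thesis
    proof (rule ccontr)
      assume "\<not> ?thesis"
      with step xy obtain J1 J2 where J: "J1 \<subseteq> I" "J2 \<subseteq> I"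
        "card J1 > card (\<Union>(B x ` J1))" "card J2 > card (\<Union>(B y ` J2))"
        by (meson not_le)
      have iJ: "i \<in> J1" "i \<in> J2"
      proof -
        have "\<Union>(B x ` J1) = \<Union>(A ` J1)" if "i \<notin> J1" using that by (auto simp: B_def)
        then show "i \<in> J1" using hall[OF J(1)] J(3) by force
        have "\<Union>(B y ` J2) = \<Union>(A ` J2)" if "i \<notin> J2" using that by (auto simp: B_def)
        then show "i \<in> J2" using hall[OF J(2)] J(4) by force
      qed
      let ?U = "\<Union>(B x ` J1)" and ?W = "\<Union>(B y ` J2)"
      have finU: "finite ?U" "finite ?W" "finite J1" "finite J2"
        using J finite_subset[OF J(1) fin(1)] finite_subset[OF J(2) fin(1)]
        by (auto intro!: finite_subset[OF Bsub] fin(2))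
      \<comment> \<open>Both index sets contain \<open>i\<close>, and \<open>x\<close>,
        \<open>y\<close> differ, so nothing is lost on the union; on the intersection only
        \<open>i\<close> has to be dropped. Hall's condition for these two index sets gives
        \<open>card ?U + card ?W \<ge> card J1 + card J2 - 1\<close>, whereas the two failures give
        at most \<open>card J1 + card J2 - 2\<close>.\<close>
      have "\<Union>(A ` (J1 \<union> J2)) = ?U \<union> ?W"
        using iJ xy unfolding B_def by (auto split: if_splits)
      then have 1: "card (J1 \<union> J2) \<le> card (?U \<union> ?W)" using hall[of "J1 \<union> J2"] J by simp
      have "\<Union>(A ` (J1 \<inter> J2 - {i})) \<subseteq> ?U \<inter> ?W" unfolding B_def by auto
      then have "card (\<Union>(A ` (J1 \<inter> J2 - {i}))) \<le> card (?U \<inter> ?W)" using finU by (meson card_mono finite_Int)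
      then have 2: "card (J1 \<inter> J2 - {i}) \<le> card (?U \<inter> ?W)"
        using hall[of "J1 \<inter> J2 - {i}"] J(1) by fastforce
      have "card (J1 \<inter> J2 - {i}) + 1 = card (J1 \<inter> J2)" using iJ finU
        by (metis Int_iff Suc_eq_plus1 card.remove finite_Int)
      then show False using 1 2 J(3,4) card_Un_Int[OF finU(1,2)] card_Un_Int[OF finU(3,4)] by linarith
    qed
  qed
qed

text \<open>Double counting of the pairs \<open>(i, v)\<close> with \<open>v \<in> A i\<close>:
  indices have degree at least \<open>a\<close> and points at most \<open>a\<close>, so no set of
  indices outnumbers its neighbourhood.\<close>

lemma Hall_bounded_degree:
  fixes a :: real
  assumes "finite I" "\<And>i. i \<in> I \<Longrightarrow> finite (A i)" "a > 0"
    and large: "\<And>i. i \<in> I \<Longrightarrow> a \<le> real (card (A i))"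
    and deg: "\<And>v. v \<in> \<Union>(A ` I) \<Longrightarrow> real (card {i\<in>I. v \<in> A i}) \<le> a"
  shows "\<exists>f. inj_on f I \<and> (\<forall>i\<in>I. f i \<in> A i)"
proof (rule Hall)
  fix J assume J: "J \<subseteq> I"
  then have fJ: "finite J" using assms(1) finite_subset by blast
  let ?U = "\<Union>(A ` J)"
  have fU: "finite ?U" using J fJ assms(2) by blast
  have "a * real (card J) \<le> (\<Sum>i\<in>J. real (card (A i)))"
    using sum_bounded_below[of J a "\<lambda>i. real (card (A i))"] large J by (auto simp: mult.commute)
  also have "\<dots> = (\<Sum>i\<in>J. \<Sum>v\<in>?U. of_bool (v \<in> A i))"
  proof (rule sum.cong[OF refl])
    fix i assume "i \<in> J"
    then have "?U \<inter> A i = A i" by auto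
    then show "real (card (A i)) = (\<Sum>v\<in>?U. of_bool (v \<in> A i))" using fU by (simp add: Int_def)
  qed
  also have "\<dots> = (\<Sum>v\<in>?U. real (card {i\<in>J. v \<in> A i}))"
    by (subst sum.swap) (simp add: fJ Int_def)
  also have "\<dots> \<le> (\<Sum>v\<in>?U. a)"
  proof (rule sum_mono)
    fix v assume v: "v \<in> ?U"
    have "card {i\<in>J. v \<in> A i} \<le> card {i\<in>I. v \<in> A i}" using J assms(1) by (intro card_mono) auto
    then show "real (card {i\<in>J. v \<in> A i}) \<le> a" using deg[of v] v J by (meson UN_mono order_refl of_nat_le_iff order_trans subsetD)
  qed
  finally have "a * real (card J) \<le> a * real (card ?U)" by (simp add: mult.commute)
  then show "card J \<le> card ?U" using assms(3) by simp
qed (use assms in auto)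

section \<open>Light edges\<close>

text \<open>Edges form a relation on the whole type rather than a set inside \<open>V\<close>, so
  that the vertex set can shrink to a sample while \<open>R\<close> stays the same. The two
  transpositions generate all permutations of the arguments, and with \<open>x \<noteq> y\<close>
  they make all three vertices distinct.\<close>

definition edge_rel :: "('a \<Rightarrow> 'a \<Rightarrow> 'a \<Rightarrow> bool) \<Rightarrow> bool" where
  "edge_rel R \<longleftrightarrow> (\<forall>x y z. R x y z \<longrightarrow> R y x z \<and> R x z y \<and> x \<noteq> y)"

text \<open>A sum of indicators instead of a cardinality: it is visibly additive when the vertex set
  is split into tiles.\<close>

definition codeg :: "'a set \<Rightarrow> ('a \<Rightarrow> 'a \<Rightarrow> 'a \<Rightarrow> bool) \<Rightarrow> 'a \<Rightarrow> 'a \<Rightarrow> real" where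
  "codeg V R x y = (\<Sum>z\<in>V. of_bool (R x y z))"

text \<open>Ordered pairs are counted, so this is twice the size of the link.\<close>
definition deg :: "'a set \<Rightarrow> ('a \<Rightarrow> 'a \<Rightarrow> 'a \<Rightarrow> bool) \<Rightarrow> 'a \<Rightarrow> real" where
  "deg V R x = (\<Sum>y\<in>V. codeg V R x y)"

text \<open>The deviations are bounded only in total, so that the condition survives sampling a bounded
  number of vertices.\<close>
definition nearly_regular ::
    "'a set \<Rightarrow> ('a \<Rightarrow> 'a \<Rightarrow> 'a \<Rightarrow> bool) \<Rightarrow> real \<Rightarrow> real \<Rightarrow> real \<Rightarrow> real \<Rightarrow> bool" where
  "nearly_regular V R D \<epsilon> c \<eta> \<longleftrightarrow>
     (\<Sum>v\<in>V. max 0 (\<bar>deg V R v - D * real (card V) ^ 2\<bar> - \<epsilon> * D * real (card V) ^ 2)) \<le> \<eta> * real (card V) ^ 3 \<and>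
     (\<Sum>x\<in>V. \<Sum>y\<in>V. of_bool (x \<noteq> y) * max 0 (c * real (card V) - codeg V R x y)) \<le> \<eta> * real (card V) ^ 3"

lemma codeg_nonneg: "codeg V R x y \<ge> 0"
  by (simp add: codeg_def sum_nonneg)

lemma edge_relD:
  assumes "edge_rel R" "R x y z"
  shows "R x z y" "R y x z" "R y z x" "R z x y" "R z y x" "x \<noteq> y" "x \<noteq> z" "y \<noteq> z"
  using assms unfolding edge_rel_def by metis+

lemma edge_rel_commute:
  assumes "edge_rel R"
  shows "R x y z = R y x z" "R x y z = R x z y"
  using edge_relD[OF assms] by blast+

text \<open>Over the ordered edges, \<open>\<psi>\<close> sums to \<open>m\<close> times the sum of
  \<open>f v * d v\<close>, minus \<open>(s - t) / 2\<close> times the sum of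
  \<open>\<bar>f x - f y\<bar>\<close> weighted by codegrees. The bound on
  \<open>m * \<epsilon> * D\<close> lets the second term swallow what irregular degrees add to the
  first; \<open>err\<close> handles the exceptional deviations, whose weight is at most
  \<open>B\<close>. The 24 is 4 (edges against \<open>D * n ^ 3\<close>) times 3 (light edges among
  all) times 2 (order of \<open>x\<close> and \<open>y\<close>).\<close>

lemma many_light_triples:
  fixes V :: "'a set" and f :: "'a \<Rightarrow> real" and D \<epsilon> c \<eta> B \<eta>1 :: real and s t r :: nat
  defines "m \<equiv> real (s + t + r)" and "n \<equiv> real (card V)" and "\<mu> \<equiv> sum f V / real (card V)"
  assumes R: "edge_rel R" and V: "finite V" "V \<noteq> {}" and st: "s > t"
    and reg: "nearly_regular V R D \<epsilon> c \<eta>"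
    and f: "\<And>v. v \<in> V \<Longrightarrow> 0 \<le> f v \<and> f v \<le> B"
    and par: "D > 0" "c > 0" "0 \<le> \<epsilon>" "\<epsilon> \<le> 1/2" "m * \<epsilon> * D \<le> c / 2" "0 \<le> \<eta>" "\<eta> \<le> D / 4" "0 < \<eta>1" "\<eta>1 \<le> 1"
    and err: "(m + real (s - t) / 2) * \<eta> * B \<le> \<eta>1 * m * \<mu> * (D / 4)"
  shows "(\<Sum>x\<in>V. \<Sum>y\<in>V. \<Sum>z\<in>V. of_bool (R x y z \<and> real s * f x + real t * f y + real r * f z \<le> m * \<mu> * (1 + 2 * \<eta>1)))
      \<ge> D * \<eta>1 / 24 * n ^ 3"
proof -
  define I where "I x y z = (of_bool (R x y z) :: real)" for x y z
  define d where "d = deg V R"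
  define E where "E = (\<Sum>x\<in>V. \<Sum>y\<in>V. \<Sum>z\<in>V. I x y z)"
  define g where "g v = f v - \<mu>" for v
  define \<psi> where "\<psi> x y z = (real s + real t) / 2 * (f x + f y) - (real s - real t) / 2 * \<bar>f x - f y\<bar> + real r * f z" for x y z
  \<comment> \<open>\<open>\<psi> x y z = s * min (f x) (f y) + t * max (f x) (f y) + r * f z\<close>\<close>
  define \<tau> where "\<tau> = m * \<mu> * (1 + 2 * \<eta>1)"
  have n0: "n > 0" using V by (simp add: n_def card_gt_0_iff)
  have mu0: "\<mu> \<ge> 0" using f by (auto simp: \<mu>_def intro!: divide_nonneg_nonneg sum_nonneg)
  have B0: "B \<ge> 0" using f V by fastforce
  have muB: "\<mu> \<le> B" using sum_bounded_above[of V f B] f V n0 by (auto simp: \<mu>_def n_def field_simps)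
  have sf: "sum f V = n * \<mu>" using n0 by (simp add: \<mu>_def n_def)
  have m1: "m > 0" using st by (simp add: m_def)
  have dsum: "d x = (\<Sum>y\<in>V. \<Sum>z\<in>V. I x y z)" for x by (simp add: d_def deg_def codeg_def I_def)
  have cod: "codeg V R x y = (\<Sum>z\<in>V. I x y z)" for x y by (simp add: codeg_def I_def)
  have I1: "I x y z = I y x z" for x y z
    unfolding I_def using edge_rel_commute(1)[OF R, of x y z] by simp
  have I2: "I x y z = I x z y" for x y z
    unfolding I_def using edge_rel_commute(2)[OF R, of x y z] by simp
  have Ed: "E = (\<Sum>x\<in>V. d x)" by (simp add: E_def dsum)
  have sx: "(\<Sum>x\<in>V. \<Sum>y\<in>V. \<Sum>z\<in>V. I x y z * f x) = (\<Sum>v\<in>V. f v * d v)"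
    unfolding dsum by (simp add: sum_distrib_left mult.commute)
  have sy: "(\<Sum>x\<in>V. \<Sum>y\<in>V. \<Sum>z\<in>V. I x y z * f y) = (\<Sum>v\<in>V. f v * d v)"
  proof -
    have "(\<Sum>x\<in>V. \<Sum>y\<in>V. \<Sum>z\<in>V. I x y z * f y) = (\<Sum>y\<in>V. \<Sum>x\<in>V. \<Sum>z\<in>V. I y x z * f y)"
      by (subst sum.swap) (simp only: I1)
    then show ?thesis using sx by simp
  qed
  have sz: "(\<Sum>x\<in>V. \<Sum>y\<in>V. \<Sum>z\<in>V. I x y z * f z) = (\<Sum>v\<in>V. f v * d v)"
  proof -
    have "(\<Sum>x\<in>V. \<Sum>y\<in>V. \<Sum>z\<in>V. I x y z * f z) = (\<Sum>x\<in>V. \<Sum>z\<in>V. \<Sum>y\<in>V. I x y z * f z)"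
      by (intro sum.cong refl sum.swap)
    also have "\<dots> = (\<Sum>x\<in>V. \<Sum>z\<in>V. \<Sum>y\<in>V. I x z y * f z)"
      using I2 by (intro sum.cong refl) simp
    finally show ?thesis using sy by simp
  qed
  have sxy: "(\<Sum>x\<in>V. \<Sum>y\<in>V. \<Sum>z\<in>V. I x y z * \<bar>f x - f y\<bar>) = (\<Sum>x\<in>V. \<Sum>y\<in>V. \<bar>f x - f y\<bar> * codeg V R x y)"
    by (simp add: cod sum_distrib_right mult.commute)
  have "(\<Sum>x\<in>V. \<Sum>y\<in>V. \<Sum>z\<in>V. I x y z * \<psi> x y z) =
     (\<Sum>x\<in>V. \<Sum>y\<in>V. \<Sum>z\<in>V. (real s + real t) / 2 * (I x y z * f x) + (real s + real t) / 2 * (I x y z * f y)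
        - (real s - real t) / 2 * (I x y z * \<bar>f x - f y\<bar>) + real r * (I x y z * f z))"
    by (intro sum.cong refl) (simp add: \<psi>_def field_simps)
  also have "\<dots> = (real s + real t) / 2 * (\<Sum>v\<in>V. f v * d v) + (real s + real t) / 2 * (\<Sum>v\<in>V. f v * d v)
      - (real s - real t) / 2 * (\<Sum>x\<in>V. \<Sum>y\<in>V. \<bar>f x - f y\<bar> * codeg V R x y) + real r * (\<Sum>v\<in>V. f v * d v)"
    by (simp only: sum.distrib sum_subtractf sum_distrib_left[symmetric] sx sy sz sxy)
  also have "\<dots> = m * (\<Sum>v\<in>V. f v * d v) - (real s - real t) / 2 * (\<Sum>x\<in>V. \<Sum>y\<in>V. \<bar>f x - f y\<bar> * codeg V R x y)"
    by (simp add: m_def field_simps)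
  finally have psum: "(\<Sum>x\<in>V. \<Sum>y\<in>V. \<Sum>z\<in>V. I x y z * \<psi> x y z) =
     m * (\<Sum>v\<in>V. f v * d v) - (real s - real t) / 2 * (\<Sum>x\<in>V. \<Sum>y\<in>V. \<bar>f x - f y\<bar> * codeg V R x y)" .
  define ex where "ex v = max 0 (\<bar>d v - D * n ^ 2\<bar> - \<epsilon> * D * n ^ 2)" for v
  define cx where "cx x y = (of_bool (x \<noteq> y) * max 0 (c * n - codeg V R x y))" for x y
  have exs: "(\<Sum>v\<in>V. ex v) \<le> \<eta> * n ^ 3" and cxs: "(\<Sum>x\<in>V. \<Sum>y\<in>V. cx x y) \<le> \<eta> * n ^ 3"
    using reg by (auto simp: nearly_regular_def ex_def cx_def d_def n_def)
  have gB: "\<bar>g v\<bar> \<le> B" if "v \<in> V" for v using f[OF that] mu0 muB by (auto simp: g_def)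
  have sg: "(\<Sum>v\<in>V. g v) = 0" using sf n0 by (simp add: g_def sum_subtractf n_def)
  \<comment> \<open>Because \<open>g\<close> has sum 0, the constant \<open>D * n ^ 2\<close> can be
    subtracted from every degree: only deviations of degrees meet deviations of
    \<open>f\<close>.\<close>
  have "(\<Sum>v\<in>V. f v * d v) = \<mu> * E + (\<Sum>v\<in>V. g v * (d v - D * n ^ 2))"
  proof -
    have "(\<Sum>v\<in>V. g v * (d v - D * n ^ 2)) = (\<Sum>v\<in>V. f v * d v) - (\<Sum>v\<in>V. \<mu> * d v) - (\<Sum>v\<in>V. g v * (D * n ^ 2))"
      by (simp add: g_def algebra_simps sum_subtractf sum.distrib)
    also have "(\<Sum>v\<in>V. \<mu> * d v) = \<mu> * E" by (simp add: Ed sum_distrib_left)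
    also have "(\<Sum>v\<in>V. g v * (D * n ^ 2)) = 0" using sg by (simp flip: sum_distrib_right)
    finally show ?thesis by simp
  qed
  also have "(\<Sum>v\<in>V. g v * (d v - D * n ^ 2)) \<le> (\<Sum>v\<in>V. \<bar>g v\<bar> * (\<epsilon> * D * n ^ 2) + B * ex v)"
  proof (rule sum_mono)
    fix v assume v: "v \<in> V"
    have "g v * (d v - D * n ^ 2) \<le> \<bar>g v\<bar> * \<bar>d v - D * n ^ 2\<bar>" by (metis abs_ge_self abs_mult)
    also have "\<dots> \<le> \<bar>g v\<bar> * (\<epsilon> * D * n ^ 2 + ex v)" by (intro mult_left_mono) (auto simp: ex_def)
    also have "\<dots> \<le> \<bar>g v\<bar> * (\<epsilon> * D * n ^ 2) + B * ex v"
      using gB[OF v] mult_right_mono[of "\<bar>g v\<bar>" B "ex v"] by (simp add: ex_def distrib_left)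
    finally show "g v * (d v - D * n ^ 2) \<le> \<bar>g v\<bar> * (\<epsilon> * D * n ^ 2) + B * ex v" .
  qed
  also have "\<dots> = (\<epsilon> * D * n ^ 2) * (\<Sum>v\<in>V. \<bar>g v\<bar>) + B * (\<Sum>v\<in>V. ex v)"
    by (simp add: sum.distrib sum_distrib_left sum_distrib_right mult.commute)
  also have "\<dots> \<le> (\<epsilon> * D * n ^ 2) * (\<Sum>v\<in>V. \<bar>g v\<bar>) + B * (\<eta> * n ^ 3)"
    using exs B0 by (simp add: mult_left_mono)
  finally have fd: "(\<Sum>v\<in>V. f v * d v) \<le> \<mu> * E + ((\<epsilon> * D * n ^ 2) * (\<Sum>v\<in>V. \<bar>g v\<bar>) + B * (\<eta> * n ^ 3))" by simp
  \<comment> \<open>Up to sign, \<open>n * g x\<close> is the sum of \<open>f x - f y\<close> over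
    all \<open>y\<close>, so the mean deviation is bounded by the differences over pairs. Codegrees
    of at least \<open>c * n\<close>, up to the defect \<open>cx\<close>, then make these
    differences visible on edges.\<close>
  have "c * n * (n * (\<Sum>v\<in>V. \<bar>g v\<bar>)) \<le> c * n * (\<Sum>x\<in>V. \<Sum>y\<in>V. \<bar>f x - f y\<bar>)"
  proof (rule mult_left_mono)
    have "n * \<bar>g x\<bar> \<le> (\<Sum>y\<in>V. \<bar>f x - f y\<bar>)" for x
    proof -
      have "n * g x = (\<Sum>y\<in>V. f x - f y)" using sf by (simp add: g_def sum_subtractf n_def algebra_simps)
      then have "n * \<bar>g x\<bar> = \<bar>\<Sum>y\<in>V. f x - f y\<bar>" using n0 by (metis abs_mult abs_of_pos)
      then show ?thesis using sum_abs by metis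
    qed
    then show "n * (\<Sum>v\<in>V. \<bar>g v\<bar>) \<le> (\<Sum>x\<in>V. \<Sum>y\<in>V. \<bar>f x - f y\<bar>)"
      by (simp add: sum_distrib_left sum_mono)
  qed (use par n0 in auto)
  also have "\<dots> = (\<Sum>x\<in>V. \<Sum>y\<in>V. \<bar>f x - f y\<bar> * (c * n))" by (simp add: sum_distrib_left mult.commute)
  also have "\<dots> \<le> (\<Sum>x\<in>V. \<Sum>y\<in>V. \<bar>f x - f y\<bar> * codeg V R x y + B * cx x y)"
  proof (intro sum_mono)
    fix x y assume xy: "x \<in> V" "y \<in> V"
    have fb: "\<bar>f x - f y\<bar> \<le> B" using f[OF xy(1)] f[OF xy(2)] by auto
    have "\<bar>f x - f y\<bar> * (c * n) \<le> \<bar>f x - f y\<bar> * (codeg V R x y + cx x y)"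
      by (cases "x = y") (auto intro!: mult_left_mono simp: cx_def)
    also have "\<dots> \<le> \<bar>f x - f y\<bar> * codeg V R x y + B * cx x y"
      using fb mult_right_mono[of "\<bar>f x - f y\<bar>" B "cx x y"] by (simp add: cx_def distrib_left)
    finally show "\<bar>f x - f y\<bar> * (c * n) \<le> \<bar>f x - f y\<bar> * codeg V R x y + B * cx x y" .
  qed
  also have "\<dots> = (\<Sum>x\<in>V. \<Sum>y\<in>V. \<bar>f x - f y\<bar> * codeg V R x y) + B * (\<Sum>x\<in>V. \<Sum>y\<in>V. cx x y)"
    by (simp add: sum.distrib sum_distrib_left)
  also have "\<dots> \<le> (\<Sum>x\<in>V. \<Sum>y\<in>V. \<bar>f x - f y\<bar> * codeg V R x y) + B * (\<eta> * n ^ 3)"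
    using cxs B0 by (simp add: mult_left_mono)
  finally have fc: "c * n ^ 2 * (\<Sum>v\<in>V. \<bar>g v\<bar>) \<le> (\<Sum>x\<in>V. \<Sum>y\<in>V. \<bar>f x - f y\<bar> * codeg V R x y) + B * (\<eta> * n ^ 3)"
    by (simp add: power2_eq_square mult.assoc)
  have st1: "real s - real t \<ge> 1" and stm: "real s - real t = real (s - t)" using st by auto
  have sgn: "(\<Sum>v\<in>V. \<bar>g v\<bar>) \<ge> 0" by (simp add: sum_nonneg)
  have El: "E \<ge> D / 4 * n ^ 3"
  proof -
    have "(\<Sum>v\<in>V. D * n ^ 2 / 2 - ex v) \<le> (\<Sum>v\<in>V. d v)"
    proof (rule sum_mono)
      fix v
      have "\<epsilon> * (D * n ^ 2) \<le> 1 / 2 * (D * n ^ 2)" using par by (intro mult_right_mono) auto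
      then show "D * n ^ 2 / 2 - ex v \<le> d v" unfolding ex_def by (auto simp: max_def abs_if split: if_splits)
    qed
    moreover have "(\<Sum>v\<in>V. D * n ^ 2 / 2 - ex v) = D / 2 * n ^ 3 - (\<Sum>v\<in>V. ex v)"
      by (simp add: sum_subtractf n_def power2_eq_square power3_eq_cube)
    moreover have "\<eta> * n ^ 3 \<le> D / 4 * n ^ 3" using par n0 by (intro mult_right_mono) auto
    ultimately show ?thesis using exs Ed by linarith
  qed
  have "(\<Sum>x\<in>V. \<Sum>y\<in>V. \<Sum>z\<in>V. I x y z * \<psi> x y z) \<le> m * \<mu> * E * (1 + \<eta>1)"
  proof -
    define S where "S = (\<Sum>v\<in>V. \<bar>g v\<bar>)"
    define Q where "Q = (\<Sum>x\<in>V. \<Sum>y\<in>V. \<bar>f x - f y\<bar> * codeg V R x y)"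
    have a: "m * (\<Sum>v\<in>V. f v * d v) \<le> m * (\<mu> * E + ((\<epsilon> * D * n ^ 2) * S + B * (\<eta> * n ^ 3)))"
      using fd m1 unfolding S_def by (intro mult_left_mono) auto
    have b: "(real s - real t) / 2 * (c * n ^ 2 * S) \<le> (real s - real t) / 2 * (Q + B * (\<eta> * n ^ 3))"
      using fc st1 unfolding S_def Q_def by (intro mult_left_mono) auto
    have "1 / 2 * (c * n ^ 2 * S) \<le> (real s - real t) / 2 * (c * n ^ 2 * S)"
      using st1 par sgn by (intro mult_right_mono) (auto simp: S_def)
    moreover have "m * \<epsilon> * D * (n ^ 2 * S) \<le> c / 2 * (n ^ 2 * S)"
      using par sgn by (intro mult_right_mono) (auto simp: S_def)
    moreover have "(m + real (s - t) / 2) * \<eta> * B * n ^ 3 \<le> \<eta>1 * m * \<mu> * (D / 4) * n ^ 3"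
      using err n0 by (intro mult_right_mono) auto
    moreover have "\<eta>1 * m * \<mu> * (D / 4 * n ^ 3) \<le> \<eta>1 * m * \<mu> * E"
      using El m1 mu0 par by (intro mult_left_mono) auto
    ultimately have "m * (\<Sum>v\<in>V. f v * d v) - (real s - real t) / 2 * Q \<le> m * \<mu> * E * (1 + \<eta>1)"
      using a b unfolding stm by (simp add: algebra_simps)
    then show ?thesis using psum unfolding Q_def by simp
  qed
  note up = this
  define H where "H = (\<Sum>x\<in>V. \<Sum>y\<in>V. \<Sum>z\<in>V. of_bool (R x y z \<and> \<psi> x y z \<le> \<tau>) :: real)"
  have psi0: "\<psi> x y z \<ge> 0" if "x \<in> V" "y \<in> V" "z \<in> V" for x y z
  proof -
    have "\<psi> x y z = real s * min (f x) (f y) + real t * max (f x) (f y) + real r * f z"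
      by (auto simp: \<psi>_def min_def max_def abs_if field_simps)
    then show ?thesis using f that by (simp add: min_def max_def)
  qed
  \<comment> \<open>Markov's inequality: an edge that is not light contributes more than
    \<open>\<tau>\<close>, while the total is at most \<open>m * \<mu> * E * (1 + \<eta>1)\<close>,
    and the gap between \<open>1 + \<eta>1\<close> and \<open>1 + 2 * \<eta>1\<close> must be filled
    by light edges. For mean 0 there is nothing to divide by, but then \<open>f\<close> vanishes on
    \<open>V\<close> and every edge is light.\<close>
  have Hl: "\<eta>1 / 3 * E \<le> H"
  proof (cases "\<mu> = 0")
    case True
    then have "f v = 0" if "v \<in> V" for v
      using sf V f that sum_nonneg_eq_0_iff[of V f] by auto
    then have "H = E" unfolding H_def E_def I_def \<psi>_def \<tau>_def using True by (intro sum.cong refl) simp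
    moreover have "E \<ge> 0" using El par n0 by (meson divide_nonneg_nonneg less_imp_le mult_nonneg_nonneg order_trans zero_le_numeral zero_le_power)
    ultimately show ?thesis using par mult_right_mono[of "\<eta>1 / 3" 1 E] by simp
  next
    case False
    then have mmu: "m * \<mu> > 0" using mu0 m1 by simp
    have "(\<Sum>x\<in>V. \<Sum>y\<in>V. \<Sum>z\<in>V. \<tau> * I x y z - \<tau> * of_bool (R x y z \<and> \<psi> x y z \<le> \<tau>))
        \<le> (\<Sum>x\<in>V. \<Sum>y\<in>V. \<Sum>z\<in>V. I x y z * \<psi> x y z)"
      using psi0 by (intro sum_mono) (auto simp: I_def)
    then have "\<tau> * E - \<tau> * H \<le> m * \<mu> * E * (1 + \<eta>1)"
      using up by (simp add: sum_subtractf E_def H_def flip: sum_distrib_left)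
    then have "m * \<mu> * ((1 + 2 * \<eta>1) * (E - H)) \<le> m * \<mu> * (E * (1 + \<eta>1))"
      by (simp add: \<tau>_def algebra_simps)
    then have "(1 + 2 * \<eta>1) * (E - H) \<le> E * (1 + \<eta>1)" using mmu by (metis mult_le_cancel_left_pos)
    then have 1: "\<eta>1 * E \<le> (1 + 2 * \<eta>1) * H" by (simp add: algebra_simps)
    have "H \<ge> 0" by (simp add: H_def sum_nonneg)
    then have "(1 + 2 * \<eta>1) * H \<le> 3 * H" using par by (intro mult_right_mono) auto
    then show ?thesis using 1 by linarith
  qed
  define L where "L x y z = (of_bool (R x y z \<and> real s * f x + real t * f y + real r * f z \<le> \<tau>) :: real)" for x y z
  \<comment> \<open>\<open>\<psi>\<close> gives \<open>s\<close> to the lighter of \<open>x\<close>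
    and \<open>y\<close>, whereas a tile needs fixed roles; swapping the first two arguments where
    necessary costs a factor 2.\<close>
  have "H \<le> (\<Sum>x\<in>V. \<Sum>y\<in>V. \<Sum>z\<in>V. L x y z + L y x z)"
    unfolding H_def
  proof (intro sum_mono)
    fix x y z
    have e: "\<psi> x y z = (if f x \<le> f y then real s * f x + real t * f y + real r * f z
        else real s * f y + real t * f x + real r * f z)"
      by (auto simp: \<psi>_def abs_if field_simps)
    then show "of_bool (R x y z \<and> \<psi> x y z \<le> \<tau>) \<le> L x y z + L y x z"
      using edge_rel_commute(1)[OF R, of x y z] by (auto simp: L_def)
  qed
  also have "\<dots> = (\<Sum>x\<in>V. \<Sum>y\<in>V. \<Sum>z\<in>V. L x y z) + (\<Sum>x\<in>V. \<Sum>y\<in>V. \<Sum>z\<in>V. L x y z)"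
    by (simp add: sum.distrib) (rule sum.swap)
  finally have "H \<le> 2 * (\<Sum>x\<in>V. \<Sum>y\<in>V. \<Sum>z\<in>V. L x y z)" by simp
  moreover have "\<eta>1 / 3 * (D / 4 * n ^ 3) \<le> \<eta>1 / 3 * E" using El par by (intro mult_left_mono) auto
  ultimately have "D * \<eta>1 / 24 * n ^ 3 \<le> (\<Sum>x\<in>V. \<Sum>y\<in>V. \<Sum>z\<in>V. L x y z)" using Hl by simp
  then show ?thesis unfolding L_def \<tau>_def .
qed

section \<open>Blown-up tiles\<close>

text \<open>Only the vertex set is recorded, not the partition, since packing concerns vertices
  alone. If \<open>t\<close> or \<open>r\<close> is 0 the edge condition is empty, and any finite
  set of the right size is a tile.\<close>

definition tile :: "('a \<Rightarrow> 'a \<Rightarrow> 'a \<Rightarrow> bool) \<Rightarrow> nat \<Rightarrow> nat \<Rightarrow> nat \<Rightarrow> 'a set \<Rightarrow> bool" where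
  "tile R s t r S \<longleftrightarrow> (\<exists>A B C. S = A \<union> B \<union> C \<and> A \<inter> B = {} \<and> A \<inter> C = {} \<and> B \<inter> C = {} \<and>
     finite S \<and> card A = s \<and> card B = t \<and> card C = r \<and> (\<forall>a\<in>A. \<forall>b\<in>B. \<forall>c\<in>C. R a b c))"

text \<open>There is one class per vertex of the tile, numbered part by part, instead of three large
  parts: a system of distinct representatives of the classes then spans a tile.\<close>

definition blown_tile :: "('a \<Rightarrow> 'a \<Rightarrow> 'a \<Rightarrow> bool) \<Rightarrow> nat \<Rightarrow> nat \<Rightarrow> nat \<Rightarrow> nat \<Rightarrow> (nat \<Rightarrow> 'a set) \<Rightarrow> bool" where
  "blown_tile R s t r M P \<longleftrightarrow> (\<forall>i<s+t+r. finite (P i) \<and> card (P i) = M) \<and>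
     disjoint_family_on P {..<s+t+r} \<and>
     (\<forall>i<s. \<forall>j\<in>{s..<s+t}. \<forall>k\<in>{s+t..<s+t+r}. \<forall>x\<in>P i. \<forall>y\<in>P j. \<forall>z\<in>P k. R x y z)"

lemma tile_card: "tile R s t r S \<Longrightarrow> finite S \<and> card S = s + t + r"
  unfolding tile_def by (auto simp: card_Un_disjoint Int_Un_distrib2)

lemma blown_tile_transversal:
  assumes "blown_tile R s t r M P" "inj_on \<phi> {..<s+t+r}" "\<And>i. i < s + t + r \<Longrightarrow> \<phi> i \<in> P i"
  shows "tile R s t r (\<phi> ` {..<s+t+r})"
  unfolding tile_def
proof (intro exI conjI)
  let ?A = "{..<s}" and ?B = "{s..<s+t}" and ?C = "{s+t..<s+t+r}"
  have U: "{..<s+t+r} = ?A \<union> ?B \<union> ?C" by auto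
  show "\<phi> ` {..<s+t+r} = \<phi> ` ?A \<union> \<phi> ` ?B \<union> \<phi> ` ?C" by (simp only: U image_Un)
  have im: "\<phi> ` Q \<inter> \<phi> ` Q' = {}" if "Q \<subseteq> {..<s+t+r}" "Q' \<subseteq> {..<s+t+r}" "Q \<inter> Q' = {}" for Q Q'
    using inj_on_image_Int[OF assms(2) that(1,2)] that(3) by simp
  have cd: "card (\<phi> ` Q) = card Q" if "Q \<subseteq> {..<s+t+r}" for Q
    using assms(2) that by (meson card_image inj_on_subset)
  show "\<phi> ` ?A \<inter> \<phi> ` ?B = {}" "\<phi> ` ?A \<inter> \<phi> ` ?C = {}" "\<phi> ` ?B \<inter> \<phi> ` ?C = {}" by (rule im; force)+
  show "card (\<phi> ` ?A) = s" "card (\<phi> ` ?B) = t" "card (\<phi> ` ?C) = r" by (subst cd; force)+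
  show "\<forall>a\<in>\<phi> ` ?A. \<forall>b\<in>\<phi> ` ?B. \<forall>c\<in>\<phi> ` ?C. R a b c"
  proof (intro ballI, elim imageE)
    fix a b c i j k assume "a = \<phi> i" "b = \<phi> j" "c = \<phi> k" "i \<in> ?A" "j \<in> ?B" "k \<in> ?C"
    moreover from this have "\<phi> i \<in> P i" "\<phi> j \<in> P j" "\<phi> k \<in> P k" by (auto intro!: assms(3))
    ultimately show "R a b c" using assms(1) unfolding blown_tile_def by blast
  qed
qed auto

lemma disjoint_subsets_of_card:
  assumes "finite X" "k * M \<le> card X"
  shows "\<exists>P. (\<forall>i<k. P i \<subseteq> X \<and> card (P i) = M) \<and> disjoint_family_on P {..<k}"
  using assms
proof (induction k arbitrary: X)
  case 0
  then show ?case by (auto simp: disjoint_family_on_def)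
next
  case (Suc k)
  then obtain Q where Q: "Q \<subseteq> X" "card Q = M"
    by (metis add_leD1 mult_Suc obtain_subset_with_card_n)
  have "k * M \<le> card (X - Q)" using Suc.prems Q by (simp add: card_Diff_subset finite_subset)
  then obtain P where P: "\<forall>i<k. P i \<subseteq> X - Q \<and> card (P i) = M" "disjoint_family_on P {..<k}"
    using Suc.IH[of "X - Q"] Suc.prems by auto
  have "disjoint_family_on (P(k := Q)) {..<Suc k}"
    using P by (fastforce simp: disjoint_family_on_def less_Suc_eq)
  moreover have "\<forall>i<Suc k. (P(k := Q)) i \<subseteq> X \<and> card ((P(k := Q)) i) = M"
    using P Q by (auto simp: less_Suc_eq)
  ultimately show ?case by blast
qed

text \<open>The summand with \<open>card U\<close> pays for the triples that meet the forbidden set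
  \<open>U\<close>. The weight of the whole blow-up is controlled by one triple: the heaviest
  vertices of the three parts form an edge that was itself required to be light, and they dominate
  all other vertices of their parts.\<close>

lemma light_blown_tile:
  fixes \<delta> :: real
  assumes "\<delta> > 0" "M > 0" "s > 0"
  shows "\<exists>n0. \<forall>(V :: 'a set) R f U \<tau>. finite V \<and> card V \<ge> n0 \<and> edge_rel R \<and> U \<subseteq> V \<and>
      (\<Sum>x\<in>V. \<Sum>y\<in>V. \<Sum>z\<in>V. of_bool (R x y z \<and> real s * f x + real t * f y + real r * f z \<le> \<tau>))
        \<ge> \<delta> * real (card V) ^ 3 + 3 * real (card U) * real (card V) ^ 2 \<longrightarrow>
      (\<exists>P. blown_tile R s t r M P \<and> (\<forall>i<s+t+r. P i \<subseteq> V - U) \<and>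
         (\<Sum>i<s+t+r. sum f (P i)) \<le> real M * \<tau>)"
proof -
  define m where "m = s + t + r"
  obtain n0 where n0: "\<forall>(V :: 'a set) R. finite V \<and> card V \<ge> n0 \<and>
      (\<Sum>x\<in>V. \<Sum>y\<in>V. \<Sum>z\<in>V. of_bool (R x y z)) \<ge> \<delta> * real (card V) ^ 3 \<longrightarrow>
      (\<exists>X Y Z. X \<subseteq> V \<and> Y \<subseteq> V \<and> Z \<subseteq> V \<and> card X = m * M \<and> card Y = m * M \<and> card Z = m * M \<and>
         (\<forall>x\<in>X. \<forall>y\<in>Y. \<forall>z\<in>Z. R x y z))"
    using dense_triples_complete_tripartite[OF assms(1), where 'a='a and M="m * M"] by (rule exE)
  show ?thesis
  proof (intro exI[of _ n0] allI impI, elim conjE)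
    fix V :: "'a set" and R f U \<tau>
    assume V: "finite V" "card V \<ge> n0" and R: "edge_rel R" and U: "U \<subseteq> V"
      and dense: "(\<Sum>x\<in>V. \<Sum>y\<in>V. \<Sum>z\<in>V. of_bool (R x y z \<and> real s * f x + real t * f y + real r * f z \<le> \<tau>))
        \<ge> \<delta> * real (card V) ^ 3 + 3 * real (card U) * real (card V) ^ 2"
    define Q where "Q x y z \<longleftrightarrow> R x y z \<and> real s * f x + real t * f y + real r * f z \<le> \<tau>" for x y z
    define Q' where "Q' x y z \<longleftrightarrow> Q x y z \<and> x \<notin> U \<and> y \<notin> U \<and> z \<notin> U" for x y z
    have cU: "(\<Sum>x\<in>V. of_bool (x \<in> U)) = real (card U)"
      using V U by (simp add: Int_absorb1)
    have "(\<Sum>x\<in>V. \<Sum>y\<in>V. \<Sum>z\<in>V. of_bool (Q x y z)) \<le> (\<Sum>x\<in>V. \<Sum>y\<in>V. \<Sum>z\<in>V. of_bool (Q' x y z) +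
       of_bool (x \<in> U) + of_bool (y \<in> U) + (of_bool (z \<in> U) :: real))"
      by (intro sum_mono) (auto simp: Q'_def)
    also have "\<dots> = (\<Sum>x\<in>V. \<Sum>y\<in>V. \<Sum>z\<in>V. of_bool (Q' x y z)) + 3 * real (card U) * real (card V) ^ 2"
      by (simp only: sum.distrib sum_constant cU sum_distrib_left[symmetric])
        (simp add: power2_eq_square)
    finally have "\<delta> * real (card V) ^ 3 \<le> (\<Sum>x\<in>V. \<Sum>y\<in>V. \<Sum>z\<in>V. of_bool (Q' x y z))"
      using dense by (simp add: Q_def)
    then have "\<exists>X Y Z. X \<subseteq> V \<and> Y \<subseteq> V \<and> Z \<subseteq> V \<and> card X = m * M \<and> card Y = m * M \<and> card Z = m * M \<and>
         (\<forall>x\<in>X. \<forall>y\<in>Y. \<forall>z\<in>Z. Q' x y z)"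
      using V by (intro n0[rule_format] conjI)
    then obtain X Y Z where XYZ: "X \<subseteq> V" "Y \<subseteq> V" "Z \<subseteq> V" "card X = m * M" "card Y = m * M" "card Z = m * M"
       "\<And>x y z. x \<in> X \<Longrightarrow> y \<in> Y \<Longrightarrow> z \<in> Z \<Longrightarrow> Q' x y z"
      by auto
    have mM: "m * M > 0" using assms by (simp add: m_def)
    have fin: "finite X" "finite Y" "finite Z" and ne: "X \<noteq> {}" "Y \<noteq> {}" "Z \<noteq> {}"
      using XYZ V mM by (auto intro: finite_subset)
    have mx: "\<exists>w\<in>W. \<forall>v\<in>W. f v \<le> f w" if "finite W" "W \<noteq> {}" for W
      using that Max_in[of "f ` W"] Max_ge[of "f ` W"] by (metis (no_types, lifting) finite_imageI image_iff image_is_empty)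
    obtain x0 y0 z0 where x0: "x0 \<in> X" "\<forall>v\<in>X. f v \<le> f x0" and y0: "y0 \<in> Y" "\<forall>v\<in>Y. f v \<le> f y0"
       and z0: "z0 \<in> Z" "\<forall>v\<in>Z. f v \<le> f z0" using mx[OF fin(1) ne(1)] mx[OF fin(2) ne(2)] mx[OF fin(3) ne(3)] by blast
    have light: "real s * f x0 + real t * f y0 + real r * f z0 \<le> \<tau>"
      using XYZ(7)[OF x0(1) y0(1) z0(1)] by (simp add: Q'_def Q_def)
    \<comment> \<open>Any two vertices from different parts, together with a chosen vertex of the
      third, form an edge outside \<open>U\<close>. Hence the parts are disjoint from each other and
      from \<open>U\<close>.\<close>
    have Q3: "x \<noteq> y \<and> x \<noteq> z \<and> y \<noteq> z \<and> x \<notin> U \<and> y \<notin> U \<and> z \<notin> U" if "x \<in> X" "y \<in> Y" "z \<in> Z" for x y z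
      using XYZ(7)[OF that] edge_relD(6-8)[OF R, of x y z] unfolding Q'_def Q_def by simp
    have dis: "X \<inter> Y = {}" "X \<inter> Z = {}" "Y \<inter> Z = {}"
      using Q3[OF _ _ z0(1)] Q3[OF _ y0(1)] Q3[OF x0(1)] by blast+
    have XU: "X \<inter> U = {}" "Y \<inter> U = {}" "Z \<inter> U = {}"
      using Q3[OF _ y0(1) z0(1)] Q3[OF x0(1) _ z0(1)] Q3[OF x0(1) y0(1)] by blast+
    have le: "m * M \<le> card X" "m * M \<le> card Y" "m * M \<le> card Z" using XYZ by auto
    obtain PX where PX: "\<forall>i<m. PX i \<subseteq> X \<and> card (PX i) = M" "disjoint_family_on PX {..<m}"
      using disjoint_subsets_of_card[OF fin(1) le(1)] by blast
    obtain PY where PY: "\<forall>i<m. PY i \<subseteq> Y \<and> card (PY i) = M" "disjoint_family_on PY {..<m}"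
      using disjoint_subsets_of_card[OF fin(2) le(2)] by blast
    obtain PZ where PZ: "\<forall>i<m. PZ i \<subseteq> Z \<and> card (PZ i) = M" "disjoint_family_on PZ {..<m}"
      using disjoint_subsets_of_card[OF fin(3) le(3)] by blast
    \<comment> \<open>Each part was cut into \<open>m\<close> classes, more than it has to supply,
      so that one index range serves all three.\<close>
    define P where "P i = (if i < s then PX i else if i < s + t then PY i else PZ i)" for i
    have P1: "P i \<subseteq> V - U \<and> finite (P i) \<and> card (P i) = M" if "i < m" for i
    proof -
      have "P i \<subseteq> V - U \<and> card (P i) = M"
        using that PX(1) PY(1) PZ(1) XYZ(1-3) XU unfolding P_def
        by (simp split: if_split) blast
      then show ?thesis using V(1) by (meson Diff_subset finite_subset)
    qed
    have P2: "disjoint_family_on P {..<m}"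
    proof -
      have "P i \<inter> P j = {}" if "i < m" "j < m" "i \<noteq> j" for i j
      proof -
        have "PX i \<inter> PX j = {}" "PY i \<inter> PY j = {}" "PZ i \<inter> PZ j = {}"
          using PX(2) PY(2) PZ(2) that by (auto simp: disjoint_family_on_def)
        moreover have "PX i \<subseteq> X" "PX j \<subseteq> X" "PY i \<subseteq> Y" "PY j \<subseteq> Y" "PZ i \<subseteq> Z" "PZ j \<subseteq> Z"
          using PX(1) PY(1) PZ(1) that by auto
        ultimately show ?thesis unfolding P_def using dis by auto
      qed
      then show ?thesis by (auto simp: disjoint_family_on_def)
    qed
    have P3: "R x y z" if "i < s" "j \<in> {s..<s+t}" "k \<in> {s+t..<m}" "x \<in> P i" "y \<in> P j" "z \<in> P k" for i j k x y z
    proof -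
      have "i < m" "j < m" "k < m" using that by (auto simp: m_def)
      then have "x \<in> X" "y \<in> Y" "z \<in> Z" using that PX(1)[rule_format, of i] PY(1)[rule_format, of j] PZ(1)[rule_format, of k]
        by (auto simp: P_def)
      then show ?thesis using XYZ(7) by (simp add: Q'_def Q_def)
    qed
    have bt: "blown_tile R s t r M P"
      using P1 P2 P3 by (auto simp: blown_tile_def m_def)
    have blk: "(\<Sum>i<s+t+r. sum f (P i)) = (\<Sum>i\<in>{..<s}. sum f (P i)) + (\<Sum>i\<in>{s..<s+t}. sum f (P i)) + (\<Sum>i\<in>{s+t..<s+t+r}. sum f (P i))"
      by (metis (no_types, lifting) atLeast0LessThan le_add1 sum.atLeastLessThan_concat zero_le)
    have b: "(\<Sum>i\<in>W. sum f (P i)) \<le> real (card W) * (real M * a)"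
      if "\<And>i. i \<in> W \<Longrightarrow> i < m" "\<And>i v. i \<in> W \<Longrightarrow> v \<in> P i \<Longrightarrow> f v \<le> a" for W a
    proof (rule sum_bounded_above)
      fix i assume "i \<in> W"
      then show "sum f (P i) \<le> real M * a"
        using sum_bounded_above[of "P i" f a] that P1 by simp
    qed
    have "(\<Sum>i\<in>{..<s}. sum f (P i)) \<le> real (card {..<s}) * (real M * f x0)"
    proof (rule b)
      fix i v assume "i \<in> {..<s}" "v \<in> P i"
      then show "f v \<le> f x0" using PX(1)[rule_format, of i] x0 by (auto simp: P_def m_def)
    qed (auto simp: m_def)
    moreover have "(\<Sum>i\<in>{s..<s+t}. sum f (P i)) \<le> real (card {s..<s+t}) * (real M * f y0)"
    proof (rule b)
      fix i v assume "i \<in> {s..<s+t}" "v \<in> P i"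
      then show "f v \<le> f y0" using PY(1)[rule_format, of i] y0 by (auto simp: P_def m_def)
    qed (auto simp: m_def)
    moreover have "(\<Sum>i\<in>{s+t..<s+t+r}. sum f (P i)) \<le> real (card {s+t..<s+t+r}) * (real M * f z0)"
    proof (rule b)
      fix i v assume "i \<in> {s+t..<s+t+r}" "v \<in> P i"
      then show "f v \<le> f z0" using PZ(1)[rule_format, of i] z0 by (auto simp: P_def m_def)
    qed (auto simp: m_def)
    ultimately have "(\<Sum>i<s+t+r. sum f (P i)) \<le> real M * (real s * f x0 + real t * f y0 + real r * f z0)"
      unfolding blk by (simp add: algebra_simps)
    also have "\<dots> \<le> real M * \<tau>" using light by (intro mult_left_mono) auto
    finally show "\<exists>P. blown_tile R s t r M P \<and> (\<forall>i<s+t+r. P i \<subseteq> V - U) \<and> (\<Sum>i<s+t+r. sum f (P i)) \<le> real M * \<tau>"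
      using bt P1 by (intro exI[of _ P]) (auto simp: m_def)
  qed
qed

text \<open>Greedy choice: the bound on \<open>q\<close> keeps the used vertices below a proportion
  \<open>\<delta> / 6\<close> of \<open>V\<close>, so that avoiding them costs at most half of the
  density. The weight \<open>f\<close> is not updated within a round, hence the individual bounds
  simply add up.\<close>

lemma light_blown_tiles:
  fixes \<delta> :: real
  assumes "\<delta> > 0" "M > 0" "s > 0"
  shows "\<exists>n0. \<forall>(V :: 'a set) R f \<tau> q. finite V \<and> card V \<ge> n0 \<and> edge_rel R \<and>
      (\<Sum>x\<in>V. \<Sum>y\<in>V. \<Sum>z\<in>V. of_bool (R x y z \<and> real s * f x + real t * f y + real r * f z \<le> \<tau>))
        \<ge> \<delta> * real (card V) ^ 3 \<and> real (q * ((s + t + r) * M)) \<le> \<delta> / 6 * real (card V) \<longrightarrow>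
      (\<exists>P. (\<forall>l<q. blown_tile R s t r M (P l) \<and> (\<forall>i<s+t+r. P l i \<subseteq> V)) \<and>
         disjoint_family_on (\<lambda>l. \<Union>i<s+t+r. P l i) {..<q} \<and>
         (\<Sum>l<q. \<Sum>i<s+t+r. sum f (P l i)) \<le> real q * (real M * \<tau>))"
proof -
  define m where "m = s + t + r"
  have "\<delta> / 2 > 0" using assms by simp
  then obtain n0 where n0: "\<forall>(V :: 'a set) R f U \<tau>. finite V \<and> card V \<ge> n0 \<and> edge_rel R \<and> U \<subseteq> V \<and>
      (\<Sum>x\<in>V. \<Sum>y\<in>V. \<Sum>z\<in>V. of_bool (R x y z \<and> real s * f x + real t * f y + real r * f z \<le> \<tau>))
        \<ge> \<delta> / 2 * real (card V) ^ 3 + 3 * real (card U) * real (card V) ^ 2 \<longrightarrow>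
      (\<exists>P. blown_tile R s t r M P \<and> (\<forall>i<s+t+r. P i \<subseteq> V - U) \<and>
         (\<Sum>i<s+t+r. sum f (P i)) \<le> real M * \<tau>)"
    using light_blown_tile[of "\<delta> / 2" M s t r, where 'a='a, OF _ assms(2,3)] by (auto elim!: exE)
  show ?thesis
  proof (intro exI[of _ n0] allI impI, elim conjE)
    fix V :: "'a set" and R f \<tau> q
    assume V: "finite V" "card V \<ge> n0" and R: "edge_rel R"
      and dense: "(\<Sum>x\<in>V. \<Sum>y\<in>V. \<Sum>z\<in>V. of_bool (R x y z \<and> real s * f x + real t * f y + real r * f z \<le> \<tau>))
        \<ge> \<delta> * real (card V) ^ 3"
      and q: "real (q * ((s + t + r) * M)) \<le> \<delta> / 6 * real (card V)"
    have "\<exists>P. (\<forall>l<q'. blown_tile R s t r M (P l) \<and> (\<forall>i<m. P l i \<subseteq> V)) \<and>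
         disjoint_family_on (\<lambda>l. \<Union>i<m. P l i) {..<q'} \<and>
         (\<Sum>l<q'. \<Sum>i<m. sum f (P l i)) \<le> real q' * (real M * \<tau>)" if "q' \<le> q" for q'
      using that
    proof (induction q')
      case 0
      then show ?case by (auto simp: disjoint_family_on_def)
    next
      case (Suc q')
      then obtain P where P: "\<And>l. l < q' \<Longrightarrow> blown_tile R s t r M (P l) \<and> (\<forall>i<m. P l i \<subseteq> V)"
         "disjoint_family_on (\<lambda>l. \<Union>i<m. P l i) {..<q'}"
         "(\<Sum>l<q'. \<Sum>i<m. sum f (P l i)) \<le> real q' * (real M * \<tau>)" by auto
      define U where "U = (\<Union>l<q'. \<Union>i<m. P l i)"
      have UV: "U \<subseteq> V" using P(1) by (auto simp: U_def)
      have "card U \<le> (\<Sum>l<q'. card (\<Union>i<m. P l i))" unfolding U_def by (rule card_UN_le) simp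
      also have "\<dots> \<le> (\<Sum>l<q'. m * M)"
      proof (rule sum_mono)
        fix l assume "l \<in> {..<q'}"
        then have "card (P l i) = M" if "i < m" for i using P(1)[of l] that by (auto simp: blown_tile_def m_def)
        then show "card (\<Union>i<m. P l i) \<le> m * M" using card_UN_le[of "{..<m}" "P l"] by simp
      qed
      also have "\<dots> \<le> q * (m * M)" using Suc.prems by simp
      finally have "real (card U) \<le> real (q * (m * M))" by (simp only: of_nat_le_iff)
      then have "real (card U) \<le> \<delta> / 6 * real (card V)" using q unfolding m_def by linarith
      then have "real (card U) * real (card V) ^ 2 \<le> \<delta> / 6 * real (card V) * real (card V) ^ 2"
        by (intro mult_right_mono) auto
      then have "3 * real (card U) * real (card V) ^ 2 \<le> \<delta> / 2 * real (card V) ^ 3"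
        by (simp add: power2_eq_square power3_eq_cube)
      then have "\<delta> / 2 * real (card V) ^ 3 + 3 * real (card U) * real (card V) ^ 2 \<le>
        (\<Sum>x\<in>V. \<Sum>y\<in>V. \<Sum>z\<in>V. of_bool (R x y z \<and> real s * f x + real t * f y + real r * f z \<le> \<tau>))"
        using dense by linarith
      then have "\<exists>P. blown_tile R s t r M P \<and> (\<forall>i<s+t+r. P i \<subseteq> V - U) \<and> (\<Sum>i<s+t+r. sum f (P i)) \<le> real M * \<tau>"
        using V R UV by (intro n0[rule_format] conjI)
      then obtain P' where P': "blown_tile R s t r M P'" "\<forall>i<m. P' i \<subseteq> V - U" "(\<Sum>i<m. sum f (P' i)) \<le> real M * \<tau>"
        unfolding m_def by auto
      let ?P = "P(q' := P')"
      have "disjoint_family_on (\<lambda>l. \<Union>i<m. ?P l i) {..<Suc q'}"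
      proof -
        have "(\<Union>i<m. P' i) \<inter> (\<Union>i<m. P l i) = {}" if "l < q'" for l
          using P'(2) that unfolding U_def by blast
        then show ?thesis using P(2) unfolding disjoint_family_on_def
          by (auto simp: less_Suc_eq) blast+
      qed
      moreover have "(\<Sum>l<Suc q'. \<Sum>i<m. sum f (?P l i)) \<le> real (Suc q') * (real M * \<tau>)"
        using P(3) P'(3) by (simp add: algebra_simps)
      moreover have "\<forall>l<Suc q'. blown_tile R s t r M (?P l) \<and> (\<forall>i<m. ?P l i \<subseteq> V)"
        using P(1) P'(1,2) by (auto simp: less_Suc_eq)
      ultimately show ?case by blast
    qed
    then show "\<exists>P. (\<forall>l<q. blown_tile R s t r M (P l) \<and> (\<forall>i<s+t+r. P l i \<subseteq> V)) \<and>
         disjoint_family_on (\<lambda>l. \<Union>i<s+t+r. P l i) {..<q} \<and>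
         (\<Sum>l<q. \<Sum>i<s+t+r. sum f (P l i)) \<le> real q * (real M * \<tau>)"
      unfolding m_def by blast
  qed
qed

section \<open>Almost perfect tilings\<close>

text \<open>When \<open>f\<close> counts the earlier covers, a new set raises the second moment by
  \<open>w\<close> plus twice the sum of \<open>f\<close> over it. Sets of average weight would
  bring this to about \<open>w\<^sup>2 / n * K\<^sup>2\<close>, the value of a perfectly even cover,
  so the excess is confined to the factor \<open>1 + \<eta>\<close> and the diagonal term
  \<open>K * w\<close>.\<close>

lemma low_energy_sequence:
  fixes V :: "'a set" and cov :: "'p \<Rightarrow> 'a set" and w \<eta> :: real
  defines "n \<equiv> real (card V)"
  assumes V: "finite V" "V \<noteq> {}" and w0: "w \<ge> 0" and eta: "\<eta> \<ge> 0"
    and cov: "\<And>p. \<Phi> p \<Longrightarrow> cov p \<subseteq> V \<and> real (card (cov p)) = w"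
    and step: "\<And>f k. k < K \<Longrightarrow> (\<And>v. v \<in> V \<Longrightarrow> 0 \<le> f v \<and> f v \<le> real k) \<Longrightarrow> sum f V = real k * w \<Longrightarrow>
        \<exists>p. \<Phi> p \<and> sum f (cov p) \<le> w * (real k * w / n) * (1 + \<eta>)"
  shows "\<exists>ps. (\<forall>k<K. \<Phi> (ps k)) \<and>
      (\<Sum>v\<in>V. (\<Sum>k<K. of_bool (v \<in> cov (ps k)))\<^sup>2) \<le> w\<^sup>2 / n * (1 + \<eta>) * (real K)\<^sup>2 + real K * w"
proof -
  have n0: "n > 0" using V by (simp add: n_def card_gt_0_iff)
  have "\<exists>ps. (\<forall>k<K'. \<Phi> (ps k)) \<and>
      (\<Sum>v\<in>V. (\<Sum>k<K'. of_bool (v \<in> cov (ps k)))\<^sup>2) \<le> w\<^sup>2 / n * (1 + \<eta>) * (real K')\<^sup>2 + real K' * w"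
    if "K' \<le> K" for K'
    using that
  proof (induction K')
    case 0
    then show ?case by simp
  next
    case (Suc k)
    then obtain ps where ps: "\<And>j. j < k \<Longrightarrow> \<Phi> (ps j)"
      "(\<Sum>v\<in>V. (\<Sum>k<k. of_bool (v \<in> cov (ps k)))\<^sup>2) \<le> w\<^sup>2 / n * (1 + \<eta>) * (real k)\<^sup>2 + real k * w" by auto
    define f where "f v = (\<Sum>j<k. of_bool (v \<in> cov (ps j)) :: real)" for v
    have ind: "(\<Sum>v\<in>V. of_bool (v \<in> cov p) * g v) = sum g (cov p)" if "\<Phi> p" for p and g :: "'a \<Rightarrow> real"
    proof -
      have "V \<inter> cov p = cov p" using cov[OF that] by auto
      then show ?thesis using V(1) sum.inter_restrict[of V g "cov p"] by (auto intro!: sum.cong)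
    qed
    have ind1: "(\<Sum>v\<in>V. of_bool (v \<in> cov p)) = w" if "\<Phi> p" for p
      using ind[OF that, of "\<lambda>_. 1"] cov[OF that] by (simp add: sum_constant)
    have f1: "0 \<le> f v \<and> f v \<le> real k" for v
      using sum_bounded_above[of "{..<k}" "\<lambda>j. of_bool (v \<in> cov (ps j)) :: real" 1] by (auto simp: f_def sum_nonneg)
    have "sum f V = (\<Sum>j<k. \<Sum>v\<in>V. of_bool (v \<in> cov (ps j)))" unfolding f_def by (rule sum.swap)
    also have "\<dots> = real k * w" using ind1 ps(1) by simp
    finally have "\<exists>p. \<Phi> p \<and> sum f (cov p) \<le> w * (real k * w / n) * (1 + \<eta>)"
      using f1 Suc.prems by (intro step) auto
    then obtain p where p: "\<Phi> p" "sum f (cov p) \<le> w * (real k * w / n) * (1 + \<eta>)" by blast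
    let ?ps = "ps(k := p)"
    have "(\<Sum>j<Suc k. of_bool (v \<in> cov (?ps j))) = f v + of_bool (v \<in> cov p)" for v by (simp add: f_def)
    then have "(\<Sum>v\<in>V. (\<Sum>j<Suc k. of_bool (v \<in> cov (?ps j)))\<^sup>2) =
        (\<Sum>v\<in>V. (f v)\<^sup>2 + 2 * (of_bool (v \<in> cov p) * f v) + of_bool (v \<in> cov p))"
      by (intro sum.cong) (auto simp: power2_eq_square algebra_simps)
    also have "\<dots> = (\<Sum>v\<in>V. (f v)\<^sup>2) + 2 * sum f (cov p) + w"
      by (simp only: sum.distrib sum_distrib_left[symmetric] ind[OF p(1)] ind1[OF p(1)])
    also have "\<dots> \<le> (w\<^sup>2 / n * (1 + \<eta>) * (real k)\<^sup>2 + real k * w) + 2 * (w\<^sup>2 / n * (1 + \<eta>) * real k) + w"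
    proof -
      have "w * (real k * w / n) * (1 + \<eta>) = w\<^sup>2 / n * (1 + \<eta>) * real k"
        by (simp add: power2_eq_square mult_ac)
      then show ?thesis using ps(2)[folded f_def] p(2) by linarith
    qed
    also have "\<dots> \<le> w\<^sup>2 / n * (1 + \<eta>) * (real (Suc k))\<^sup>2 + real (Suc k) * w"
    proof -
      have "w\<^sup>2 / n * (1 + \<eta>) \<ge> 0" using n0 eta by simp
      then show ?thesis by (simp add: power2_eq_square algebra_simps)
    qed
    finally show ?case using ps(1) p(1) by (intro exI[of _ ?ps]) (auto simp: less_Suc_eq)
  qed
  then show ?thesis by blast
qed

text \<open>Cauchy-Schwarz without square roots: sum the inequalities
  \<open>2 * a * \<bar>f x\<bar> \<le> (f x)\<^sup>2 + a\<^sup>2\<close>.\<close>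

lemma sum_abs_le_of_sum_squares:
  fixes f :: "'a \<Rightarrow> real"
  assumes "(\<Sum>x\<in>A. (f x)\<^sup>2) \<le> a\<^sup>2 * real (card A)" "a > 0"
  shows "(\<Sum>x\<in>A. \<bar>f x\<bar>) \<le> a * real (card A)"
proof -
  have "2 * a * (\<Sum>x\<in>A. \<bar>f x\<bar>) = (\<Sum>x\<in>A. 2 * a * \<bar>f x\<bar>)" by (simp add: sum_distrib_left)
  also have "\<dots> \<le> (\<Sum>x\<in>A. (f x)\<^sup>2 + a\<^sup>2)"
  proof (rule sum_mono)
    fix x
    have "0 \<le> (\<bar>f x\<bar> - a)\<^sup>2" by simp
    then show "2 * a * \<bar>f x\<bar> \<le> (f x)\<^sup>2 + a\<^sup>2" by (simp add: power2_diff mult_ac)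
  qed
  also have "\<dots> = (\<Sum>x\<in>A. (f x)\<^sup>2) + a\<^sup>2 * real (card A)" by (simp add: sum.distrib)
  also have "\<dots> \<le> 2 * a * (a * real (card A))" using assms(1) by (simp add: power2_eq_square mult_ac)
  finally show ?thesis using assms(2) by simp
qed

text \<open>Classes of size \<open>M\<close>, slightly above the average cover \<kappa>, leave the
  room that Hall's theorem needs. The overcovered vertices \<open>B\<close> are forbidden; as the
  variance is small they carry few incidences, so few families lose more than
  \<open>\<theta> * M\<close> vertices to them. Such a family is dropped as a whole, because a tile
  needs a representative of every class.\<close>

lemma evenly_covering_families_transversals:
  fixes V :: "'a set" and P :: "'j \<Rightarrow> nat \<Rightarrow> 'a set" and J :: "'j set" and m M :: nat and \<kappa> \<sigma> \<theta> :: real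
  defines "n \<equiv> real (card V)" and "X \<equiv> \<lambda>v. (\<Sum>j\<in>J. \<Sum>i<m. of_bool (v \<in> P j i))"
  assumes fin: "finite J" "finite V" and P: "\<And>j i. j \<in> J \<Longrightarrow> i < m \<Longrightarrow> P j i \<subseteq> V \<and> card (P j i) = M"
    and X2: "(\<Sum>v\<in>V. (X v - \<kappa>)\<^sup>2) \<le> (\<sigma> * \<kappa>)\<^sup>2 * n"
    and par: "\<kappa> > 0" "0 < \<theta>" "\<theta> < 1" "\<sigma> > 0" "M > 0" "(1 + \<theta>) * \<kappa> \<le> (1 - \<theta>) * real M"
  shows "\<exists>J' \<phi>. J' \<subseteq> J \<and> inj_on \<phi> (J' \<times> {..<m}) \<and> (\<forall>j\<in>J'. \<forall>i<m. \<phi> (j, i) \<in> P j i) \<and>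
      real (card J') \<ge> real (card J) - 2 * n * \<kappa> * \<sigma> / (\<theta>\<^sup>2 * real M)"
proof -
  define B where "B = {v\<in>V. X v > (1 + \<theta>) * \<kappa>}"
  have fB: "finite B" "B \<subseteq> V" using fin by (auto simp: B_def)
  have X0: "X v \<ge> 0" for v by (simp add: X_def sum_nonneg)
  have sl: "\<sigma> * \<kappa> > 0" using par by simp
  have L1: "(\<Sum>v\<in>V. \<bar>X v - \<kappa>\<bar>) \<le> n * (\<sigma> * \<kappa>)"
    using sum_abs_le_of_sum_squares[of "\<lambda>v. X v - \<kappa>" V "\<sigma> * \<kappa>"] X2 sl by (simp add: n_def mult.commute)
  have B1: "(\<Sum>v\<in>B. X v - \<kappa>) \<le> n * (\<sigma> * \<kappa>)"
  proof -
    have "(\<Sum>v\<in>B. X v - \<kappa>) \<le> (\<Sum>v\<in>B. \<bar>X v - \<kappa>\<bar>)" by (intro sum_mono) auto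
    also have "\<dots> \<le> (\<Sum>v\<in>V. \<bar>X v - \<kappa>\<bar>)" using fin fB by (intro sum_mono2) auto
    finally show ?thesis using L1 by linarith
  qed
  have "real (card B) * (\<theta> * \<kappa>) \<le> (\<Sum>v\<in>B. X v - \<kappa>)"
    by (rule sum_bounded_below) (auto simp: B_def algebra_simps)
  then have "\<theta> * (real (card B) * \<kappa>) \<le> n * (\<sigma> * \<kappa>)" using B1 by (simp add: mult_ac)
  then have cB: "real (card B) * \<kappa> \<le> n * (\<sigma> * \<kappa>) / \<theta>" using par by (simp add: field_simps)
  have n0: "n \<ge> 0" by (simp add: n_def)
  have "(\<Sum>v\<in>B. X v) = (\<Sum>v\<in>B. X v - \<kappa>) + real (card B) * \<kappa>" by (simp add: sum_subtractf)
  also have "\<dots> \<le> n * (\<sigma> * \<kappa>) + n * (\<sigma> * \<kappa>) / \<theta>" using B1 cB by linarith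
  also have "\<dots> \<le> 2 * (n * (\<sigma> * \<kappa>)) / \<theta>"
  proof -
    have "n * (\<sigma> * \<kappa>) * \<theta> \<le> n * (\<sigma> * \<kappa>) * 1" using par n0 sl by (intro mult_left_mono) auto
    then have "n * (\<sigma> * \<kappa>) \<le> n * (\<sigma> * \<kappa>) / \<theta>" using par by (simp add: field_simps)
    then show ?thesis unfolding mult_2 add_divide_distrib by linarith
  qed
  finally have BX: "(\<Sum>v\<in>B. X v) \<le> 2 * (n * (\<sigma> * \<kappa>)) / \<theta>" .
  \<comment> \<open>Counted over all classes of a family together, so that a bound for the family
    bounds each of its classes.\<close>
  define lost where "lost j = (\<Sum>i<m. \<Sum>v\<in>B. of_bool (v \<in> P j i) :: real)" for j
  have lost0: "lost j \<ge> 0" for j by (simp add: lost_def sum_nonneg)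
  have "(\<Sum>v\<in>B. X v) = (\<Sum>j\<in>J. \<Sum>v\<in>B. \<Sum>i<m. of_bool (v \<in> P j i))"
    unfolding X_def by (rule sum.swap)
  also have "\<dots> = (\<Sum>j\<in>J. lost j)" unfolding lost_def by (intro sum.cong refl sum.swap)
  finally have BL: "(\<Sum>v\<in>B. X v) = (\<Sum>j\<in>J. lost j)" .
  define J' where "J' = {j\<in>J. lost j \<le> \<theta> * real M}"
  have J': "J' \<subseteq> J" "finite J'" "finite (J - J')" using fin by (auto simp: J'_def)
  have "real (card (J - J')) * (\<theta> * real M) \<le> (\<Sum>j\<in>J - J'. lost j)"
    by (rule sum_bounded_below) (auto simp: J'_def)
  also have "\<dots> \<le> (\<Sum>j\<in>J. lost j)" using fin lost0 by (intro sum_mono2) auto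
  finally have "real (card (J - J')) * (\<theta> * real M) \<le> 2 * (n * (\<sigma> * \<kappa>)) / \<theta>" using BX BL by linarith
  then have "real (card (J - J')) \<le> 2 * n * \<kappa> * \<sigma> / (\<theta>\<^sup>2 * real M)"
    using par by (simp add: field_simps power2_eq_square)
  moreover have "real (card (J - J')) = real (card J) - real (card J')"
    using J' fin by (simp add: card_Diff_subset card_mono)
  ultimately have cJ': "real (card J') \<ge> real (card J) - 2 * n * \<kappa> * \<sigma> / (\<theta>\<^sup>2 * real M)" by linarith
  \<comment> \<open>Without \<open>B\<close>, a class of a surviving family keeps at least
    \<open>(1 - \<theta>) * M\<close> vertices, and each of these lies in at most
    \<open>(1 + \<theta>) * \<kappa>\<close> classes; the last parameter assumption compares the
    two.\<close>
  define A where "A p = P (fst p) (snd p) - B" for p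
  let ?I = "J' \<times> {..<m}"
  have "\<exists>\<phi>. inj_on \<phi> ?I \<and> (\<forall>p\<in>?I. \<phi> p \<in> A p)"
  proof (rule Hall_bounded_degree)
    show "finite ?I" using J' by simp
    show "(1 - \<theta>) * real M > 0" using par by simp
    fix p assume p: "p \<in> ?I"
    obtain j i where ji: "p = (j, i)" "j \<in> J'" "i < m" using p by auto
    have Pji: "P j i \<subseteq> V" "card (P j i) = M" using P[of j i] ji J' by auto
    then have fP: "finite (P j i)" using fin finite_subset by blast
    then show "finite (A p)" by (simp add: A_def ji)
    have "real (card (P j i \<inter> B)) = (\<Sum>v\<in>B. of_bool (v \<in> P j i))" using fB by (simp add: Int_commute)
    also have "\<dots> \<le> lost j" unfolding lost_def
      using ji sum_nonneg[of B] by (intro member_le_sum) (auto intro: sum_nonneg)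
    also have "\<dots> \<le> \<theta> * real M" using ji by (simp add: J'_def)
    finally have 1: "real (card (P j i \<inter> B)) \<le> \<theta> * real M" .
    have "card (P j i) = card (P j i - B) + card (P j i \<inter> B)"
      using fP by (metis add.commute card_Int_Diff)
    then have "real (card (A p)) = real M - real (card (P j i \<inter> B))" using Pji by (simp add: A_def ji)
    then show "(1 - \<theta>) * real M \<le> real (card (A p))" using 1 by (simp add: algebra_simps)
  next
    fix v assume "v \<in> \<Union>(A ` ?I)"
    then obtain j i where ji: "j \<in> J'" "i < m" "v \<in> P j i" "v \<notin> B" by (auto simp: A_def)
    then have "v \<in> V" using P[of j i] J' by auto
    then have Xv: "X v \<le> (1 + \<theta>) * \<kappa>" using ji by (auto simp: B_def)
    have "{p\<in>?I. v \<in> A p} \<subseteq> {p\<in>J \<times> {..<m}. v \<in> P (fst p) (snd p)}" using J' by (auto simp: A_def)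
    then have "card {p\<in>?I. v \<in> A p} \<le> card {p\<in>J \<times> {..<m}. v \<in> P (fst p) (snd p)}"
      using fin by (intro card_mono) auto
    then have "real (card {p\<in>?I. v \<in> A p}) \<le> real (card {p\<in>J \<times> {..<m}. v \<in> P (fst p) (snd p)})" by simp
    also have "\<dots> = (\<Sum>p\<in>J \<times> {..<m}. of_bool (v \<in> P (fst p) (snd p)))"
      using fin by (simp add: Int_def del: mem_Times_iff)
    also have "\<dots> = X v" unfolding X_def sum.cartesian_product case_prod_beta ..
    finally show "real (card {p\<in>?I. v \<in> A p}) \<le> (1 - \<theta>) * real M" using Xv par by linarith
  qed
  then obtain \<phi> where \<phi>: "inj_on \<phi> ?I" "\<forall>p\<in>?I. \<phi> p \<in> A p" by blast
  have "\<forall>j\<in>J'. \<forall>i<m. \<phi> (j, i) \<in> P j i" using \<phi>(2) by (auto simp: A_def)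
  then show ?thesis using \<phi>(1) cJ' J'(1) by blast
qed

definition tiling :: "('a \<Rightarrow> 'a \<Rightarrow> 'a \<Rightarrow> bool) \<Rightarrow> nat \<Rightarrow> nat \<Rightarrow> nat \<Rightarrow> 'a set \<Rightarrow> 'a set set \<Rightarrow> bool" where
  "tiling R s t r V T \<longleftrightarrow> (\<forall>S\<in>T. tile R s t r S \<and> S \<subseteq> V) \<and> disjoint T"

lemma blown_tiles_sum:
  fixes f :: "'a \<Rightarrow> real" and P :: "nat \<Rightarrow> nat \<Rightarrow> 'a set"
  assumes "\<forall>l<q. blown_tile R s t r M (P l)" "disjoint_family_on (\<lambda>l. \<Union>i<s+t+r. P l i) {..<q}"
  shows "sum f (\<Union>l<q. \<Union>i<s+t+r. P l i) = (\<Sum>l<q. \<Sum>i<s+t+r. sum f (P l i))"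
proof -
  have fin: "finite (P l i)" and dis: "disjoint_family_on (P l) {..<s+t+r}" if "l < q" "i < s + t + r" for l i
    using assms(1) that by (auto simp: blown_tile_def)
  have "sum f (\<Union>l<q. \<Union>i<s+t+r. P l i) = (\<Sum>l<q. sum f (\<Union>i<s+t+r. P l i))"
    using assms(2) fin by (intro sum.UNION_disjoint) (auto simp: disjoint_family_on_def)
  also have "\<dots> = (\<Sum>l<q. \<Sum>i<s+t+r. sum f (P l i))"
  proof (intro sum.cong refl)
    fix l assume l: "l \<in> {..<q}"
    show "sum f (\<Union>i<s+t+r. P l i) = (\<Sum>i<s+t+r. sum f (P l i))"
    proof (rule sum.UNION_disjoint)
      show "\<forall>i\<in>{..<s+t+r}. finite (P l i)" using fin l by auto
      have "disjoint_family_on (P l) {..<s+t+r}" using assms(1) l by (auto simp: blown_tile_def)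
      then show "\<forall>i\<in>{..<s+t+r}. \<forall>j\<in>{..<s+t+r}. i \<noteq> j \<longrightarrow> P l i \<inter> P l j = {}"
        by (auto simp: disjoint_family_on_def)
    qed simp
  qed
  finally show ?thesis .
qed

lemma blown_tiles_indicator:
  fixes P :: "nat \<Rightarrow> nat \<Rightarrow> 'a set"
  assumes "\<forall>l<q. blown_tile R s t r M (P l)" "disjoint_family_on (\<lambda>l. \<Union>i<s+t+r. P l i) {..<q}"
  shows "(of_bool (v \<in> (\<Union>l<q. \<Union>i<s+t+r. P l i)) :: real) = (\<Sum>l<q. \<Sum>i<s+t+r. of_bool (v \<in> P l i))"
proof -
  have fin: "finite (P l i)" if "l < q" "i < s + t + r" for l i
    using assms(1) that by (auto simp: blown_tile_def)
  have e: "(\<Sum>x\<in>W. of_bool (x = v)) = (of_bool (v \<in> W) :: real)" if "finite W" for W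
    using that by (auto simp: of_bool_def sum.delta)
  \<comment> \<open>Summing the indicator of the single point \<open>v\<close> over a finite set
    tests membership, so the identity for sums already contains the one for indicators.\<close>
  have "(\<Sum>x\<in>(\<Union>l<q. \<Union>i<s+t+r. P l i). of_bool (x = v)) = (\<Sum>l<q. \<Sum>i<s+t+r. \<Sum>x\<in>P l i. of_bool (x = v) :: real)"
    using blown_tiles_sum[OF assms] .
  also have "\<dots> = (\<Sum>l<q. \<Sum>i<s+t+r. of_bool (v \<in> P l i))"
    by (intro sum.cong refl e fin) auto
  finally show ?thesis using e[of "\<Union>l<q. \<Union>i<s+t+r. P l i"] fin by auto
qed

lemma sum_sq_deviation:
  fixes X :: "'a \<Rightarrow> real"
  assumes "sum X V = k * real (card V)"
  shows "(\<Sum>v\<in>V. (X v - k)\<^sup>2) = (\<Sum>v\<in>V. (X v)\<^sup>2) - k\<^sup>2 * real (card V)"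
proof -
  have "(\<Sum>v\<in>V. (X v - k)\<^sup>2) = (\<Sum>v\<in>V. (X v)\<^sup>2) - 2 * k * sum X V + k\<^sup>2 * real (card V)"
    by (simp add: power2_diff sum.distrib sum_subtractf sum_distrib_left sum_distrib_right mult_ac)
  then show ?thesis using assms by (simp add: power2_eq_square)
qed

lemma transversal_tiling:
  assumes "inj_on \<phi> (J \<times> {..<s+t+r})" "s > 0"
    and "\<And>j i. j \<in> J \<Longrightarrow> i < s+t+r \<Longrightarrow> \<phi> (j, i) \<in> P j i"
    and "\<And>j i. j \<in> J \<Longrightarrow> i < s+t+r \<Longrightarrow> P j i \<subseteq> V" "\<And>j. j \<in> J \<Longrightarrow> blown_tile R s t r M (P j)"
  shows "\<exists>T. tiling R s t r V T \<and> card T = card J"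
proof -
  define S where "S j = (\<lambda>i. \<phi> (j, i)) ` {..<s+t+r}" for j
  have dis: "S j \<inter> S j' = {}" if "j \<in> J" "j' \<in> J" "j \<noteq> j'" for j j'
    using inj_onD[OF assms(1)] that by (fastforce simp: S_def)
  have ne: "S j \<noteq> {}" for j using assms(2) by (auto simp: S_def)
  have inj: "inj_on S J" using dis ne by (metis Int_absorb inj_onI)
  have "tile R s t r (S j) \<and> S j \<subseteq> V" if "j \<in> J" for j
  proof
    have "inj_on (\<lambda>i. \<phi> (j, i)) {..<s+t+r}"
      using inj_onD[OF assms(1)] that by (fastforce intro!: inj_onI)
    then show "tile R s t r (S j)"
      unfolding S_def using assms(3,5) that by (intro blown_tile_transversal) auto
    show "S j \<subseteq> V" unfolding S_def using assms(3,4) that by blast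
  qed
  moreover have "disjoint (S ` J)" using dis by (auto simp: pairwise_def disjnt_def)
  ultimately have "tiling R s t r V (S ` J)" by (auto simp: tiling_def)
  then show ?thesis using card_image[OF inj] by blast
qed

text \<open>Only the number \<open>q\<close> of blow-ups per round grows with \<open>V\<close>.
  Every round covers a fixed proportion of the vertices, so after \<open>k\<close> rounds the bound
  \<open>f \<le> k\<close> is comparable with the mean \<open>k * \<rho>\<close>, and one
  \<open>\<eta>\<close> serves all rounds.\<close>

lemma almost_perfect_tiling:
  fixes D \<epsilon> c \<gamma> :: real and s t r :: nat
  assumes st: "s > t" and par: "D > 0" "c > 0" "0 \<le> \<epsilon>" "\<epsilon> \<le> 1/2" "real (s + t + r) * \<epsilon> * D \<le> c / 2"
    and gam: "0 < \<gamma>" "\<gamma> \<le> 1/2"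
  shows "\<exists>\<eta>>0. \<exists>n0. \<forall>(V :: 'a set) R. finite V \<and> card V \<ge> n0 \<and> edge_rel R \<and> nearly_regular V R D \<epsilon> c \<eta> \<longrightarrow>
     (\<exists>T. tiling R s t r V T \<and> real (s + t + r) * real (card T) \<ge> (1 - \<gamma>) * real (card V))"
proof -
  define mm where "mm = s + t + r"
  define m where "m = real mm"
  \<comment> \<open>Read backwards from the final count: two losses of \<open>\<theta>\<close> come
    from the slack in Hall's condition, one from rounding \<open>K\<close> and one from the dropped
    families, in total \<open>4 * \<theta> = \<gamma>\<close>. \<open>\<sigma>\<close> makes the
    loss of dropped families exactly this large, and \<open>4 * \<eta>1 = \<sigma>\<^sup>2\<close>
    matches the variance that the rounds achieve.\<close>
  define \<theta> where "\<theta> = \<gamma> / 4"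
  define \<sigma> where "\<sigma> = \<theta> ^ 3 / (2 * m)"
  define \<eta>1 where "\<eta>1 = \<sigma>\<^sup>2 / 4"
  define \<delta> where "\<delta> = D * \<eta>1 / 24"
  define \<rho>0 where "\<rho>0 = min 1 (\<delta> / 6)"
  \<comment> \<open>\<open>M * \<theta> \<ge> 1\<close> makes the rounding of \<open>K\<close> cost
    at most \<open>\<theta>\<close>. \<open>M \<ge> 1 / \<eta>1\<close> yields
    \<open>\<kappa> \<ge> 1 / (2 * \<eta>1)\<close>, so that the diagonal term of the second moment
    is no larger than the error from the light edges.\<close>
  define M where "M = nat \<lceil>1 / \<theta> + 2 / (2 * \<eta>1)\<rceil> + 1"
  define \<eta> where "\<eta> = \<eta>1 * \<rho>0 * D / 16"
  have m1: "m \<ge> 1" using st by (simp add: m_def mm_def)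
  have th: "0 < \<theta>" "\<theta> \<le> 1/8" using gam by (auto simp: \<theta>_def)
  have sg: "\<sigma> > 0" using th m1 by (simp add: \<sigma>_def)
  have "\<theta> ^ 3 \<le> 1" using th by (simp add: power_le_one)
  then have sg1: "\<sigma> \<le> 1" using m1 by (simp add: \<sigma>_def field_simps)
  have e1: "\<eta>1 > 0" "\<eta>1 \<le> 1" using sg sg1 power_le_one[of \<sigma> 2] by (auto simp: \<eta>1_def)
  have dl: "\<delta> > 0" using e1 par by (simp add: \<delta>_def)
  have r0: "\<rho>0 > 0" "\<rho>0 \<le> 1" "\<rho>0 \<le> \<delta> / 6" using dl by (auto simp: \<rho>0_def)
  have et: "\<eta> > 0" using e1 r0 par by (simp add: \<eta>_def)
  have "\<eta>1 * \<rho>0 \<le> 1" using e1 r0 by (simp add: mult_le_one)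
  then have "\<eta>1 * \<rho>0 * D \<le> 1 * D" using par by (intro mult_right_mono) auto
  then have et4: "\<eta> \<le> D / 4" using par by (simp add: \<eta>_def)
  have M0: "real M \<ge> 1 / \<theta> + 2 / (2 * \<eta>1)" "M > 0" unfolding M_def by linarith+
  have Mth: "real M * \<theta> \<ge> 1"
  proof -
    have "real M \<ge> 1 / \<theta>" using M0(1) e1 by (smt (verit) divide_pos_pos)
    then show ?thesis using th by (simp add: field_simps)
  qed
  have Met: "real M / 2 \<ge> 1 / (2 * \<eta>1)"
  proof -
    have "real M \<ge> 2 / (2 * \<eta>1)" using M0(1) th by (smt (verit) divide_pos_pos)
    then show ?thesis by simp
  qed
  have s0: "s > 0" using st by simp
  obtain n1 where n1: "\<forall>(V :: 'a set) R f \<tau> q. finite V \<and> card V \<ge> n1 \<and> edge_rel R \<and>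
      (\<Sum>x\<in>V. \<Sum>y\<in>V. \<Sum>z\<in>V. of_bool (R x y z \<and> real s * f x + real t * f y + real r * f z \<le> \<tau>))
        \<ge> \<delta> * real (card V) ^ 3 \<and> real (q * ((s + t + r) * M)) \<le> \<delta> / 6 * real (card V) \<longrightarrow>
      (\<exists>P. (\<forall>l<q. blown_tile R s t r M (P l) \<and> (\<forall>i<s+t+r. P l i \<subseteq> V)) \<and>
         disjoint_family_on (\<lambda>l. \<Union>i<s+t+r. P l i) {..<q} \<and>
         (\<Sum>l<q. \<Sum>i<s+t+r. sum f (P l i)) \<le> real q * (real M * \<tau>))"
    using light_blown_tiles[OF dl M0(2) s0, of t r] by (rule exE)
  define n0 where "n0 = n1 + nat \<lceil>2 * m * real M / \<rho>0\<rceil> + 1"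
  have main: "\<exists>T. tiling R s t r V T \<and> m * real (card T) \<ge> (1 - \<gamma>) * real (card V)"
    if V: "finite V" "card V \<ge> n0" and R: "edge_rel R" and reg: "nearly_regular V R D \<epsilon> c \<eta>"
    for V :: "'a set" and R
  proof -
    define n where "n = real (card V)"
    have Vn1: "card V \<ge> n1" and nbig: "n \<ge> 2 * m * real M / \<rho>0" and npos: "n > 0"
      using V(2) unfolding n0_def n_def by linarith+
    have Vne: "V \<noteq> {}" using npos by (auto simp: n_def)
    define q where "q = nat \<lfloor>\<rho>0 * n / (m * real M)\<rfloor>"
    have mM: "m * real M > 0" using m1 M0 by simp
    have q0: "real q \<le> \<rho>0 * n / (m * real M)" "real q > \<rho>0 * n / (m * real M) - 1"
    proof -
      have "0 \<le> \<rho>0 * n / (m * real M)" using mM r0 npos by simp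
      then show "real q \<le> \<rho>0 * n / (m * real M)" "real q > \<rho>0 * n / (m * real M) - 1"
        unfolding q_def by linarith+
    qed
    define w where "w = real q * (m * real M)"
    have w1: "w \<le> \<rho>0 * n" using q0(1) mM by (simp add: w_def field_simps)
    have w2: "w \<ge> \<rho>0 * n / 2"
    proof -
      have "w \<ge> (\<rho>0 * n / (m * real M) - 1) * (m * real M)"
        unfolding w_def using q0(2) mM by (intro mult_right_mono) auto
      then have "w \<ge> \<rho>0 * n - m * real M" using m1 M0(2) by (simp add: left_diff_distrib)
      moreover have "2 * (m * real M) \<le> \<rho>0 * n" using nbig r0 by (simp add: field_simps)
      ultimately show ?thesis by linarith
    qed
    have wpos: "w > 0" using w2 mult_pos_pos[OF r0(1) npos] by linarith
    define \<rho> where "\<rho> = w / n"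
    have rho: "0 < \<rho>" "\<rho> \<le> 1" "\<rho> \<ge> \<rho>0 / 2"
    proof -
      show "0 < \<rho>" using wpos npos by (simp add: \<rho>_def)
      have "\<rho>0 * n \<le> 1 * n" using r0 npos by (intro mult_right_mono) auto
      then have "w \<le> n" using w1 by linarith
      then show "\<rho> \<le> 1" using npos by (simp add: \<rho>_def)
      show "\<rho> \<ge> \<rho>0 / 2" using w2 npos by (simp add: \<rho>_def field_simps)
    qed
    \<comment> \<open>The largest number of rounds for which the average cover
      \<open>\<kappa>\<close> satisfies Hall's room condition. It is bounded independently of
      \<open>V\<close>, as \<open>\<rho> \<ge> \<rho>0 / 2\<close>.\<close>
    define K where "K = nat \<lfloor>real M * (1 - \<theta>) / ((1 + \<theta>) * \<rho>)\<rfloor>"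
    define \<kappa> where "\<kappa> = real K * \<rho>"
    have K0: "real K \<le> real M * (1 - \<theta>) / ((1 + \<theta>) * \<rho>)" "real K > real M * (1 - \<theta>) / ((1 + \<theta>) * \<rho>) - 1"
    proof -
      have "0 \<le> real M * (1 - \<theta>) / ((1 + \<theta>) * \<rho>)" using rho th by simp
      then show "real K \<le> real M * (1 - \<theta>) / ((1 + \<theta>) * \<rho>)" "real K > real M * (1 - \<theta>) / ((1 + \<theta>) * \<rho>) - 1"
        unfolding K_def by linarith+
    qed
    have k1: "(1 + \<theta>) * \<kappa> \<le> (1 - \<theta>) * real M"
    proof -
      have "(1 + \<theta>) * \<rho> > 0" using rho th by simp
      then have "real K * ((1 + \<theta>) * \<rho>) \<le> real M * (1 - \<theta>)" using K0(1) by (simp add: pos_le_divide_eq)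
      then show ?thesis by (simp add: \<kappa>_def mult_ac)
    qed
    have k2: "\<kappa> \<ge> real M * (1 - 3 * \<theta>)"
    proof -
      have "\<kappa> \<ge> (real M * (1 - \<theta>) / ((1 + \<theta>) * \<rho>) - 1) * \<rho>"
        unfolding \<kappa>_def using K0(2) rho by (intro mult_right_mono) auto
      then have "\<kappa> \<ge> real M * ((1 - \<theta>) / (1 + \<theta>)) - \<rho>" using rho th by (simp add: left_diff_distrib)
      moreover have "1 - 2 * \<theta> \<le> (1 - \<theta>) / (1 + \<theta>)"
      proof -
        have "(1 - 2 * \<theta>) * (1 + \<theta>) \<le> 1 - \<theta>" using th by (simp add: algebra_simps)
        then show ?thesis using th by (simp add: pos_le_divide_eq)
      qed
      then have "real M * (1 - 2 * \<theta>) \<le> real M * ((1 - \<theta>) / (1 + \<theta>))" by (intro mult_left_mono) auto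
      moreover have "real M * (1 - 3 * \<theta>) = real M * (1 - 2 * \<theta>) - real M * \<theta>" by (simp add: algebra_simps)
      ultimately show ?thesis using rho Mth by linarith
    qed
    have k3: "\<kappa> \<ge> 1 / (2 * \<eta>1)"
    proof -
      have "real M * (1 / 2) \<le> real M * (1 - 3 * \<theta>)" using th by (intro mult_left_mono) auto
      then show ?thesis using k2 Met by linarith
    qed
    have kpos: "\<kappa> > 0" using k3 e1 by (meson divide_pos_pos less_le_trans mult_pos_pos zero_less_numeral zero_less_one)
    define cov where "cov P = (\<Union>l<q. \<Union>i<s+t+r. P l i :: 'a set)" for P
    define \<Phi> where "\<Phi> P \<longleftrightarrow> (\<forall>l<q. blown_tile R s t r M (P l) \<and> (\<forall>i<s+t+r. P l i \<subseteq> V)) \<and>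
         disjoint_family_on (\<lambda>l. \<Union>i<s+t+r. P l i) {..<q}" for P
    have \<Phi>D: "\<forall>l<q. blown_tile R s t r M (P l)" "disjoint_family_on (\<lambda>l. \<Union>i<s+t+r. P l i) {..<q}"
      "\<And>l i. l < q \<Longrightarrow> i < s+t+r \<Longrightarrow> P l i \<subseteq> V" if "\<Phi> P" for P
      using that by (auto simp: \<Phi>_def)
    have covs: "sum f (cov P) = (\<Sum>l<q. \<Sum>i<s+t+r. sum f (P l i))" if "\<Phi> P" for P and f :: "'a \<Rightarrow> real"
      unfolding cov_def by (rule blown_tiles_sum[OF \<Phi>D(1,2)[OF that]])
    have covV: "cov P \<subseteq> V \<and> real (card (cov P)) = w" if "\<Phi> P" for P
    proof
      show "cov P \<subseteq> V" unfolding cov_def using \<Phi>D(3)[OF that] by blast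
      have "real (card (cov P)) = (\<Sum>l<q. \<Sum>i<s+t+r. real (card (P l i)))"
        using covs[OF that, of "\<lambda>_. 1"] by simp
      also have "\<dots> = (\<Sum>l<q. \<Sum>i<s+t+r. real M)"
        using \<Phi>D(1)[OF that] by (intro sum.cong refl) (auto simp: blown_tile_def)
      also have "\<dots> = w" by (simp add: w_def m_def mm_def)
      finally show "real (card (cov P)) = w" .
    qed
    have "\<exists>ps. (\<forall>k<K. \<Phi> (ps k)) \<and> (\<Sum>v\<in>V. (\<Sum>k<K. of_bool (v \<in> cov (ps k)))\<^sup>2) \<le>
        w\<^sup>2 / n * (1 + 2 * \<eta>1) * (real K)\<^sup>2 + real K * w"
      unfolding n_def
    proof (rule low_energy_sequence)
      fix f :: "'a \<Rightarrow> real" and k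
      assume f: "\<And>v. v \<in> V \<Longrightarrow> 0 \<le> f v \<and> f v \<le> real k" and sf: "sum f V = real k * w"
      define \<mu> where "\<mu> = sum f V / n"
      have mu: "\<mu> = real k * \<rho>" by (simp add: \<mu>_def sf \<rho>_def)
      \<comment> \<open>Both sides are linear in \<open>k\<close>. The 16 in \<open>\<eta>\<close>
        consists of 2 for \<open>m + (s - t) / 2 \<le> 2 * m\<close>, 2 for
        \<open>\<rho> \<ge> \<rho>0 / 2\<close>, and 4 for \<open>D / 4\<close>.\<close>
      have "(m + real (s - t) / 2) * \<eta> * real k \<le> \<eta>1 * m * \<mu> * (D / 4)"
      proof -
        have "m + real (s - t) / 2 \<le> 2 * m" by (simp add: m_def mm_def)
        then have "(m + real (s - t) / 2) * (\<eta> * real k) \<le> 2 * m * (\<eta> * real k)"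
          using et by (intro mult_right_mono) auto
        also have "\<dots> = \<eta>1 * m * (real k * (\<rho>0 / 2)) * (D / 4)" by (simp add: \<eta>_def)
        also have "\<dots> \<le> \<eta>1 * m * (real k * \<rho>) * (D / 4)"
          using rho e1 m1 par by (intro mult_right_mono mult_left_mono) auto
        finally show ?thesis by (simp add: mu mult.assoc)
      qed
      then have "(\<Sum>x\<in>V. \<Sum>y\<in>V. \<Sum>z\<in>V. of_bool (R x y z \<and> real s * f x + real t * f y + real r * f z \<le> m * \<mu> * (1 + 2 * \<eta>1)))
        \<ge> D * \<eta>1 / 24 * n ^ 3"
        unfolding m_def mm_def \<mu>_def n_def
        using R V Vne st reg f par e1 et et4 by (intro many_light_triples[where \<epsilon>=\<epsilon> and c=c and \<eta>=\<eta> and B="real k"]) auto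
      moreover have "real (q * ((s + t + r) * M)) \<le> \<delta> / 6 * n"
      proof -
        have "real (q * ((s + t + r) * M)) = w" by (simp add: w_def m_def mm_def)
        moreover have "\<rho>0 * n \<le> \<delta> / 6 * n" using r0 npos by (intro mult_right_mono) auto
        ultimately show ?thesis using w1 by linarith
      qed
      ultimately have "\<exists>P. (\<forall>l<q. blown_tile R s t r M (P l) \<and> (\<forall>i<s+t+r. P l i \<subseteq> V)) \<and>
         disjoint_family_on (\<lambda>l. \<Union>i<s+t+r. P l i) {..<q} \<and>
         (\<Sum>l<q. \<Sum>i<s+t+r. sum f (P l i)) \<le> real q * (real M * (m * \<mu> * (1 + 2 * \<eta>1)))"
        using V(1) Vn1 R unfolding \<delta>_def n_def by (intro n1[unfolded \<delta>_def, rule_format] conjI)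
      then obtain P where P: "\<Phi> P" "(\<Sum>l<q. \<Sum>i<s+t+r. sum f (P l i)) \<le> real q * (real M * (m * \<mu> * (1 + 2 * \<eta>1)))"
        unfolding \<Phi>_def by auto
      have "sum f (cov P) \<le> w * (real k * w / n) * (1 + 2 * \<eta>1)"
        using P(2) covs[OF P(1)] by (simp add: mu w_def \<rho>_def mult_ac)
      then show "\<exists>p. \<Phi> p \<and> sum f (cov p) \<le> w * (real k * w / real (card V)) * (1 + 2 * \<eta>1)"
        using P(1) unfolding n_def by blast
    qed (use V Vne wpos e1 covV in auto)
    then obtain ps where ps: "\<And>k. k < K \<Longrightarrow> \<Phi> (ps k)" and
      en: "(\<Sum>v\<in>V. (\<Sum>k<K. of_bool (v \<in> cov (ps k)))\<^sup>2) \<le> w\<^sup>2 / n * (1 + 2 * \<eta>1) * (real K)\<^sup>2 + real K * w"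
      by blast
    define J where "J = {..<K} \<times> {..<q}"
    define Q where "Q j = ps (fst j) (snd j)" for j
    define X where "X v = (\<Sum>j\<in>J. \<Sum>i<s+t+r. of_bool (v \<in> Q j i) :: real)" for v
    have Xk: "X v = (\<Sum>k<K. of_bool (v \<in> cov (ps k)))" for v
    proof -
      have "X v = (\<Sum>k<K. \<Sum>l<q. \<Sum>i<s+t+r. of_bool (v \<in> ps k l i))"
        unfolding X_def J_def Q_def by (subst sum.cartesian_product') simp
      also have "\<dots> = (\<Sum>k<K. of_bool (v \<in> cov (ps k)))"
        unfolding cov_def using blown_tiles_indicator[OF \<Phi>D(1,2)[OF ps]] by (intro sum.cong refl) auto
      finally show ?thesis .
    qed
    have SX: "sum X V = \<kappa> * real (card V)"
    proof -
      have "sum X V = (\<Sum>k<K. \<Sum>v\<in>V. of_bool (v \<in> cov (ps k)))" unfolding Xk by (rule sum.swap)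
      also have "\<dots> = (\<Sum>k<K. w)"
      proof (intro sum.cong refl)
        fix k assume "k \<in> {..<K}"
        then have "cov (ps k) \<subseteq> V" "real (card (cov (ps k))) = w" using covV ps by auto
        then show "(\<Sum>v\<in>V. of_bool (v \<in> cov (ps k))) = w" using V(1) by (simp add: Int_absorb1)
      qed
      also have "\<dots> = \<kappa> * real (card V)" using npos by (simp add: \<kappa>_def \<rho>_def n_def)
      finally show ?thesis .
    qed
    have X2: "(\<Sum>v\<in>V. (X v - \<kappa>)\<^sup>2) \<le> (\<sigma> * \<kappa>)\<^sup>2 * real (card V)"
    proof -
      have "(\<Sum>v\<in>V. (X v - \<kappa>)\<^sup>2) = (\<Sum>v\<in>V. (X v)\<^sup>2) - \<kappa>\<^sup>2 * n"
        using sum_sq_deviation[OF SX] by (simp add: n_def)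
      also have "\<dots> \<le> w\<^sup>2 / n * (1 + 2 * \<eta>1) * (real K)\<^sup>2 + real K * w - \<kappa>\<^sup>2 * n" using en unfolding Xk by simp
      also have "\<dots> = n * (2 * \<eta>1 * \<kappa>\<^sup>2 + \<kappa>)"
        using npos by (simp add: \<kappa>_def \<rho>_def field_simps power2_eq_square)
      also have "\<dots> \<le> n * (2 * \<eta>1 * \<kappa>\<^sup>2 + 2 * \<eta>1 * \<kappa>\<^sup>2)"
      proof -
        have "1 \<le> 2 * \<eta>1 * \<kappa>" using k3 e1 by (simp add: field_simps)
        then have "1 * \<kappa> \<le> 2 * \<eta>1 * \<kappa> * \<kappa>" using kpos by (intro mult_right_mono) auto
        then show ?thesis using npos by (intro mult_left_mono) (auto simp: power2_eq_square)
      qed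
      also have "\<dots> = (\<sigma> * \<kappa>)\<^sup>2 * real (card V)" by (simp add: \<eta>1_def n_def power_mult_distrib)
      finally show ?thesis .
    qed
    have QV: "Q j i \<subseteq> V \<and> card (Q j i) = M" "blown_tile R s t r M (Q j)" if "j \<in> J" "i < s + t + r" for j i
    proof -
      have "fst j < K" "snd j < q" using that by (auto simp: J_def)
      then have "blown_tile R s t r M (Q j)" "Q j i \<subseteq> V"
        using \<Phi>D(1,3)[OF ps, of "fst j"] that by (simp_all add: Q_def)
      then show "Q j i \<subseteq> V \<and> card (Q j i) = M" "blown_tile R s t r M (Q j)"
        using that by (auto simp: blown_tile_def)
    qed
    have "\<exists>J' \<phi>. J' \<subseteq> J \<and> inj_on \<phi> (J' \<times> {..<s+t+r}) \<and> (\<forall>j\<in>J'. \<forall>i<s+t+r. \<phi> (j, i) \<in> Q j i) \<and>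
      real (card J') \<ge> real (card J) - 2 * real (card V) * \<kappa> * \<sigma> / (\<theta>\<^sup>2 * real M)"
      using V(1) X2 kpos th sg M0 k1 QV(1) unfolding X_def
      by (intro evenly_covering_families_transversals) (auto simp: J_def)
    then obtain J' \<phi> where J': "J' \<subseteq> J" "inj_on \<phi> (J' \<times> {..<s+t+r})" "\<And>j i. j \<in> J' \<Longrightarrow> i < s+t+r \<Longrightarrow> \<phi> (j, i) \<in> Q j i"
      "real (card J') \<ge> real (card J) - 2 * real (card V) * \<kappa> * \<sigma> / (\<theta>\<^sup>2 * real M)"
      by blast
    have "\<exists>T. tiling R s t r V T \<and> card T = card J'"
    proof (rule transversal_tiling[OF J'(2) s0])
      show "\<phi> (j, i) \<in> Q j i" "Q j i \<subseteq> V" if "j \<in> J'" "i < s + t + r" for j i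
        using J'(3)[OF that] QV(1)[of j i] that J'(1) by auto
      show "blown_tile R s t r M (Q j)" if "j \<in> J'" for j
        using QV(2)[of j 0] that J'(1) s0 by auto
    qed
    then obtain T where T: "tiling R s t r V T" "card T = card J'" by blast
    have cJ: "m * real (card J) = \<kappa> * n / real M"
      using npos M0 by (simp add: J_def \<kappa>_def \<rho>_def w_def)
    have "(1 - \<gamma>) * n \<le> (1 - 3 * \<theta>) * (1 - \<theta>) * n"
      using npos th by (intro mult_right_mono) (auto simp: \<theta>_def algebra_simps)
    also have "\<dots> \<le> \<kappa> / real M * ((1 - \<theta>) * n)"
    proof -
      have "1 - 3 * \<theta> \<le> \<kappa> / real M" using k2 M0 by (simp add: field_simps)
      then have "(1 - 3 * \<theta>) * ((1 - \<theta>) * n) \<le> \<kappa> / real M * ((1 - \<theta>) * n)"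
        using npos th by (intro mult_right_mono) auto
      then show ?thesis by (simp add: mult.assoc)
    qed
    also have "\<dots> = m * real (card J) - m * (2 * n * \<kappa> * \<sigma> / (\<theta>\<^sup>2 * real M))"
      unfolding cJ using m1 th M0 by (simp add: \<sigma>_def field_simps power2_eq_square power3_eq_cube)
    also have "\<dots> = m * (real (card J) - 2 * n * \<kappa> * \<sigma> / (\<theta>\<^sup>2 * real M))" by (simp add: right_diff_distrib)
    also have "\<dots> \<le> m * real (card J')" using J'(4) m1 unfolding n_def by (intro mult_left_mono) auto
    finally show ?thesis using T unfolding n_def by auto
  qed
  then show ?thesis using et unfolding m_def mm_def
    by (intro exI[of _ \<eta>] conjI exI[of _ n0] allI impI) auto
qed

section \<open>Sampling tiles\<close>

text \<open>A uniform random function stays uniform when its value at \<open>i\<close> is drawn again.\<close>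
lemma sum_PiE_resample:
  fixes \<phi> :: "('i \<Rightarrow> 't) \<Rightarrow> real"
  assumes "i \<in> I"
  shows "(\<Sum>\<omega>\<in>PiE I (\<lambda>_. T). \<Sum>S\<in>T. \<phi> (\<omega>(i := S))) = real (card T) * (\<Sum>\<omega>\<in>PiE I (\<lambda>_. T). \<phi> \<omega>)"
proof -
  let ?\<Omega> = "PiE I (\<lambda>_. T)"
  have "(\<Sum>\<omega>\<in>?\<Omega>. \<Sum>S\<in>T. \<phi> (\<omega>(i := S))) = (\<Sum>p\<in>?\<Omega> \<times> T. \<phi> ((fst p)(i := snd p)))"
    by (simp add: sum.cartesian_product case_prod_beta)
  also have "\<dots> = (\<Sum>p\<in>?\<Omega> \<times> T. \<phi> (fst p))"
    by (rule sum.reindex_bij_witness[where i="\<lambda>p. ((fst p)(i := snd p), fst p i)" and j="\<lambda>p. ((fst p)(i := snd p), fst p i)"])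
      (use assms in \<open>auto simp: PiE_iff extensional_def\<close>)
  also have "\<dots> = (\<Sum>\<omega>\<in>?\<Omega>. \<Sum>S\<in>T. \<phi> \<omega>)"
    unfolding sum.cartesian_product case_prod_beta ..
  also have "\<dots> = real (card T) * (\<Sum>\<omega>\<in>?\<Omega>. \<phi> \<omega>)" by (simp add: sum_distrib_left)
  finally show ?thesis .
qed

text \<open>Redraw coordinate \<open>i\<close>: neither \<open>u\<close> nor
  \<open>h (\<omega> j)\<close> notices, and \<open>h\<close> averages to 0.\<close>

lemma sum_PiE_orthogonal:
  fixes h :: "'t \<Rightarrow> real" and u :: "('i \<Rightarrow> 't) \<Rightarrow> real"
  assumes "i \<in> I" "i \<noteq> j" "finite T" "T \<noteq> {}" "sum h T = 0"
    and "\<And>\<omega> S. \<omega> \<in> PiE I (\<lambda>_. T) \<Longrightarrow> S \<in> T \<Longrightarrow> u (\<omega>(i := S)) = u \<omega>"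
  shows "(\<Sum>\<omega>\<in>PiE I (\<lambda>_. T). u \<omega> * (h (\<omega> i) * h (\<omega> j))) = 0"
proof -
  have "real (card T) * (\<Sum>\<omega>\<in>PiE I (\<lambda>_. T). u \<omega> * (h (\<omega> i) * h (\<omega> j))) =
      (\<Sum>\<omega>\<in>PiE I (\<lambda>_. T). \<Sum>S\<in>T. u (\<omega>(i := S)) * (h S * h (\<omega> j)))"
    using sum_PiE_resample[OF assms(1), where T=T and \<phi>="\<lambda>\<omega>. u \<omega> * (h (\<omega> i) * h (\<omega> j))"] assms(2) by simp
  also have "\<dots> = (\<Sum>\<omega>\<in>PiE I (\<lambda>_. T). u \<omega> * h (\<omega> j) * sum h T)"
    by (intro sum.cong refl) (simp add: assms(6) sum_distrib_left sum_distrib_right mult_ac)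
  finally show ?thesis using assms by simp
qed

text \<open>For constant \<open>u\<close> this is the variance of a sum of \<open>p\<close>
  independent centred variables. A weight that depends only on the coordinates in \<open>J\<close>
  spoils just the cross terms with both indices in \<open>J\<close>, which accounts for the extra
  \<open>(card J)\<^sup>2\<close>.\<close>

lemma sum_PiE_second_moment:
  fixes h :: "'t \<Rightarrow> real" and u :: "(nat \<Rightarrow> 't) \<Rightarrow> real" and T :: "'t set" and p :: nat
  defines "\<Omega> \<equiv> PiE {..<p} (\<lambda>_. T)"
  assumes T: "finite T" "T \<noteq> {}" and J: "finite J" and h: "sum h T = 0" "\<And>S. S \<in> T \<Longrightarrow> \<bar>h S\<bar> \<le> B"
    and u: "\<And>\<omega>. \<omega> \<in> \<Omega> \<Longrightarrow> u \<omega> \<ge> 0"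
      "\<And>i \<omega> S. i < p \<Longrightarrow> i \<notin> J \<Longrightarrow> \<omega> \<in> \<Omega> \<Longrightarrow> S \<in> T \<Longrightarrow> u (\<omega>(i := S)) = u \<omega>"
  shows "(\<Sum>\<omega>\<in>\<Omega>. u \<omega> * (\<Sum>i<p. h (\<omega> i))\<^sup>2) \<le> B\<^sup>2 * (real p + (real (card J))\<^sup>2) * (\<Sum>\<omega>\<in>\<Omega>. u \<omega>)"
proof -
  define U where "U = (\<Sum>\<omega>\<in>\<Omega>. u \<omega>)"
  have U0: "U \<ge> 0" unfolding U_def using u(1) by (rule sum_nonneg)
  define t where "t i j = (\<Sum>\<omega>\<in>\<Omega>. u \<omega> * (h (\<omega> i) * h (\<omega> j)))" for i j
  have "(\<Sum>\<omega>\<in>\<Omega>. u \<omega> * (\<Sum>i<p. h (\<omega> i))\<^sup>2) = (\<Sum>\<omega>\<in>\<Omega>. \<Sum>i<p. \<Sum>j<p. u \<omega> * (h (\<omega> i) * h (\<omega> j)))"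
    by (simp only: power2_eq_square sum_product) (simp only: sum_distrib_left)
  also have "\<dots> = (\<Sum>i<p. \<Sum>j<p. t i j)"
    unfolding t_def by (subst sum.swap) (intro sum.cong refl, rule sum.swap)
  also have "\<dots> \<le> (\<Sum>i<p. \<Sum>j<p. (of_bool (i = j) + of_bool (i \<in> J) * of_bool (j \<in> J)) * (B\<^sup>2 * U))"
  proof (intro sum_mono)
    fix i j assume ij: "i \<in> {..<p}" "j \<in> {..<p}"
    have b: "t i j \<le> B\<^sup>2 * U"
      unfolding U_def t_def sum_distrib_left
    proof (rule sum_mono)
      fix \<omega> assume w: "\<omega> \<in> \<Omega>"
      then have "\<omega> i \<in> T" "\<omega> j \<in> T" using ij by (auto simp: \<Omega>_def)
      then have "\<bar>h (\<omega> i)\<bar> * \<bar>h (\<omega> j)\<bar> \<le> B * B"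
        using h(2)[of "\<omega> i"] h(2)[of "\<omega> j"] by (intro mult_mono) auto
      then have "h (\<omega> i) * h (\<omega> j) \<le> B\<^sup>2" by (simp add: power2_eq_square flip: abs_mult)
      then show "u \<omega> * (h (\<omega> i) * h (\<omega> j)) \<le> B\<^sup>2 * u \<omega>"
        using u(1)[OF w] mult_left_mono[of "h (\<omega> i) * h (\<omega> j)" "B\<^sup>2" "u \<omega>"] by (simp add: mult.commute)
    qed
    have BU: "B\<^sup>2 * U \<ge> 0" using U0 by simp
    have z1: "t i j = 0" if "i \<noteq> j" "i \<notin> J"
      unfolding t_def \<Omega>_def using that ij T h u(2)[of i] by (intro sum_PiE_orthogonal) (auto simp: \<Omega>_def)
    have z2: "t i j = 0" if "i \<noteq> j" "j \<notin> J"
    proof -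
      have "t j i = 0"
        unfolding t_def \<Omega>_def using that ij T h u(2)[of j] by (intro sum_PiE_orthogonal) (auto simp: \<Omega>_def)
      then show ?thesis unfolding t_def by (simp add: mult.commute)
    qed
    show "t i j \<le> (of_bool (i = j) + of_bool (i \<in> J) * of_bool (j \<in> J)) * (B\<^sup>2 * U)"
      using b BU z1 z2 by (cases "i = j"; cases "i \<in> J"; cases "j \<in> J") auto
  qed
  also have "\<dots> = ((\<Sum>i<p. \<Sum>j<p. of_bool (i = j)) + (\<Sum>i<p. of_bool (i \<in> J)) * (\<Sum>j<p. of_bool (j \<in> J))) * (B\<^sup>2 * U)"
    by (simp only: sum_distrib_right[symmetric] sum.distrib sum_product)
  also have "\<dots> \<le> (real p + (real (card J))\<^sup>2) * (B\<^sup>2 * U)"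
  proof (rule mult_right_mono)
    have "(\<Sum>i<p. \<Sum>j<p. of_bool (i = j)) = real p" by (simp add: of_bool_def)
    moreover have "card ({..<p} \<inter> J) \<le> card J" using J by (simp add: card_mono)
    then have "real (card ({..<p} \<inter> J)) * real (card ({..<p} \<inter> J)) \<le> real (card J) * real (card J)"
      by (intro mult_mono) auto
    ultimately show "(\<Sum>i<p. \<Sum>j<p. of_bool (i = j)) + (\<Sum>i<p. of_bool (i \<in> J)) * (\<Sum>j<p. of_bool (j \<in> J)) \<le> real p + (real (card J))\<^sup>2"
      by (simp add: power2_eq_square)
  qed (use U0 in simp)
  finally show ?thesis unfolding U_def by (simp add: mult_ac)
qed

text \<open>Tiles are drawn with replacement to keep the coordinates independent; a union bound over
  pairs shows that repetitions are rare.\<close>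

lemma sum_PiE_non_injective:
  fixes p :: nat and T :: "'t set"
  defines "\<Omega> \<equiv> PiE {..<p} (\<lambda>_. T)"
  assumes "finite T" "T \<noteq> {}"
  shows "(\<Sum>\<omega>\<in>\<Omega>. of_bool (\<not> inj_on \<omega> {..<p})) \<le> (real p)\<^sup>2 / real (card T) * real (card \<Omega>)"
proof -
  have pair: "(\<Sum>\<omega>\<in>\<Omega>. of_bool (i \<noteq> j \<and> \<omega> i = \<omega> j)) \<le> real (card \<Omega>) / real (card T)" if "i < p" "j < p" for i j
  proof (cases "i = j")
    case False
    have "real (card T) * (\<Sum>\<omega>\<in>\<Omega>. of_bool (\<omega> i = \<omega> j)) = (\<Sum>\<omega>\<in>\<Omega>. \<Sum>S\<in>T. of_bool (S = \<omega> j))"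
      using sum_PiE_resample[of i "{..<p}", where T=T and \<phi>="\<lambda>\<omega>. of_bool (\<omega> i = \<omega> j)"] that False unfolding \<Omega>_def by simp
    also have "\<dots> = (\<Sum>\<omega>\<in>\<Omega>. 1)"
      using that assms(2) by (intro sum.cong refl) (auto simp: \<Omega>_def of_bool_def)
    finally show ?thesis using assms False by (simp add: field_simps card_gt_0_iff)
  qed simp
  have "(\<Sum>\<omega>\<in>\<Omega>. of_bool (\<not> inj_on \<omega> {..<p})) \<le> (\<Sum>\<omega>\<in>\<Omega>. \<Sum>i<p. \<Sum>j<p. of_bool (i \<noteq> j \<and> \<omega> i = \<omega> j) :: real)"
  proof (rule sum_mono)
    fix \<omega>
    show "of_bool (\<not> inj_on \<omega> {..<p}) \<le> (\<Sum>i<p. \<Sum>j<p. of_bool (i \<noteq> j \<and> \<omega> i = \<omega> j) :: real)"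
    proof (cases "inj_on \<omega> {..<p}")
      case False
      then obtain i j where ij: "i < p" "j < p" "i \<noteq> j" "\<omega> i = \<omega> j" by (auto simp: inj_on_def)
      have "(1::real) = of_bool (i \<noteq> j \<and> \<omega> i = \<omega> j)" using ij by simp
      also have "\<dots> \<le> (\<Sum>j<p. of_bool (i \<noteq> j \<and> \<omega> i = \<omega> j))"
        using ij by (intro member_le_sum[of j "{..<p}" "\<lambda>j. of_bool (i \<noteq> j \<and> \<omega> i = \<omega> j) :: real"]) auto
      also have "\<dots> \<le> (\<Sum>i<p. \<Sum>j<p. of_bool (i \<noteq> j \<and> \<omega> i = \<omega> j))"
        using ij by (intro member_le_sum[of i "{..<p}" "\<lambda>i. \<Sum>j<p. of_bool (i \<noteq> j \<and> \<omega> i = \<omega> j) :: real"]) (auto intro: sum_nonneg)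
      finally show ?thesis using False by simp
    qed (simp add: sum_nonneg)
  qed
  also have "\<dots> = (\<Sum>i<p. \<Sum>j<p. \<Sum>\<omega>\<in>\<Omega>. of_bool (i \<noteq> j \<and> \<omega> i = \<omega> j))"
    by (subst sum.swap) (intro sum.cong refl, rule sum.swap)
  also have "\<dots> \<le> (\<Sum>i<p. \<Sum>j<p. real (card \<Omega>) / real (card T))"
    using pair by (intro sum_mono) auto
  also have "\<dots> = (real p)\<^sup>2 / real (card T) * real (card \<Omega>)" by (simp add: power2_eq_square)
  finally show ?thesis .
qed

text \<open>The index \<open>p\<close> stands for the fixed block \<open>L\<close> of uncovered vertices; smaller indices are sampled
  tiles.\<close>
definition sample_block :: "nat \<Rightarrow> 'a set \<Rightarrow> (nat \<Rightarrow> 'a set) \<Rightarrow> nat \<Rightarrow> 'a set" where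
  "sample_block p L \<omega> j = (if j < p then \<omega> j else L)"

text \<open>Counted with multiplicity, so that each summand depends on a single draw and the total
  weight is the same for all samples. If the draws are distinct members of a tiling and
  \<open>L\<close> is disjoint from them, it is the indicator of the sampled vertex set.\<close>

definition sample_weight :: "nat \<Rightarrow> 'a set \<Rightarrow> (nat \<Rightarrow> 'a set) \<Rightarrow> 'a \<Rightarrow> real" where
  "sample_weight p L \<omega> v = (\<Sum>j\<le>p. of_bool (v \<in> sample_block p L \<omega> j))"

lemma sum_sample_weight:
  assumes "finite V" "L \<subseteq> V" "\<And>S. S \<in> T \<Longrightarrow> S \<subseteq> V \<and> card S = m" "\<omega> \<in> PiE {..<p} (\<lambda>_. T)"
  shows "(\<Sum>v\<in>V. sample_weight p L \<omega> v) = real (card L + p * m)"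
proof -
  have c: "(\<Sum>v\<in>V. of_bool (v \<in> S)) = real (card S)" if "S \<subseteq> V" for S
    using that assms(1) by (simp add: Int_absorb1)
  have "(\<Sum>v\<in>V. sample_weight p L \<omega> v) = (\<Sum>j\<le>p. \<Sum>v\<in>V. of_bool (v \<in> sample_block p L \<omega> j))"
    unfolding sample_weight_def by (rule sum.swap)
  also have "\<dots> = (\<Sum>j<p. \<Sum>v\<in>V. of_bool (v \<in> \<omega> j)) + (\<Sum>v\<in>V. of_bool (v \<in> L))"
    by (simp add: sample_block_def flip: lessThan_Suc_atMost del: sum_of_bool_eq)
  also have "(\<Sum>j<p. \<Sum>v\<in>V. of_bool (v \<in> \<omega> j)) = (\<Sum>j<p. real m)"
  proof (intro sum.cong refl)
    fix j assume "j \<in> {..<p}"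
    then have "\<omega> j \<in> T" using assms(4) by auto
    then show "(\<Sum>v\<in>V. of_bool (v \<in> \<omega> j)) = real m" using c[of "\<omega> j"] assms(3) by simp
  qed
  finally show ?thesis using c[OF assms(2)] by (simp del: sum_of_bool_eq)
qed

text \<open>The pairs at which deviations are measured lie in the sample themselves, so they are not
  independent of it. Expanding both weights fixes the blocks of \<open>x\<close> and
  \<open>y\<close>; such a term depends on at most two coordinates, whence the 4 in
  \<open>p + 4\<close>.\<close>

lemma sampled_pairs_second_moment:
  fixes T :: "'a set set" and h :: "'a \<Rightarrow> 'a \<Rightarrow> 'a set \<Rightarrow> real" and B :: real and p m :: nat
  defines "\<Omega> \<equiv> PiE {..<p} (\<lambda>_. T)"
  assumes V: "finite V" "L \<subseteq> V" and T: "finite T" "T \<noteq> {}" "\<And>S. S \<in> T \<Longrightarrow> S \<subseteq> V \<and> card S = m"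
    and h: "\<And>x y. sum (h x y) T = 0" "\<And>x y S. S \<in> T \<Longrightarrow> \<bar>h x y S\<bar> \<le> B"
  shows "(\<Sum>\<omega>\<in>\<Omega>. \<Sum>x\<in>V. \<Sum>y\<in>V. sample_weight p L \<omega> x * sample_weight p L \<omega> y * (\<Sum>i<p. h x y (\<omega> i))\<^sup>2)
     \<le> B\<^sup>2 * (real p + 4) * (real (card L + p * m))\<^sup>2 * real (card \<Omega>)"
proof -
  let ?w = "sample_weight p L"
  define C where "C = B\<^sup>2 * (real p + 4)"
  have C0: "C \<ge> 0" by (simp add: C_def)
  have pair: "(\<Sum>\<omega>\<in>\<Omega>. ?w \<omega> x * ?w \<omega> y * (\<Sum>i<p. h x y (\<omega> i))\<^sup>2) \<le> C * (\<Sum>\<omega>\<in>\<Omega>. ?w \<omega> x * ?w \<omega> y)" for x y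
  proof -
    define u where "u j j' \<omega> = (of_bool (x \<in> sample_block p L \<omega> j) * of_bool (y \<in> sample_block p L \<omega> j') :: real)" for j j' \<omega>
    have ww: "?w \<omega> x * ?w \<omega> y = (\<Sum>j\<le>p. \<Sum>j'\<le>p. u j j' \<omega>)" for \<omega>
      unfolding sample_weight_def u_def by (rule sum_product)
    have sw: "(\<Sum>\<omega>\<in>\<Omega>. ?w \<omega> x * ?w \<omega> y * g \<omega>) = (\<Sum>j\<le>p. \<Sum>j'\<le>p. \<Sum>\<omega>\<in>\<Omega>. u j j' \<omega> * g \<omega>)" for g
      unfolding ww sum_distrib_right by (subst sum.swap) (intro sum.cong refl, rule sum.swap)
    have "(\<Sum>\<omega>\<in>\<Omega>. ?w \<omega> x * ?w \<omega> y * (\<Sum>i<p. h x y (\<omega> i))\<^sup>2) =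
        (\<Sum>j\<le>p. \<Sum>j'\<le>p. \<Sum>\<omega>\<in>\<Omega>. u j j' \<omega> * (\<Sum>i<p. h x y (\<omega> i))\<^sup>2)" by (rule sw)
    also have "\<dots> \<le> (\<Sum>j\<le>p. \<Sum>j'\<le>p. C * (\<Sum>\<omega>\<in>\<Omega>. u j j' \<omega>))"
    proof (intro sum_mono)
      fix j j'
      have "(\<Sum>\<omega>\<in>\<Omega>. u j j' \<omega> * (\<Sum>i<p. h x y (\<omega> i))\<^sup>2) \<le>
         B\<^sup>2 * (real p + (real (card {j, j'}))\<^sup>2) * (\<Sum>\<omega>\<in>\<Omega>. u j j' \<omega>)"
        unfolding \<Omega>_def using T h by (intro sum_PiE_second_moment) (auto simp: u_def sample_block_def)
      also have "\<dots> \<le> C * (\<Sum>\<omega>\<in>\<Omega>. u j j' \<omega>)"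
      proof -
        have "real (card {j, j'}) \<le> 2" by (cases "j = j'") auto
        then have "(real (card {j, j'}))\<^sup>2 \<le> 2\<^sup>2" by (intro power_mono) auto
        then have "B\<^sup>2 * (real p + (real (card {j, j'}))\<^sup>2) \<le> C" unfolding C_def by (intro mult_left_mono) auto
        then show ?thesis by (intro mult_right_mono sum_nonneg) (auto simp: u_def)
      qed
      finally show "(\<Sum>\<omega>\<in>\<Omega>. u j j' \<omega> * (\<Sum>i<p. h x y (\<omega> i))\<^sup>2) \<le> C * (\<Sum>\<omega>\<in>\<Omega>. u j j' \<omega>)" .
    qed
    also have "\<dots> = C * (\<Sum>\<omega>\<in>\<Omega>. ?w \<omega> x * ?w \<omega> y)"
      using sw[of "\<lambda>_. 1"] by (simp add: sum_distrib_left)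
    finally show ?thesis .
  qed
  have swap3: "(\<Sum>\<omega>\<in>\<Omega>. \<Sum>x\<in>V. \<Sum>y\<in>V. g \<omega> x y) = (\<Sum>x\<in>V. \<Sum>y\<in>V. \<Sum>\<omega>\<in>\<Omega>. g \<omega> x y)" for g :: "_ \<Rightarrow> _ \<Rightarrow> _ \<Rightarrow> real"
    by (subst sum.swap) (intro sum.cong refl, rule sum.swap)
  have "(\<Sum>\<omega>\<in>\<Omega>. \<Sum>x\<in>V. \<Sum>y\<in>V. ?w \<omega> x * ?w \<omega> y * (\<Sum>i<p. h x y (\<omega> i))\<^sup>2) \<le>
      (\<Sum>x\<in>V. \<Sum>y\<in>V. C * (\<Sum>\<omega>\<in>\<Omega>. ?w \<omega> x * ?w \<omega> y))"
    unfolding swap3 using pair by (intro sum_mono)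
  also have "\<dots> = C * (\<Sum>\<omega>\<in>\<Omega>. \<Sum>x\<in>V. \<Sum>y\<in>V. ?w \<omega> x * ?w \<omega> y)"
    unfolding swap3 by (simp add: sum_distrib_left)
  also have "(\<Sum>\<omega>\<in>\<Omega>. \<Sum>x\<in>V. \<Sum>y\<in>V. ?w \<omega> x * ?w \<omega> y) = (\<Sum>\<omega>\<in>\<Omega>. (real (card L + p * m))\<^sup>2)"
  proof (intro sum.cong refl)
    fix \<omega> assume "\<omega> \<in> \<Omega>"
    then have "(\<Sum>v\<in>V. ?w \<omega> v) = real (card L + p * m)"
      using V T by (intro sum_sample_weight) (auto simp: \<Omega>_def)
    then show "(\<Sum>x\<in>V. \<Sum>y\<in>V. ?w \<omega> x * ?w \<omega> y) = (real (card L + p * m))\<^sup>2"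
      by (simp add: power2_eq_square flip: sum_product)
  qed
  finally show ?thesis by (simp add: C_def mult_ac)
qed

text \<open>There are three bad events, a repetition and a second moment above four times its bound
  in either family. Each has probability at most 1/4, by Markov's inequality for the last two, so
  some sample avoids them all.\<close>

lemma exists_concentrated_sample:
  fixes T :: "'a set set" and L :: "'a set" and h1 h2 :: "'a \<Rightarrow> 'a \<Rightarrow> 'a set \<Rightarrow> real" and B1 B2 :: real and p m :: nat
  defines "N \<equiv> real (card L + p * m)"
  assumes V: "finite V" "L \<subseteq> V" and T: "finite T" "T \<noteq> {}" "\<And>S. S \<in> T \<Longrightarrow> S \<subseteq> V \<and> card S = m"
    and h1: "\<And>x y. sum (h1 x y) T = 0" "\<And>x y S. S \<in> T \<Longrightarrow> \<bar>h1 x y S\<bar> \<le> B1"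
    and h2: "\<And>x y. sum (h2 x y) T = 0" "\<And>x y S. S \<in> T \<Longrightarrow> \<bar>h2 x y S\<bar> \<le> B2"
    and par: "B1 > 0" "B2 > 0" "N > 0" "4 * p\<^sup>2 \<le> card T"
  shows "\<exists>\<omega>\<in>PiE {..<p} (\<lambda>_. T). inj_on \<omega> {..<p} \<and>
     (\<Sum>x\<in>V. \<Sum>y\<in>V. sample_weight p L \<omega> x * sample_weight p L \<omega> y * (\<Sum>i<p. h1 x y (\<omega> i))\<^sup>2) \<le> 4 * (B1\<^sup>2 * (real p + 4) * N\<^sup>2) \<and>
     (\<Sum>x\<in>V. \<Sum>y\<in>V. sample_weight p L \<omega> x * sample_weight p L \<omega> y * (\<Sum>i<p. h2 x y (\<omega> i))\<^sup>2) \<le> 4 * (B2\<^sup>2 * (real p + 4) * N\<^sup>2)"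
proof (rule ccontr)
  assume neg: "\<not> ?thesis"
  define \<Omega> where "\<Omega> = PiE {..<p} (\<lambda>_. T)"
  define F where "F h \<omega> = (\<Sum>x\<in>V. \<Sum>y\<in>V. sample_weight p L \<omega> x * sample_weight p L \<omega> y * (\<Sum>i<p. h x y (\<omega> i))\<^sup>2)"
    for h :: "'a \<Rightarrow> 'a \<Rightarrow> 'a set \<Rightarrow> real" and \<omega>
  define b1 where "b1 = B1\<^sup>2 * (real p + 4) * N\<^sup>2"
  define b2 where "b2 = B2\<^sup>2 * (real p + 4) * N\<^sup>2"
  have b: "b1 > 0" "b2 > 0" using par by (auto simp: b1_def b2_def)
  have F0: "F h \<omega> \<ge> 0" for h \<omega>
    unfolding F_def sample_weight_def by (intro sum_nonneg mult_nonneg_nonneg) auto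
  have m1: "(\<Sum>\<omega>\<in>\<Omega>. F h1 \<omega>) \<le> b1 * real (card \<Omega>)"
    unfolding F_def \<Omega>_def b1_def N_def using V T h1 by (intro sampled_pairs_second_moment) auto
  have m2: "(\<Sum>\<omega>\<in>\<Omega>. F h2 \<omega>) \<le> b2 * real (card \<Omega>)"
    unfolding F_def \<Omega>_def b2_def N_def using V T h2 by (intro sampled_pairs_second_moment) auto
  have m3: "(\<Sum>\<omega>\<in>\<Omega>. of_bool (\<not> inj_on \<omega> {..<p})) \<le> (real p)\<^sup>2 / real (card T) * real (card \<Omega>)"
    unfolding \<Omega>_def using T by (intro sum_PiE_non_injective) auto
  have fin\<Omega>: "finite \<Omega>" "\<Omega> \<noteq> {}" using T by (auto simp: \<Omega>_def finite_PiE PiE_eq_empty_iff)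
  then have c0: "real (card \<Omega>) > 0" by (simp add: card_gt_0_iff)
  have "real (4 * p\<^sup>2) \<le> real (card T)" using par by (simp only: of_nat_le_iff)
  then have "(real p)\<^sup>2 / real (card T) \<le> 1 / 4" using T by (simp add: divide_le_eq card_gt_0_iff)
  then have "(real p)\<^sup>2 / real (card T) * real (card \<Omega>) \<le> 1 / 4 * real (card \<Omega>)" by (intro mult_right_mono) auto
  then have m3': "(\<Sum>\<omega>\<in>\<Omega>. of_bool (\<not> inj_on \<omega> {..<p})) \<le> real (card \<Omega>) / 4" using m3 by linarith
  have "real (card \<Omega>) = (\<Sum>\<omega>\<in>\<Omega>. 1)" by simp
  also have "\<dots> \<le> (\<Sum>\<omega>\<in>\<Omega>. of_bool (\<not> inj_on \<omega> {..<p}) + F h1 \<omega> / (4 * b1) + F h2 \<omega> / (4 * b2))"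
  proof (rule sum_mono)
    fix \<omega> assume "\<omega> \<in> \<Omega>"
    then have "\<not> inj_on \<omega> {..<p} \<or> F h1 \<omega> > 4 * b1 \<or> F h2 \<omega> > 4 * b2"
      using neg unfolding \<Omega>_def F_def b1_def b2_def by (auto simp: not_le)
    moreover have "F h1 \<omega> / (4 * b1) \<ge> 0" "F h2 \<omega> / (4 * b2) \<ge> 0" using F0 b by auto
    moreover have "F h1 \<omega> / (4 * b1) \<ge> 1" if "F h1 \<omega> > 4 * b1" using that b by simp
    moreover have "F h2 \<omega> / (4 * b2) \<ge> 1" if "F h2 \<omega> > 4 * b2" using that b by simp
    ultimately show "1 \<le> of_bool (\<not> inj_on \<omega> {..<p}) + F h1 \<omega> / (4 * b1) + F h2 \<omega> / (4 * b2)"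
      by (elim disjE) auto
  qed
  also have "\<dots> = (\<Sum>\<omega>\<in>\<Omega>. of_bool (\<not> inj_on \<omega> {..<p})) + (\<Sum>\<omega>\<in>\<Omega>. F h1 \<omega>) / (4 * b1) + (\<Sum>\<omega>\<in>\<Omega>. F h2 \<omega>) / (4 * b2)"
    by (simp only: sum.distrib sum_divide_distrib)
  also have "\<dots> \<le> real (card \<Omega>) / 4 + b1 * real (card \<Omega>) / (4 * b1) + b2 * real (card \<Omega>) / (4 * b2)"
    using m1 m2 m3' b by (intro add_mono divide_right_mono) auto
  also have "\<dots> = 3 / 4 * real (card \<Omega>)" using b by simp
  finally show False using c0 by simp
qed

lemma codeg_le_card: "finite S \<Longrightarrow> codeg S R x y \<le> real (card S)"
  unfolding codeg_def using sum_bounded_above[of S "\<lambda>z. of_bool (R x y z) :: real" 1] by simp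

lemma abs_diff_le_of_bounds:
  fixes a b :: real
  assumes "0 \<le> a" "a \<le> B" "0 \<le> b" "b \<le> B"
  shows "\<bar>a - b\<bar> \<le> B"
  using assms by (auto simp: abs_if)

lemma average_bounds:
  fixes f :: "'b \<Rightarrow> real"
  assumes "finite T" "T \<noteq> {}" "\<And>S. S \<in> T \<Longrightarrow> 0 \<le> f S \<and> f S \<le> B"
  shows "0 \<le> sum f T / real (card T)" "sum f T / real (card T) \<le> B"
    "(\<Sum>S\<in>T. f S - sum f T / real (card T)) = 0"
proof -
  have c: "real (card T) > 0" using assms by (simp add: card_gt_0_iff)
  show "0 \<le> sum f T / real (card T)" using assms by (auto intro!: divide_nonneg_nonneg sum_nonneg)
  have "sum f T \<le> real (card T) * B" using assms by (intro sum_bounded_above) auto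
  then show "sum f T / real (card T) \<le> B" using c by (simp add: divide_le_eq mult.commute)
  show "(\<Sum>S\<in>T. f S - sum f T / real (card T)) = 0" using c by (simp add: sum_subtractf)
qed

text \<open>A degree in the sample is quadratic in the draws and is handled by two linear steps: the
  codegree of a pair is, up to \<open>L\<close>, a sum over the drawn tiles with mean
  \<open>\<mu> x y\<close> per tile, and the sum of \<open>\<mu> x\<close> over the sample is again
  such a sum, with mean \<open>\<nu> x\<close>. The summand \<open>2 * card L * N\<close> in the
  degree assumption pays for the pairs that meet \<open>L\<close>.\<close>

lemma sample_nearly_regular:
  fixes V L :: "'a set" and s t r p :: nat and D \<epsilon> c \<eta> :: real
  defines "m \<equiv> s + t + r"
  defines "N \<equiv> real (card L + p * m)"
  assumes V: "finite V" and T: "tiling R s t r V T" "finite T" "T \<noteq> {}" and L: "L \<subseteq> V - \<Union>T"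
    and par: "s > 0" "p > 0" "\<eta> > 0" "4 * p\<^sup>2 \<le> card T" "80 * real m ^ 4 \<le> \<eta>\<^sup>2 * real p"
    and cod: "\<And>x y. x \<in> V \<Longrightarrow> y \<in> V \<Longrightarrow> x \<noteq> y \<Longrightarrow> c * N \<le> real p * (codeg (\<Union>T) R x y / real (card T))"
    and dg: "\<And>x. x \<in> V \<Longrightarrow> \<bar>(real p)\<^sup>2 * (deg (\<Union>T) R x / (real (card T))\<^sup>2) - D * N\<^sup>2\<bar> + 2 * real (card L) * N \<le> \<epsilon> * D * N\<^sup>2"
  shows "\<exists>T0\<subseteq>T. card T0 = p \<and> card (L \<union> \<Union>T0) = card L + p * m \<and> nearly_regular (L \<union> \<Union>T0) R D \<epsilon> c \<eta>"
proof -
  define k where "k = real (card T)"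
  define U where "U = \<Union>T"
  have k0: "k > 0" using T by (simp add: k_def card_gt_0_iff)
  have TS: "S \<subseteq> V \<and> card S = m" "finite S" if "S \<in> T" for S
    using T(1) that tile_card[of R s t r S] by (auto simp: tiling_def m_def)
  have disT: "S \<inter> S' = {}" if "S \<in> T" "S' \<in> T" "S \<noteq> S'" for S S'
    using T(1) that by (auto simp: tiling_def pairwise_def disjnt_def)
  have m0: "m > 0" using par by (simp add: m_def)
  have LV: "L \<subseteq> V" "finite L" using L V by (auto intro: finite_subset)
  have sumU: "sum g U = (\<Sum>S\<in>T. sum g S)" for g :: "'a \<Rightarrow> real"
    unfolding U_def using disT TS by (subst sum.Union_disjoint) auto
  define \<mu> where "\<mu> x y = codeg U R x y / k" for x y
  define h2 where "h2 x y S = codeg S R x y - \<mu> x y" for x y S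
  have codU: "codeg U R x y = (\<Sum>S\<in>T. codeg S R x y)" for x y unfolding codeg_def by (rule sumU)
  have cb: "0 \<le> codeg S R x y \<and> codeg S R x y \<le> real m" if "S \<in> T" for S x y
    using codeg_nonneg[of S R x y] codeg_le_card[of S R x y] TS[OF that] by simp
  have av2: "0 \<le> \<mu> x y" "\<mu> x y \<le> real m" "(\<Sum>S\<in>T. codeg S R x y - \<mu> x y) = 0" for x y
    using average_bounds[OF T(2,3), of "\<lambda>S. codeg S R x y" "real m"] cb unfolding \<mu>_def codU k_def by auto
  have h2a: "sum (h2 x y) T = 0" for x y unfolding h2_def by (rule av2(3))
  have h2b: "\<bar>h2 x y S\<bar> \<le> real m" if "S \<in> T" for x y S
    unfolding h2_def using cb[OF that, of x y] av2(1,2)[of x y] by (intro abs_diff_le_of_bounds) auto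
  define \<nu> where "\<nu> x = sum (\<mu> x) U / k" for x
  \<comment> \<open>The argument \<open>y\<close> is a dummy that lets the estimate for pairs be
    reused; the factor \<open>N\<close> from summing over it cancels in the bound for
    \<open>e1\<close>.\<close>
  define h1 where "h1 x (y::'a) S = sum (\<mu> x) S - \<nu> x" for x y S
  have kb: "0 \<le> sum (\<mu> x) S \<and> sum (\<mu> x) S \<le> (real m)\<^sup>2" if "S \<in> T" for S x
  proof
    show "0 \<le> sum (\<mu> x) S" using av2(1) by (simp add: sum_nonneg)
    show "sum (\<mu> x) S \<le> (real m)\<^sup>2"
      using sum_bounded_above[of S "\<mu> x" "real m"] av2(2) TS[OF that] by (simp add: power2_eq_square)
  qed
  have av1: "0 \<le> \<nu> x" "\<nu> x \<le> (real m)\<^sup>2" "(\<Sum>S\<in>T. sum (\<mu> x) S - \<nu> x) = 0" for x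
    using average_bounds[OF T(2,3), of "sum (\<mu> x)" "(real m)\<^sup>2"] kb unfolding \<nu>_def sumU k_def by auto
  have h1a: "sum (h1 x y) T = 0" for x y unfolding h1_def by (rule av1(3))
  have h1b: "\<bar>h1 x y S\<bar> \<le> (real m)\<^sup>2" if "S \<in> T" for x y S
    unfolding h1_def using kb[OF that, of x] av1(1,2)[of x] by (intro abs_diff_le_of_bounds) auto
  have nu: "\<nu> x = deg U R x / k\<^sup>2" for x
    by (simp add: \<nu>_def \<mu>_def deg_def power2_eq_square flip: sum_divide_distrib)
  have pN: "real p \<le> N" "N > 0"
  proof -
    have "p * 1 \<le> p * m" using m0 by (intro mult_left_mono) auto
    then show "real p \<le> N" unfolding N_def of_nat_le_iff by linarith
    then show "N > 0" using par by simp
  qed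
  have "\<exists>\<omega>\<in>PiE {..<p} (\<lambda>_. T). inj_on \<omega> {..<p} \<and>
     (\<Sum>x\<in>V. \<Sum>y\<in>V. sample_weight p L \<omega> x * sample_weight p L \<omega> y * (\<Sum>i<p. h1 x y (\<omega> i))\<^sup>2) \<le> 4 * (((real m)\<^sup>2)\<^sup>2 * (real p + 4) * N\<^sup>2) \<and>
     (\<Sum>x\<in>V. \<Sum>y\<in>V. sample_weight p L \<omega> x * sample_weight p L \<omega> y * (\<Sum>i<p. h2 x y (\<omega> i))\<^sup>2) \<le> 4 * ((real m)\<^sup>2 * (real p + 4) * N\<^sup>2)"
    unfolding N_def using V LV T TS h1a h1b h2a h2b m0 par pN(2)
    by (intro exists_concentrated_sample) (auto simp: N_def)
  then obtain \<omega> where w: "\<omega> \<in> PiE {..<p} (\<lambda>_. T)" "inj_on \<omega> {..<p}"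
    and E1: "(\<Sum>x\<in>V. \<Sum>y\<in>V. sample_weight p L \<omega> x * sample_weight p L \<omega> y * (\<Sum>i<p. h1 x y (\<omega> i))\<^sup>2) \<le> 4 * (((real m)\<^sup>2)\<^sup>2 * (real p + 4) * N\<^sup>2)"
    and E2: "(\<Sum>x\<in>V. \<Sum>y\<in>V. sample_weight p L \<omega> x * sample_weight p L \<omega> y * (\<Sum>i<p. h2 x y (\<omega> i))\<^sup>2) \<le> 4 * ((real m)\<^sup>2 * (real p + 4) * N\<^sup>2)"
    by blast
  have wT: "\<omega> i \<in> T" if "i < p" for i using w(1) that by auto
  define T0 where "T0 = \<omega> ` {..<p}"
  have T0: "T0 \<subseteq> T" "card T0 = p" using wT w(2) by (auto simp: T0_def card_image)
  define W where "W = L \<union> \<Union>T0"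
  have WV: "W \<subseteq> V" using LV(1) T0(1) TS(1) unfolding W_def by blast
  have fW: "finite W" using WV V finite_subset by blast
  have disL: "L \<inter> S = {}" if "S \<in> T" for S using L that by auto
  have sumW: "sum g W = sum g L + (\<Sum>i<p. sum g (\<omega> i))" for g :: "'a \<Rightarrow> real"
  proof -
    have "sum g W = sum g L + sum g (\<Union>T0)"
    proof -
      have "finite (\<Union>T0)" using fW by (simp add: W_def)
      moreover have "L \<inter> \<Union>T0 = {}" using L T0(1) by blast
      ultimately show ?thesis unfolding W_def using LV(2) by (intro sum.union_disjoint)
    qed
    also have "sum g (\<Union>T0) = (\<Sum>S\<in>T0. sum g S)"
      using disT TS T0(1) by (subst sum.Union_disjoint) (auto simp: subset_iff)
    also have "\<dots> = (\<Sum>i<p. sum g (\<omega> i))" unfolding T0_def using w(2) by (simp add: sum.reindex)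
    finally show ?thesis .
  qed
  have cW: "real (card W) = N"
  proof -
    have "real (card W) = real (card L) + (\<Sum>i<p. real (card (\<omega> i)))" using sumW[of "\<lambda>_. 1"] by simp
    also have "(\<Sum>i<p. real (card (\<omega> i))) = (\<Sum>i<p. real m)" using wT TS by (intro sum.cong refl) auto
    finally show ?thesis by (simp add: N_def)
  qed
  have wW: "sample_weight p L \<omega> v = of_bool (v \<in> W)" for v
  proof (cases "v \<in> L")
    case True
    then have "v \<notin> \<omega> j" if "j < p" for j using disL wT[OF that] by auto
    then have "(\<Sum>j<p. of_bool (v \<in> \<omega> j)) = (0::real)" by simp
    then show ?thesis using True
      by (simp add: sample_weight_def sample_block_def W_def flip: lessThan_Suc_atMost del: sum_of_bool_eq)
  next
    case False
    then have e: "sample_weight p L \<omega> v = (\<Sum>j<p. of_bool (v \<in> \<omega> j))"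
      by (simp add: sample_weight_def sample_block_def flip: lessThan_Suc_atMost del: sum_of_bool_eq)
    show ?thesis
    proof (cases "\<exists>i<p. v \<in> \<omega> i")
      case True
      then obtain i where i: "i < p" "v \<in> \<omega> i" by blast
      have "v \<in> \<omega> j \<longleftrightarrow> j = i" if "j < p" for j
        using disT[OF wT[OF that] wT[OF i(1)]] i that inj_onD[OF w(2), of j i] by auto
      then have "(\<Sum>j<p. of_bool (v \<in> \<omega> j)) = (\<Sum>j<p. of_bool (j = i) :: real)" by (intro sum.cong) auto
      also have "\<dots> = 1" using i by (simp add: of_bool_def)
      finally show ?thesis using e i by (auto simp: W_def T0_def)
    next
      case False
      then show ?thesis using e \<open>v \<notin> L\<close> by (auto simp: W_def T0_def)
    qed
  qed
  have sV: "(\<Sum>x\<in>V. of_bool (x \<in> W) * g x) = sum g W" for g :: "'a \<Rightarrow> real"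
  proof -
    have "V \<inter> W = W" using WV by auto
    then show ?thesis using V sum.inter_restrict[of V g W] by (auto intro!: sum.cong)
  qed
  have sVV: "(\<Sum>x\<in>V. \<Sum>y\<in>V. sample_weight p L \<omega> x * sample_weight p L \<omega> y * g x y) = (\<Sum>x\<in>W. \<Sum>y\<in>W. g x y)" for g
    unfolding wW by (simp only: mult.assoc sum_distrib_left[symmetric] sV)
  define e1 where "e1 x = (\<Sum>i<p. sum (\<mu> x) (\<omega> i) - \<nu> x)" for x
  define e2 where "e2 x y = (\<Sum>i<p. h2 x y (\<omega> i))" for x y
  \<comment> \<open>Half of the allowed error, since the degree estimate has two terms of size
    \<open>a * N\<^sup>2\<close>. The 80 in the assumption on \<open>p\<close> is 4 from the
    concentration bound, 5 from \<open>p + 4 \<le> 5 * p\<close>, and 4 from squaring this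
    half.\<close>
  define a where "a = \<eta> * N / 2"
  have a0: "a > 0" using par pN by (simp add: a_def)
  have mp: "4 * (real m ^ 4 * (real p + 4)) \<le> a\<^sup>2"
  proof -
    have "real p + 4 \<le> 5 * real p" using par by simp
    then have "4 * (real m ^ 4 * (real p + 4)) \<le> 4 * (real m ^ 4 * (5 * real p))"
      by (intro mult_left_mono) auto
    also have "\<dots> = 80 * real m ^ 4 * real p / 4" by simp
    also have "\<dots> \<le> \<eta>\<^sup>2 * real p * real p / 4" using par by (intro divide_right_mono mult_right_mono) auto
    also have "\<dots> \<le> \<eta>\<^sup>2 * N\<^sup>2 / 4"
    proof -
      have "real p * real p \<le> N * N" using pN by (intro mult_mono) auto
      then have "\<eta>\<^sup>2 * (real p * real p) \<le> \<eta>\<^sup>2 * (N * N)" by (intro mult_left_mono) auto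
      then show ?thesis by (simp add: power2_eq_square mult.assoc)
    qed
    also have "\<dots> = a\<^sup>2" by (simp add: a_def power_mult_distrib power_divide)
    finally show ?thesis .
  qed
  have mp2: "4 * ((real m)\<^sup>2 * (real p + 4)) \<le> a\<^sup>2"
  proof -
    have "(real m)\<^sup>2 \<le> real m ^ 4" using m0 by (intro power_increasing) auto
    then have "4 * ((real m)\<^sup>2 * (real p + 4)) \<le> 4 * (real m ^ 4 * (real p + 4))"
      by (intro mult_left_mono mult_right_mono) auto
    then show ?thesis using mp by linarith
  qed
  have S2: "(\<Sum>x\<in>W. \<Sum>y\<in>W. \<bar>e2 x y\<bar>) \<le> a * N\<^sup>2"
  proof -
    have "(\<Sum>q\<in>W\<times>W. (e2 (fst q) (snd q))\<^sup>2) = (\<Sum>x\<in>W. \<Sum>y\<in>W. (e2 x y)\<^sup>2)"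
      unfolding sum.cartesian_product case_prod_beta ..
    also have "\<dots> \<le> 4 * ((real m)\<^sup>2 * (real p + 4)) * N\<^sup>2" using E2 unfolding sVV e2_def by (simp add: mult.assoc)
    also have "\<dots> \<le> a\<^sup>2 * N\<^sup>2" using mp2 by (intro mult_right_mono) auto
    also have "\<dots> = a\<^sup>2 * real (card (W \<times> W))" using cW by (simp add: card_cartesian_product power2_eq_square)
    finally have "(\<Sum>q\<in>W\<times>W. \<bar>e2 (fst q) (snd q)\<bar>) \<le> a * real (card (W \<times> W))"
      using a0 by (rule sum_abs_le_of_sum_squares)
    moreover have "(\<Sum>q\<in>W\<times>W. \<bar>e2 (fst q) (snd q)\<bar>) = (\<Sum>x\<in>W. \<Sum>y\<in>W. \<bar>e2 x y\<bar>)"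
      unfolding sum.cartesian_product case_prod_beta ..
    ultimately show ?thesis using cW by (simp add: card_cartesian_product power2_eq_square)
  qed
  have S1: "(\<Sum>x\<in>W. \<bar>e1 x\<bar>) \<le> a * N"
  proof -
    have "(\<Sum>x\<in>W. \<Sum>y\<in>W. (e1 x)\<^sup>2) \<le> 4 * (real m ^ 4 * (real p + 4)) * N\<^sup>2"
      using E1 unfolding sVV e1_def h1_def by (simp add: mult.assoc flip: power_mult)
    also have "\<dots> \<le> a\<^sup>2 * N\<^sup>2" using mp by (intro mult_right_mono) auto
    finally have "N * (\<Sum>x\<in>W. (e1 x)\<^sup>2) \<le> N * (a\<^sup>2 * N)"
      using cW by (simp add: sum_distrib_left power2_eq_square mult_ac)
    then have "(\<Sum>x\<in>W. (e1 x)\<^sup>2) \<le> a\<^sup>2 * real (card W)" using pN cW by simp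
    then have "(\<Sum>x\<in>W. \<bar>e1 x\<bar>) \<le> a * real (card W)" using a0 by (rule sum_abs_le_of_sum_squares)
    then show ?thesis using cW by simp
  qed
  have codW: "codeg W R x y = e2 x y + real p * \<mu> x y + codeg L R x y" for x y
  proof -
    have "codeg W R x y = codeg L R x y + (\<Sum>i<p. codeg (\<omega> i) R x y)" unfolding codeg_def by (rule sumW)
    then show ?thesis by (simp add: e2_def h2_def sum_subtractf)
  qed
  have codL: "0 \<le> codeg L R x y" "codeg L R x y \<le> real (card L)" for x y
    by (rule codeg_nonneg, rule codeg_le_card[OF LV(2)])
  have muW: "sum (\<mu> x) W = e1 x + real p * \<nu> x + sum (\<mu> x) L" for x
    unfolding sumW e1_def by (simp add: sum_subtractf)
  have muL: "0 \<le> sum (\<mu> x) L" "sum (\<mu> x) L \<le> real (card L) * real m" for x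
    using av2(1,2) sum_bounded_above[of L "\<mu> x" "real m"] by (auto intro: sum_nonneg)
  have degW: "\<bar>deg W R x - (real p)\<^sup>2 * \<nu> x\<bar> \<le> real p * \<bar>e1 x\<bar> + (\<Sum>y\<in>W. \<bar>e2 x y\<bar>) + 2 * real (card L) * N" for x
  proof -
    define A where "A = (\<Sum>y\<in>W. e2 x y)"
    define Cl where "Cl = (\<Sum>y\<in>W. codeg L R x y)"
    have "deg W R x = A + real p * sum (\<mu> x) W + Cl"
      unfolding deg_def codW by (simp add: sum.distrib sum_distrib_left A_def Cl_def)
    then have e: "deg W R x - (real p)\<^sup>2 * \<nu> x = A + real p * e1 x + real p * sum (\<mu> x) L + Cl"
      unfolding muW by (simp add: algebra_simps power2_eq_square)
    have "\<bar>A\<bar> \<le> (\<Sum>y\<in>W. \<bar>e2 x y\<bar>)" unfolding A_def by (rule sum_abs)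
    moreover have "\<bar>real p * e1 x\<bar> = real p * \<bar>e1 x\<bar>" by (simp add: abs_mult)
    moreover have "0 \<le> Cl" unfolding Cl_def using codL by (simp add: sum_nonneg)
    moreover have "Cl \<le> real (card L) * N"
      unfolding Cl_def using sum_bounded_above[of W "codeg L R x" "real (card L)"] codL cW by (simp add: mult.commute)
    moreover have "0 \<le> real p * sum (\<mu> x) L" using muL by simp
    moreover have "real p * sum (\<mu> x) L \<le> real (card L) * N"
    proof -
      have "real p * sum (\<mu> x) L \<le> real p * (real (card L) * real m)" using muL by (intro mult_left_mono) auto
      also have "\<dots> = real (card L) * real (p * m)" by simp
      also have "\<dots> \<le> real (card L) * N" by (intro mult_left_mono) (auto simp: N_def)
      finally show ?thesis .
    qed
    ultimately show ?thesis unfolding e by linarith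
  qed
  have "(\<Sum>v\<in>W. max 0 (\<bar>deg W R v - D * N ^ 2\<bar> - \<epsilon> * D * N ^ 2)) \<le> (\<Sum>v\<in>W. real p * \<bar>e1 v\<bar> + (\<Sum>y\<in>W. \<bar>e2 v y\<bar>))"
  proof (rule sum_mono)
    fix v assume "v \<in> W"
    then have "\<bar>(real p)\<^sup>2 * \<nu> v - D * N\<^sup>2\<bar> + 2 * real (card L) * N \<le> \<epsilon> * D * N\<^sup>2"
      using dg[of v] WV nu[of v] by (auto simp: U_def k_def)
    then have "\<bar>deg W R v - D * N ^ 2\<bar> - \<epsilon> * D * N ^ 2 \<le> real p * \<bar>e1 v\<bar> + (\<Sum>y\<in>W. \<bar>e2 v y\<bar>)"
      using degW[of v] by linarith
    moreover have "0 \<le> real p * \<bar>e1 v\<bar> + (\<Sum>y\<in>W. \<bar>e2 v y\<bar>)" by (simp add: sum_nonneg)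
    ultimately show "max 0 (\<bar>deg W R v - D * N ^ 2\<bar> - \<epsilon> * D * N ^ 2) \<le> real p * \<bar>e1 v\<bar> + (\<Sum>y\<in>W. \<bar>e2 v y\<bar>)" by simp
  qed
  also have "\<dots> = real p * (\<Sum>v\<in>W. \<bar>e1 v\<bar>) + (\<Sum>v\<in>W. \<Sum>y\<in>W. \<bar>e2 v y\<bar>)"
    by (simp add: sum.distrib sum_distrib_left)
  also have "\<dots> \<le> N * (a * N) + a * N\<^sup>2"
    using S1 S2 pN by (intro add_mono mult_mono) (auto intro: sum_nonneg)
  also have "\<dots> = \<eta> * N ^ 3" by (simp add: a_def power2_eq_square power3_eq_cube)
  finally have R1: "(\<Sum>v\<in>W. max 0 (\<bar>deg W R v - D * N ^ 2\<bar> - \<epsilon> * D * N ^ 2)) \<le> \<eta> * N ^ 3" .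
  have "(\<Sum>x\<in>W. \<Sum>y\<in>W. of_bool (x \<noteq> y) * max 0 (c * N - codeg W R x y)) \<le> (\<Sum>x\<in>W. \<Sum>y\<in>W. \<bar>e2 x y\<bar>)"
  proof (intro sum_mono)
    fix x y assume "x \<in> W" "y \<in> W"
    then have "c * N \<le> real p * \<mu> x y" if "x \<noteq> y" using cod[of x y] that WV by (auto simp: \<mu>_def U_def k_def)
    then have "c * N - codeg W R x y \<le> \<bar>e2 x y\<bar>" if "x \<noteq> y" using that codL(1)[of x y] unfolding codW by fastforce
    then show "of_bool (x \<noteq> y) * max 0 (c * N - codeg W R x y) \<le> \<bar>e2 x y\<bar>" by (cases "x = y") auto
  qed
  also have "\<dots> \<le> a * N\<^sup>2" by (rule S2)
  also have "\<dots> \<le> \<eta> * N ^ 3" using par pN by (simp add: a_def power2_eq_square power3_eq_cube)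
  finally have R2: "(\<Sum>x\<in>W. \<Sum>y\<in>W. of_bool (x \<noteq> y) * max 0 (c * N - codeg W R x y)) \<le> \<eta> * N ^ 3" .
  have "nearly_regular W R D \<epsilon> c \<eta>" unfolding nearly_regular_def cW using R1 R2 by simp
  moreover have "card W = card L + p * m" using cW unfolding N_def by (simp only: of_nat_eq_iff)
  ultimately show ?thesis using T0 unfolding W_def by blast
qed

section \<open>Packings covering all but a constant number of vertices\<close>

lemma edge_rel_three_graph:
  assumes "three_graph V G"
  shows "edge_rel (\<lambda>x y z. {x, y, z} \<in> G)"
  unfolding edge_rel_def
proof (intro allI impI)
  fix x y z assume g: "{x, y, z} \<in> G"
  then have "card {x, y, z} = 3" using assms by (auto simp: three_graph_def)
  then have "x \<noteq> y" by (auto simp: card_insert_if split: if_splits)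
  then show "{y, x, z} \<in> G \<and> {x, z, y} \<in> G \<and> x \<noteq> y" using g by (simp add: insert_commute)
qed

lemma codeg_eq_card_pair_link:
  assumes "three_graph V G"
  shows "codeg V (\<lambda>x y z. {x, y, z} \<in> G) x y = real (card (pair_link G x y))"
proof -
  have "V \<inter> {z. {x, y, z} \<in> G} = pair_link G x y" using assms by (auto simp: three_graph_def pair_link_def)
  then show ?thesis using assms by (simp add: codeg_def three_graph_def)
qed

lemma deg_eq_card_vertex_link:
  assumes G: "three_graph V G"
  shows "deg V (\<lambda>x y z. {x, y, z} \<in> G) v = 2 * real (card (vertex_link G v))"
proof -
  have fV: "finite V" using G by (simp add: three_graph_def)
  define A where "A = {p \<in> V \<times> V. {v, fst p, snd p} \<in> G}"
  define f where "f p = {fst p, snd p}" for p :: "'a \<times> 'a"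
  have fA: "finite A" using fV by (simp add: A_def)
  have "deg V (\<lambda>x y z. {x, y, z} \<in> G) v = (\<Sum>p\<in>V \<times> V. of_bool ({v, fst p, snd p} \<in> G))"
    unfolding deg_def codeg_def sum.cartesian_product case_prod_beta ..
  also have "\<dots> = real (card A)" using fV by (simp add: A_def Int_def del: mem_Times_iff)
  finally have 1: "deg V (\<lambda>x y z. {x, y, z} \<in> G) v = real (card A)" .
  have im: "f ` A = vertex_link G v"
  proof
    show "f ` A \<subseteq> vertex_link G v" by (auto simp: f_def A_def vertex_link_def)
    show "vertex_link G v \<subseteq> f ` A"
    proof
      fix e assume "e \<in> vertex_link G v"
      then obtain a b where ab: "e = {a, b}" "{v, a, b} \<in> G" by (auto simp: vertex_link_def)
      then have "(a, b) \<in> A" using G by (fastforce simp: A_def three_graph_def)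
      then show "e \<in> f ` A" using ab by (auto simp: f_def intro!: image_eqI[of _ _ "(a, b)"])
    qed
  qed
  have "card A = (\<Sum>e\<in>f ` A. card {p \<in> A. f p = e})"
    using sum.image_gen[OF fA, of "\<lambda>_. 1 :: nat" f] by simp
  also have "\<dots> = (\<Sum>e\<in>f ` A. 2)"
  proof (rule sum.cong[OF refl])
    fix e assume "e \<in> f ` A"
    then obtain a b where ab: "(a, b) \<in> A" "e = {a, b}" by (auto simp: f_def)
    have ne: "a \<noteq> b"
      using ab edge_relD(8)[OF edge_rel_three_graph[OF G], of v a b] by (auto simp: A_def)
    have "{p \<in> A. f p = e} = {(a, b), (b, a)}"
      using ab by (auto simp: f_def A_def doubleton_eq_iff insert_commute)
    then show "card {p \<in> A. f p = e} = 2" using ne by simp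
  qed
  finally show ?thesis using 1 im by simp
qed

text \<open>Copies need not be induced, so the complete tripartite graph on the parts of
  \<open>F\<close> may take its place: every edge of \<open>F\<close> has one vertex in each part,
  and all such triples of a tile are edges.\<close>

lemma tile_is_copy:
  assumes F: "three_partite VF F X Y Z"
    and S: "tile (\<lambda>x y z. {x, y, z} \<in> G) (card X) (card Y) (card Z) S" "S \<subseteq> V"
  shows "\<exists>H. is_copy VF F V G (S, H)"
proof -
  obtain A B C where ABC: "S = A \<union> B \<union> C" "A \<inter> B = {}" "A \<inter> C = {}" "B \<inter> C = {}" "finite S"
     "card A = card X" "card B = card Y" "card C = card Z" "\<forall>a\<in>A. \<forall>b\<in>B. \<forall>c\<in>C. {a, b, c} \<in> G"
    using S(1) unfolding tile_def by blast
  have XYZ: "X \<union> Y \<union> Z = VF" "X \<inter> Y = {}" "X \<inter> Z = {}" "Y \<inter> Z = {}" "finite VF"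
    using F by (auto simp: three_partite_def three_graph_def)
  have "finite X" "finite Y" "finite Z" using XYZ by auto
  moreover have "finite A" "finite B" "finite C" using ABC by auto
  ultimately obtain f g h where fgh: "bij_betw f X A" "bij_betw g Y B" "bij_betw h Z C"
    using ABC(6-8) by (metis finite_same_card_bij)
  define \<phi> where "\<phi> v = (if v \<in> X then f v else if v \<in> Y then g v else h v)" for v
  have 1: "bij_betw \<phi> X A" using fgh(1) by (rule bij_betw_cong[THEN iffD1, rotated]) (simp add: \<phi>_def)
  have 2: "bij_betw \<phi> Y B"
    using fgh(2) by (rule bij_betw_cong[THEN iffD1, rotated]) (use XYZ(2) in \<open>auto simp: \<phi>_def\<close>)
  have 3: "bij_betw \<phi> Z C"
    using fgh(3) by (rule bij_betw_cong[THEN iffD1, rotated]) (use XYZ(3,4) in \<open>auto simp: \<phi>_def\<close>)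
  have "bij_betw \<phi> (X \<union> Y) (A \<union> B)" using 1 2 ABC(2) by (rule bij_betw_combine)
  then have "bij_betw \<phi> (X \<union> Y \<union> Z) (A \<union> B \<union> C)"
    by (rule bij_betw_combine[OF _ 3]) (use ABC(3,4) in auto)
  then have bij: "bij_betw \<phi> VF S" using XYZ(1) ABC(1) by simp
  have "\<phi> ` e \<in> G" if "e \<in> F" for e
  proof -
    have "card (e \<inter> X) = 1" "card (e \<inter> Y) = 1" "card (e \<inter> Z) = 1" "e \<subseteq> VF"
      using F that by (auto simp: three_partite_def three_graph_def)
    then obtain x y z where xyz: "e \<inter> X = {x}" "e \<inter> Y = {y}" "e \<inter> Z = {z}"
      by (metis card_1_singletonE)
    then have "e = {x, y, z}" using XYZ(1) \<open>e \<subseteq> VF\<close> by blast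
    moreover have "x \<in> X" "y \<in> Y" "z \<in> Z" using xyz by blast+
    then have "\<phi> x \<in> A" "\<phi> y \<in> B" "\<phi> z \<in> C"
      using bij_betw_apply[OF 1] bij_betw_apply[OF 2] bij_betw_apply[OF 3] by simp_all
    ultimately show ?thesis using ABC(9) by simp
  qed
  then have "is_copy VF F V G (S, (\<lambda>e. \<phi> ` e) ` F)"
    using bij S(2) by (auto simp: is_copy_def)
  then show ?thesis by blast
qed

lemma tiling_packing:
  assumes F: "three_partite VF F X Y Z"
    and T: "tiling (\<lambda>x y z. {x, y, z} \<in> G) (card X) (card Y) (card Z) V T"
  shows "\<exists>P. is_packing VF F V G P \<and> covered P = \<Union>T"
proof -
  have "\<forall>S\<in>T. \<exists>H. is_copy VF F V G (S, H)" using T unfolding tiling_def by (blast intro: tile_is_copy[OF F])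
  then obtain H where H: "\<And>S. S \<in> T \<Longrightarrow> is_copy VF F V G (S, H S)" by metis
  define P where "P = (\<lambda>S. (S, H S)) ` T"
  have "is_packing VF F V G P"
    using H T by (auto simp: is_packing_def P_def disjoint_family_on_def tiling_def pairwise_def disjnt_def)
  moreover have "covered P = \<Union>T" by (auto simp: covered_def P_def)
  ultimately show ?thesis by blast
qed

section \<open>The exchange argument for maximum tilings\<close>

lemma deg_subset_bounds:
  assumes "finite V" "U \<subseteq> V"
  shows "codeg V R x y - real (card (V - U)) \<le> codeg U R x y"
    and "deg U R x \<le> deg V R x"
    and "deg V R x - 2 * real (card (V - U)) * real (card V) \<le> deg U R x"
proof -
  have fU: "finite U" using assms finite_subset by blast
  have split: "sum g V = sum g U + sum g (V - U)" for g :: "'a \<Rightarrow> real"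
    using sum.subset_diff[OF assms(2,1)] by (simp add: add.commute)
  have cb: "codeg W R x y \<le> real (card W)" if "finite W" for W x y using codeg_le_card[OF that] .
  have c: "codeg V R x y = codeg U R x y + codeg (V - U) R x y" for x y unfolding codeg_def by (rule split)
  show c1: "codeg V R x y - real (card (V - U)) \<le> codeg U R x y" for y
    using c[of x y] cb[of "V - U" x y] assms by simp
  have "deg V R x = (\<Sum>y\<in>U. codeg V R x y) + (\<Sum>y\<in>V - U. codeg V R x y)" unfolding deg_def by (rule split)
  also have "(\<Sum>y\<in>U. codeg V R x y) = deg U R x + (\<Sum>y\<in>U. codeg (V - U) R x y)"
    unfolding deg_def c by (simp add: sum.distrib)
  finally have d: "deg V R x = deg U R x + (\<Sum>y\<in>U. codeg (V - U) R x y) + (\<Sum>y\<in>V - U. codeg V R x y)" .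
  have "(\<Sum>y\<in>U. codeg (V - U) R x y) \<ge> 0" "(\<Sum>y\<in>V - U. codeg V R x y) \<ge> 0"
    by (simp_all add: sum_nonneg codeg_nonneg)
  then show "deg U R x \<le> deg V R x" using d by linarith
  have "(\<Sum>y\<in>U. codeg (V - U) R x y) \<le> real (card U) * real (card (V - U))"
    using cb assms by (intro sum_bounded_above) auto
  also have "\<dots> \<le> real (card V) * real (card (V - U))" using assms by (intro mult_right_mono) (auto simp: card_mono)
  finally have 1: "(\<Sum>y\<in>U. codeg (V - U) R x y) \<le> real (card V) * real (card (V - U))" .
  have "(\<Sum>y\<in>V - U. codeg V R x y) \<le> real (card (V - U)) * real (card V)"
    using cb assms by (intro sum_bounded_above) auto
  then show "deg V R x - 2 * real (card (V - U)) * real (card V) \<le> deg U R x"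
    using 1 d by (simp add: mult.commute)
qed

text \<open>In the application \<open>M\<close> counts the vertices of the sampled tiles,
  \<open>b\<close> the added uncovered ones, \<open>a\<close> is the size to which \<open>V\<close>
  is scaled down, and \<open>q\<close> is a degree divided by \<open>n\<^sup>2\<close>. As
  \<open>a\<close> and \<open>N\<close> agree up to a factor 1 + O(\<gamma>), the degree errs by at
  most \<open>10 * \<gamma> * D + 2 * \<gamma>\<close> and \<open>2 * b * N\<close> adds
  \<open>6 * \<gamma>\<close>, each times \<open>N\<^sup>2\<close>; this is the coefficient
  \<open>10 * D + 8\<close>.\<close>

lemma scaled_degree_close:
  fixes a q D \<epsilon> \<gamma> N b M :: real
  assumes "0 < \<gamma>" "\<gamma> \<le> 1/8" "0 < D" "\<gamma> \<le> D / 4" "0 \<le> \<epsilon>" "\<epsilon> \<le> 1 / 4" "\<gamma> * (10 * D + 8) \<le> \<epsilon> * D"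
    and "0 < M" "M \<le> a" "a * (1 - \<gamma>) \<le> M" "N = M + b" "0 \<le> b" "b \<le> 3 * \<gamma> * M"
    and q: "(1 - \<epsilon>) * D - 2 * \<gamma> \<le> q" "q \<le> (1 + \<epsilon>) * D"
  shows "\<bar>a\<^sup>2 * q - D * N\<^sup>2\<bar> + 2 * b * N \<le> 2 * \<epsilon> * D * N\<^sup>2"
proof -
  have N0: "N > 0" "M \<le> N" using assms by auto
  have a0: "a > 0" using assms by linarith
  have "(1 - 3 * \<gamma>) * N \<le> M"
  proof -
    have "(1 - 3 * \<gamma>) * N = M + b - 3 * \<gamma> * M - 3 * \<gamma> * b" using assms by (simp add: algebra_simps)
    moreover have "0 \<le> 3 * \<gamma> * b" using assms by simp
    ultimately show ?thesis using assms by linarith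
  qed
  then have lo: "(1 - 3 * \<gamma>) * N \<le> a" using assms by linarith
  have hi: "a \<le> (1 + 2 * \<gamma>) * N"
  proof -
    have "2 * \<gamma> * \<gamma> \<le> 2 * \<gamma> * (1 / 8)" using assms by (intro mult_left_mono) auto
    then have "1 \<le> (1 + 2 * \<gamma>) * (1 - \<gamma>)" using assms by (simp add: algebra_simps)
    then have "a * 1 \<le> a * ((1 + 2 * \<gamma>) * (1 - \<gamma>))" using a0 by (intro mult_left_mono) auto
    also have "\<dots> = (1 + 2 * \<gamma>) * (a * (1 - \<gamma>))" by simp
    also have "\<dots> \<le> (1 + 2 * \<gamma>) * N" using assms N0 by (intro mult_left_mono) auto
    finally show ?thesis by simp
  qed
  have q0: "q \<ge> 0"
  proof -
    have "\<epsilon> * D \<le> 1 / 4 * D" using assms by (intro mult_right_mono) auto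
    moreover have "(1 - \<epsilon>) * D = D - \<epsilon> * D" by (simp add: algebra_simps)
    ultimately show ?thesis using assms by linarith
  qed
  have "a\<^sup>2 \<le> ((1 + 2 * \<gamma>) * N)\<^sup>2" using hi a0 by (intro power_mono) auto
  also have "\<dots> = (1 + 4 * \<gamma> + 4 * \<gamma> * \<gamma>) * N\<^sup>2" by (simp add: power2_eq_square algebra_simps)
  also have "\<dots> \<le> (1 + 5 * \<gamma>) * N\<^sup>2"
  proof (rule mult_right_mono)
    have "4 * \<gamma> * \<gamma> \<le> 4 * \<gamma> * (1 / 8)" using assms by (intro mult_left_mono) auto
    then show "1 + 4 * \<gamma> + 4 * \<gamma> * \<gamma> \<le> 1 + 5 * \<gamma>" using assms by linarith
  qed simp
  finally have a_hi: "a\<^sup>2 \<le> (1 + 5 * \<gamma>) * N\<^sup>2" .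
  have "((1 - 3 * \<gamma>) * N)\<^sup>2 \<le> a\<^sup>2" using lo N0 assms by (intro power_mono) auto
  moreover have "((1 - 3 * \<gamma>) * N)\<^sup>2 = (1 - 6 * \<gamma> + 9 * \<gamma> * \<gamma>) * N\<^sup>2" by (simp add: power2_eq_square algebra_simps)
  moreover have "(1 - 6 * \<gamma>) * N\<^sup>2 \<le> (1 - 6 * \<gamma> + 9 * \<gamma> * \<gamma>) * N\<^sup>2" using assms by (intro mult_right_mono) auto
  ultimately have a_lo: "(1 - 6 * \<gamma>) * N\<^sup>2 \<le> a\<^sup>2" by linarith
  have up: "a\<^sup>2 * q \<le> (D + \<epsilon> * D + 10 * \<gamma> * D) * N\<^sup>2"
  proof -
    have "a\<^sup>2 * q \<le> ((1 + 5 * \<gamma>) * N\<^sup>2) * ((1 + \<epsilon>) * D)" using a_hi q q0 assms by (intro mult_mono) auto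
    also have "\<dots> = (D + \<epsilon> * D + 5 * \<gamma> * (1 + \<epsilon>) * D) * N\<^sup>2" by (simp add: algebra_simps)
    also have "\<dots> \<le> (D + \<epsilon> * D + 5 * \<gamma> * 2 * D) * N\<^sup>2"
      using assms by (intro mult_right_mono add_left_mono mult_left_mono) auto
    finally show ?thesis by simp
  qed
  have dn: "(D - \<epsilon> * D - 2 * \<gamma> - 6 * \<gamma> * D) * N\<^sup>2 \<le> a\<^sup>2 * q"
  proof -
    have "(1 - 6 * \<gamma>) * N\<^sup>2 * q \<le> a\<^sup>2 * q" using a_lo q0 by (intro mult_right_mono) auto
    moreover have "((1 - 6 * \<gamma>) * N\<^sup>2) * ((1 - \<epsilon>) * D - 2 * \<gamma>) \<le> ((1 - 6 * \<gamma>) * N\<^sup>2) * q"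
      using q assms by (intro mult_left_mono) auto
    moreover have "(D - \<epsilon> * D - 2 * \<gamma> - 6 * \<gamma> * D) * N\<^sup>2 \<le> ((1 - 6 * \<gamma>) * ((1 - \<epsilon>) * D - 2 * \<gamma>)) * N\<^sup>2"
      using assms by (intro mult_right_mono) (auto simp: algebra_simps)
    ultimately show ?thesis by (simp add: mult_ac)
  qed
  have "2 * b * N \<le> 6 * \<gamma> * N\<^sup>2"
  proof -
    have "3 * \<gamma> * M \<le> 3 * \<gamma> * N" using N0 assms by (intro mult_left_mono) auto
    then have "b \<le> 3 * \<gamma> * N" using assms by linarith
    then have "b * N \<le> 3 * \<gamma> * N * N" using N0 by (intro mult_right_mono) auto
    then show ?thesis by (simp add: power2_eq_square mult_ac)
  qed
  moreover have "\<bar>a\<^sup>2 * q - D * N\<^sup>2\<bar> \<le> (\<epsilon> * D + 10 * \<gamma> * D + 2 * \<gamma>) * N\<^sup>2"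
  proof -
    have "0 \<le> \<gamma> * D * N\<^sup>2" "0 \<le> \<gamma> * N\<^sup>2" using assms by auto
    then show ?thesis using up dn by (auto simp: abs_if algebra_simps)
  qed
  moreover have "(\<gamma> * (10 * D + 8)) * N\<^sup>2 \<le> \<epsilon> * D * N\<^sup>2" using assms by (intro mult_right_mono) auto
  ultimately show ?thesis by (simp add: algebra_simps)
qed

lemma tiling_exchange:
  assumes T: "tiling R s t r V T" "finite T" "T0 \<subseteq> T" and L: "L \<subseteq> V - \<Union>T"
    and T1: "tiling R s t r (L \<union> \<Union>T0) T1" "finite T1" and s: "s > 0"
  shows "\<exists>T'. tiling R s t r V T' \<and> card T' = card T - card T0 + card T1"
proof -
  have ne: "S \<noteq> {}" if "tile R s t r S" for S using tile_card[OF that] s by auto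
  have T0V: "\<Union>T0 \<subseteq> V" using T(1,3) by (auto simp: tiling_def)
  have dis: "S \<inter> S' = {}" if "S \<in> T - T0" "S' \<in> T1" for S S'
  proof -
    have "S \<inter> X = {}" if "X \<in> T0" for X
    proof -
      have "S \<in> T" "X \<in> T" "S \<noteq> X" using T(3) \<open>S \<in> T - T0\<close> that by auto
      then show ?thesis using T(1) by (auto simp: tiling_def pairwise_def disjnt_def)
    qed
    then have "S \<inter> \<Union>T0 = {}" by blast
    moreover have "S \<inter> L = {}" using L that by auto
    moreover have "S' \<subseteq> L \<union> \<Union>T0" using T1(1) that by (auto simp: tiling_def)
    ultimately show ?thesis by blast
  qed
  have "(T - T0) \<inter> T1 = {}"
  proof (rule equals0I)
    fix S assume S: "S \<in> (T - T0) \<inter> T1"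
    then have "tile R s t r S" using T1(1) by (auto simp: tiling_def)
    then show False using ne[of S] dis[of S S] S by simp
  qed
  then have "card ((T - T0) \<union> T1) = card T - card T0 + card T1"
    using T T1(2) by (simp add: card_Un_disjoint card_Diff_subset finite_subset)
  moreover have "tiling R s t r V ((T - T0) \<union> T1)"
    unfolding tiling_def
  proof
    show "\<forall>S\<in>T - T0 \<union> T1. tile R s t r S \<and> S \<subseteq> V"
      using T(1) T1(1) L T0V unfolding tiling_def by blast
    have "disjoint (T - T0)" using T(1) by (auto simp: tiling_def pairwise_def)
    moreover have "disjoint T1" using T1(1) by (simp add: tiling_def)
    moreover have "disjnt S S'" "disjnt S' S" if "S \<in> T - T0" "S' \<in> T1" for S S'
      using dis[OF that] by (auto simp: disjnt_def)
    ultimately show "disjoint (T - T0 \<union> T1)" by (intro pairwiseI) (auto dest: pairwiseD)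
  qed
  ultimately show ?thesis by blast
qed

lemma card_Union_tiling:
  assumes "tiling R s t r V T" "finite V"
  shows "card (\<Union>T) = (s + t + r) * card T"
proof -
  have S: "finite S" "card S = s + t + r" if "S \<in> T" for S
    using assms(1) tile_card[of R s t r S] that by (auto simp: tiling_def)
  have "card (\<Union>T) = (\<Sum>S\<in>T. card S)"
    using assms S(1) by (intro card_Union_disjoint) (auto simp: tiling_def)
  also have "\<dots> = (\<Sum>S\<in>T. s + t + r)" using S(2) by (intro sum.cong) auto
  finally show ?thesis by simp
qed

lemma tiling_up_to_constant:
  fixes s t r :: nat and c1 c2 :: real
  assumes st: "s > t" and c: "0 < c1" "0 < c2"
  shows "\<exists>\<epsilon>>0. \<exists>C>0. \<exists>n0. \<forall>(V :: 'b set) R. finite V \<and> card V > n0 \<and> edge_rel R \<and>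
     (\<forall>v\<in>V. \<bar>deg V R v - 2 * c1 * (real (card V))\<^sup>2\<bar> \<le> \<epsilon> * (2 * c1) * (real (card V))\<^sup>2) \<and>
     (\<forall>u\<in>V. \<forall>v\<in>V. u \<noteq> v \<longrightarrow> codeg V R u v > c2 * real (card V)) \<longrightarrow>
     (\<exists>T. tiling R s t r V T \<and> card (V - \<Union>T) \<le> C)"
proof -
  define m where "m = s + t + r"
  define D where "D = 2 * c1"
  \<comment> \<open>\<open>\<epsilon>'\<close> and \<open>d\<close> are what the almost perfect
    tiling tolerates. \<open>V\<close> itself is asked for half the irregularity and twice the
    codegree, which leaves room for the errors in passing to a sample; \<open>\<gamma>\<close> is
    then chosen small against that room.\<close>
  define d where "d = c2 / 2"
  define \<epsilon>' where "\<epsilon>' = min (1/2) (d / (2 * real m * D))"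
  define \<epsilon> where "\<epsilon> = \<epsilon>' / 2"
  define \<gamma> where "\<gamma> = min (min (1/8) (c2 / 4)) (min (D / 4) (\<epsilon> * D / (10 * D + 8)))"
  have m1: "m \<ge> 1" using st by (simp add: m_def)
  have D0: "D > 0" "d > 0" using c by (auto simp: D_def d_def)
  have e': "\<epsilon>' > 0" "\<epsilon>' \<le> 1/2" using D0 m1 by (auto simp: \<epsilon>'_def)
  have "\<epsilon>' \<le> d / (2 * real m * D)" by (simp add: \<epsilon>'_def)
  moreover have "2 * real m * D > 0" using D0 m1 by simp
  ultimately have "\<epsilon>' * (2 * real m * D) \<le> d" by (simp only: pos_le_divide_eq)
  then have e'm: "real (s + t + r) * \<epsilon>' * D \<le> d / 2" unfolding m_def[symmetric] by (simp add: mult_ac)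
  have e: "\<epsilon> > 0" "\<epsilon> \<le> 1/4" using e' by (auto simp: \<epsilon>_def)
  have "0 < \<epsilon> * D / (10 * D + 8)" using e D0 by simp
  then have g: "0 < \<gamma>" "\<gamma> \<le> 1/8" "\<gamma> \<le> c2 / 4" "\<gamma> \<le> D / 4"
    unfolding \<gamma>_def using D0 c by linarith+
  have "\<gamma> \<le> \<epsilon> * D / (10 * D + 8)" by (simp add: \<gamma>_def)
  then have gD: "\<gamma> * (10 * D + 8) \<le> \<epsilon> * D" using D0 by (simp add: pos_le_divide_eq)
  have "\<exists>\<eta>>0. \<exists>n0. \<forall>(V :: 'b set) R. finite V \<and> card V \<ge> n0 \<and> edge_rel R \<and> nearly_regular V R D \<epsilon>' d \<eta> \<longrightarrow>
     (\<exists>T. tiling R s t r V T \<and> real (s + t + r) * real (card T) \<ge> (1 - \<gamma>) * real (card V))"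
    using st D0 e' e'm g by (intro almost_perfect_tiling) auto
  then obtain \<eta> n1 where eta: "\<eta> > 0" and
    apt: "\<And>(V :: 'b set) R. finite V \<Longrightarrow> card V \<ge> n1 \<Longrightarrow> edge_rel R \<Longrightarrow> nearly_regular V R D \<epsilon>' d \<eta> \<Longrightarrow>
     (\<exists>T. tiling R s t r V T \<and> real m * real (card T) \<ge> (1 - \<gamma>) * real (card V))"
    unfolding m_def by metis
  \<comment> \<open>The summands provide, in turn, that the sample is large enough to be tiled, that
    it concentrates, and that \<open>\<gamma> * M \<ge> 1\<close>, which makes rounding in
    \<open>C\<close> harmless.\<close>
  define p where "p = n1 + nat \<lceil>80 * real m ^ 4 / \<eta>\<^sup>2\<rceil> + nat \<lceil>1 / \<gamma>\<rceil> + 1"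
  have p0: "p > 0" "p \<ge> n1" by (auto simp: p_def)
  have p1: "80 * real m ^ 4 \<le> \<eta>\<^sup>2 * real p"
  proof -
    have "80 * real m ^ 4 / \<eta>\<^sup>2 \<le> real p" unfolding p_def by linarith
    then show ?thesis using eta by (simp add: field_simps)
  qed
  have p2: "\<gamma> * real p \<ge> 1"
  proof -
    have "1 / \<gamma> \<le> real p" unfolding p_def by linarith
    then show ?thesis using g by (simp add: field_simps)
  qed
  define M where "M = real (p * m)"
  have Mp: "M \<ge> real p" "M > 0"
  proof -
    have "p * 1 \<le> p * m" using m1 by (intro mult_left_mono) auto
    then show "M \<ge> real p" unfolding M_def of_nat_le_iff by simp
    then show "M > 0" using p0 by simp
  qed
  have gM: "\<gamma> * M \<ge> 1" using p2 Mp g mult_left_mono[of "real p" M \<gamma>] by linarith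
  \<comment> \<open>The aim is \<open>C > \<gamma> * N\<close> with \<open>N = M + C\<close>: a
    tiling that misses a proportion \<gamma> of the enlarged sample then covers more than the
    \<open>M\<close> vertices of the old tiles. The factor 2 suffices because
    \<open>N < 2 * M\<close>.\<close>
  define C where "C = nat \<lceil>2 * \<gamma> * M\<rceil>"
  have C1: "real C \<ge> 2 * \<gamma> * M" "real C \<le> 3 * \<gamma> * M" using gM unfolding C_def by linarith+
  have C0: "C > 0" using C1 gM by simp
  define N where "N = real (C + p * m)"
  have NM: "N = M + real C" by (simp add: N_def M_def)
  have gN: "\<gamma> * N < real C"
  proof -
    have "\<gamma> * N \<le> \<gamma> * (M + 3 * \<gamma> * M)" using C1 g NM by (intro mult_left_mono) auto
    also have "\<dots> = \<gamma> * M * (1 + 3 * \<gamma>)" by (simp add: algebra_simps)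
    also have "\<dots> < \<gamma> * M * 2" using g gM by (intro mult_strict_left_mono) auto
    finally show ?thesis using C1 by linarith
  qed
  \<comment> \<open>A maximum tiling covers at least half of \<open>V\<close>, so this many vertices
    force at least \<open>4 * p\<^sup>2\<close> tiles, and \<open>p\<close> random ones rarely
    repeat.\<close>
  define n0 where "n0 = n1 + 8 * m * p\<^sup>2 + 1"
  have main: "\<exists>T. tiling R s t r V T \<and> card (V - \<Union>T) \<le> C"
    if V: "finite V" "card V > n0" and R: "edge_rel R"
      and dg: "\<And>v. v \<in> V \<Longrightarrow> \<bar>deg V R v - D * (real (card V))\<^sup>2\<bar> \<le> \<epsilon> * D * (real (card V))\<^sup>2"
      and cd: "\<And>u v. u \<in> V \<Longrightarrow> v \<in> V \<Longrightarrow> u \<noteq> v \<Longrightarrow> codeg V R u v > c2 * real (card V)"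
    for V :: "'b set" and R
  proof -
    define n where "n = real (card V)"
    have n0: "n > 0" using V by (simp add: n_def)
    have "nearly_regular V R D \<epsilon>' d \<eta>"
      unfolding nearly_regular_def
    proof
      have "max 0 (\<bar>deg V R v - D * (real (card V))\<^sup>2\<bar> - \<epsilon>' * D * (real (card V))\<^sup>2) = 0" if "v \<in> V" for v
      proof -
        have "\<epsilon> * (D * n\<^sup>2) \<le> \<epsilon>' * (D * n\<^sup>2)" using e' D0 by (intro mult_right_mono) (auto simp: \<epsilon>_def)
        then show ?thesis using dg[OF that] by (simp add: n_def mult.assoc)
      qed
      then show "(\<Sum>v\<in>V. max 0 (\<bar>deg V R v - D * (real (card V))\<^sup>2\<bar> - \<epsilon>' * D * (real (card V))\<^sup>2)) \<le> \<eta> * real (card V) ^ 3"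
        using eta by simp
      have "of_bool (x \<noteq> y) * max 0 (d * real (card V) - codeg V R x y) = 0" if "x \<in> V" "y \<in> V" for x y
      proof (cases "x = y")
        case False
        have "d * n \<le> c2 * n" using n0 c by (intro mult_right_mono) (auto simp: d_def)
        then show ?thesis using cd[OF that False] by (simp add: n_def)
      qed simp
      then have "(\<Sum>x\<in>V. \<Sum>y\<in>V. of_bool (x \<noteq> y) * max 0 (d * real (card V) - codeg V R x y)) = 0"
        by (intro sum.neutral ballI)
      then show "(\<Sum>x\<in>V. \<Sum>y\<in>V. of_bool (x \<noteq> y) * max 0 (d * real (card V) - codeg V R x y)) \<le> \<eta> * real (card V) ^ 3"
        using eta by simp
    qed
    \<comment> \<open>The almost perfect tiling is used first for \<open>V\<close> itself: a maximum
      tiling leaves at most \<open>\<gamma> * n\<close> vertices, hence degrees among covered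
      vertices are close to those in \<open>V\<close>.\<close>
    then obtain T2 where T2: "tiling R s t r V T2" "real m * real (card T2) \<ge> (1 - \<gamma>) * n"
      using apt[OF V(1) _ R] V(2) unfolding n_def n0_def by auto
    have fT: "finite T" "card T \<le> card (Pow V)" if "tiling R s t r V T" for T
    proof -
      have "T \<subseteq> Pow V" using that by (auto simp: tiling_def)
      then show "finite T" "card T \<le> card (Pow V)" using V(1) by (auto intro: finite_subset card_mono)
    qed
    obtain T where T: "tiling R s t r V T" and Tmax: "\<And>T'. tiling R s t r V T' \<Longrightarrow> card T' \<le> card T"
      using ex_has_greatest_nat[of "tiling R s t r V" T2 card "card (Pow V) + 1"] T2(1) fT(2)
      by (metis le_imp_less_Suc Suc_eq_plus1)
    define k where "k = real (card T)"
    define U where "U = \<Union>T"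
    have UV: "U \<subseteq> V" using T by (auto simp: U_def tiling_def)
    have cU: "real (card U) = real m * k"
      using card_Union_tiling[OF T V(1)] by (simp add: U_def m_def k_def)
    have mk: "(1 - \<gamma>) * n \<le> real m * k"
      using T2(2) mult_left_mono[of "real (card T2)" "real (card T)" "real m"] Tmax[OF T2(1)] by (simp add: k_def)
    have cUV: "real m * k \<le> n" using cU card_mono[OF V(1) UV] by (simp add: n_def)
    have cVU: "real (card (V - U)) \<le> \<gamma> * n"
    proof -
      have "real (card (V - U)) = n - real m * k"
        using cU UV V(1) by (simp add: card_Diff_subset finite_subset n_def of_nat_diff card_mono)
      then show ?thesis using mk by (simp add: algebra_simps)
    qed
    have kbig: "4 * p\<^sup>2 \<le> card T"
    proof -
      have "n > real (8 * m * p\<^sup>2)" using V(2) unfolding n_def n0_def of_nat_less_iff by linarith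
      moreover have "1 / 2 * n \<le> (1 - \<gamma>) * n" using g n0 by (intro mult_right_mono) auto
      ultimately have "real m * real (4 * p\<^sup>2) < real m * k" using mk by simp
      then have "real (4 * p\<^sup>2) < k" using m1 by (simp only: mult_less_cancel_left_pos of_nat_0_less_iff)
      then show ?thesis unfolding k_def of_nat_less_iff by simp
    qed
    then have k0: "k > 0" using p0 unfolding k_def by (cases "card T = 0") auto
    show ?thesis
    proof (rule ccontr)
      assume "\<not> ?thesis"
      then have "C \<le> card (V - U)" using T unfolding U_def by (meson nle_le)
      then obtain L where L: "L \<subseteq> V - U" "card L = C" by (meson obtain_subset_with_card_n)
      \<comment> \<open>\<open>p / k\<close> is the scale of the sample relative to the whole
        tiling, so \<open>a\<close> is \<open>V\<close> scaled down. It exceeds \<open>M\<close>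
        only on account of the uncovered vertices.\<close>
      define a where "a = real p * n / k"
      have a1: "M \<le> a"
      proof -
        have "real p * (real m * k) \<le> real p * n" using cUV by (intro mult_left_mono) auto
        then show ?thesis using k0 by (simp add: a_def M_def field_simps)
      qed
      have a2: "a * (1 - \<gamma>) \<le> M"
      proof -
        have "real p * ((1 - \<gamma>) * n) \<le> real p * (real m * k)" using mk by (intro mult_left_mono) auto
        then show ?thesis using k0 by (simp add: a_def M_def field_simps)
      qed
      have "\<exists>T0\<subseteq>T. card T0 = p \<and> card (L \<union> \<Union>T0) = card L + p * (s + t + r) \<and> nearly_regular (L \<union> \<Union>T0) R D \<epsilon>' d \<eta>"
      proof (rule sample_nearly_regular[OF V(1) T])
        show "finite T" using fT T by simp
        show "T \<noteq> {}" using k0 by (auto simp: k_def)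
        show "L \<subseteq> V - \<Union>T" using L by (simp add: U_def)
        show "0 < s" "0 < p" "0 < \<eta>" "4 * p\<^sup>2 \<le> card T" "80 * real (s + t + r) ^ 4 \<le> \<eta>\<^sup>2 * real p"
          using st p0 eta kbig p1 by (auto simp: m_def)
      next
        fix x y assume xy: "x \<in> V" "y \<in> V" "x \<noteq> y"
        have "codeg U R x y \<ge> c2 * n - \<gamma> * n"
          using cd[OF xy] deg_subset_bounds(1)[OF V(1) UV, of R x y] cVU by (simp add: n_def)
        moreover have "3 / 4 * c2 * n \<le> (c2 - \<gamma>) * n" using g n0 by (intro mult_right_mono) auto
        ultimately have "codeg U R x y \<ge> 3 / 4 * c2 * n" by (simp add: algebra_simps)
        then have "real p * (codeg U R x y / k) \<ge> real p * (3 / 4 * c2 * n / k)"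
          using k0 by (intro mult_left_mono divide_right_mono) auto
        moreover have "real p * (3 / 4 * c2 * n / k) = 3 / 4 * c2 * a" by (simp add: a_def)
        moreover have "d * N \<le> 3 / 4 * c2 * a"
        proof -
          have "3 * \<gamma> * M \<le> 3 * (1 / 8) * M" using g Mp by (intro mult_right_mono mult_left_mono) auto
          then have "N \<le> 3 / 2 * a" using NM C1 a1 Mp by linarith
          then have "d * N \<le> d * (3 / 2 * a)" using D0 by (intro mult_left_mono) auto
          then show ?thesis by (simp add: d_def)
        qed
        ultimately have "d * N \<le> real p * (codeg U R x y / k)" by linarith
        then show "d * real (card L + p * (s + t + r)) \<le> real p * (codeg (\<Union>T) R x y / real (card T))"
          using L(2) by (simp add: N_def m_def U_def k_def)
      next
        fix x assume x: "x \<in> V"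
        define q where "q = deg U R x / n\<^sup>2"
        have n2: "n\<^sup>2 > 0" using n0 by simp
        have "deg V R x - 2 * \<gamma> * n\<^sup>2 \<le> deg U R x"
        proof -
          have "2 * real (card (V - U)) * n \<le> 2 * (\<gamma> * n) * n" using cVU n0 by (intro mult_right_mono) auto
          then show ?thesis using deg_subset_bounds(3)[OF V(1) UV, of R x] by (simp add: n_def power2_eq_square)
        qed
        then have "((1 - \<epsilon>) * D - 2 * \<gamma>) * n\<^sup>2 \<le> deg U R x"
          using dg[OF x] by (simp add: n_def abs_le_iff algebra_simps)
        then have q1: "(1 - \<epsilon>) * D - 2 * \<gamma> \<le> q" using n2 by (simp add: q_def pos_le_divide_eq)
        have "deg U R x \<le> ((1 + \<epsilon>) * D) * n\<^sup>2"
          using dg[OF x] deg_subset_bounds(2)[OF V(1) UV, of R x] by (simp add: n_def abs_le_iff algebra_simps)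
        then have q2: "q \<le> (1 + \<epsilon>) * D" using n2 by (simp add: q_def pos_divide_le_eq)
        have "\<bar>a\<^sup>2 * q - D * N\<^sup>2\<bar> + 2 * real C * N \<le> 2 * \<epsilon> * D * N\<^sup>2"
          by (rule scaled_degree_close[of \<gamma> D \<epsilon> M a]) (use g D0 e gD Mp a1 a2 NM C1 q1 q2 in auto)
        moreover have "a\<^sup>2 * q = (real p)\<^sup>2 * (deg U R x / k\<^sup>2)"
          using n0 k0 by (simp add: a_def q_def power_divide power_mult_distrib)
        ultimately show "\<bar>(real p)\<^sup>2 * (deg (\<Union>T) R x / (real (card T))\<^sup>2) - D * (real (card L + p * (s + t + r)))\<^sup>2\<bar>
           + 2 * real (card L) * real (card L + p * (s + t + r)) \<le> \<epsilon>' * D * (real (card L + p * (s + t + r)))\<^sup>2"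
          using L(2) by (simp add: N_def m_def U_def k_def \<epsilon>_def)
      qed
      then obtain T0 where T0: "T0 \<subseteq> T" "card T0 = p" "card (L \<union> \<Union>T0) = C + p * m"
         "nearly_regular (L \<union> \<Union>T0) R D \<epsilon>' d \<eta>" using L(2) unfolding m_def by auto
      have "card (L \<union> \<Union>T0) \<ge> n1"
      proof -
        have "real n1 \<le> real (C + p * m)" using p0(2) Mp(1) unfolding M_def by linarith
        then show ?thesis using T0(3) by linarith
      qed
      moreover have fW: "finite (L \<union> \<Union>T0)"
        using T0(3) C0 by (intro card_ge_0_finite) simp
      ultimately obtain T1 where T1: "tiling R s t r (L \<union> \<Union>T0) T1"
          "real m * real (card T1) \<ge> (1 - \<gamma>) * real (card (L \<union> \<Union>T0))"
        using apt[OF fW _ R T0(4)] by blast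
      have "(1 - \<gamma>) * N > M" using gN NM by (simp add: algebra_simps)
      then have "real (m * p) < real (m * card T1)" using T1(2) T0(3) by (simp add: N_def M_def mult.commute)
      then have "p < card T1" unfolding of_nat_less_iff using m1 by simp
      moreover have "finite T1"
      proof -
        have "T1 \<subseteq> Pow (L \<union> \<Union>T0)" using T1(1) by (auto simp: tiling_def)
        then show ?thesis using fW by (meson finite_Pow_iff finite_subset)
      qed
      then obtain T' where T': "tiling R s t r V T'" "card T' = card T - card T0 + card T1"
        using tiling_exchange[OF T fT(1)[OF T] T0(1) _ T1(1)] L(1) st unfolding U_def by auto
      moreover have "card T0 \<le> card T" using T0(1) fT(1)[OF T] by (simp add: card_mono)
      ultimately show False using Tmax[OF T'(1)] T0(2) by linarith
    qed
  qed
  show ?thesis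
    using e(1) C0 main unfolding D_def
    by (intro exI[of _ \<epsilon>] conjI exI[of _ C] exI[of _ n0] allI impI) auto
qed

lemma packing_up_to_constant:
  fixes VF :: "'a set" and c1 c2 :: real
  assumes F: "three_partite VF F X Y Z" and XY: "card X > card Y" and c: "0 < c1" "0 < c2"
  shows "\<exists>(\<epsilon>::real) (C::nat) (n0::nat). \<epsilon> > 0 \<and> C > 0 \<and> n0 > 0 \<and>
    (\<forall>(V::'b set) (G::'b set set) (n::nat).
       three_graph V G \<and> card V = n \<and> n > n0 \<and>
       (\<forall>v\<in>V. real (card (vertex_link G v))
                  \<in> {(1 - \<epsilon>) * c1 * real n ^ 2 .. (1 + \<epsilon>) * c1 * real n ^ 2}) \<and>
       (\<forall>u\<in>V. \<forall>v\<in>V. u \<noteq> v \<longrightarrow> real (card (pair_link G u v)) > c2 * real n)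
       \<longrightarrow> (\<exists>P. is_packing VF F V G P \<and> card (V - covered P) \<le> C))"
proof -
  obtain \<epsilon> C n0 where e: "\<epsilon> > 0" "C > 0" and
    T: "\<forall>(V :: 'b set) R. finite V \<and> card V > n0 \<and> edge_rel R \<and>
     (\<forall>v\<in>V. \<bar>deg V R v - 2 * c1 * (real (card V))\<^sup>2\<bar> \<le> \<epsilon> * (2 * c1) * (real (card V))\<^sup>2) \<and>
     (\<forall>u\<in>V. \<forall>v\<in>V. u \<noteq> v \<longrightarrow> codeg V R u v > c2 * real (card V)) \<longrightarrow>
     (\<exists>T. tiling R (card X) (card Y) (card Z) V T \<and> card (V - \<Union>T) \<le> C)"
    using tiling_up_to_constant[OF XY c, of "card Z", where 'b='b] by (elim exE conjE)
  have "\<exists>P. is_packing VF F V G P \<and> card (V - covered P) \<le> C"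
    if G: "three_graph V G" "card V = n" "n > Suc n0"
      and dg: "\<forall>v\<in>V. real (card (vertex_link G v)) \<in> {(1 - \<epsilon>) * c1 * real n ^ 2 .. (1 + \<epsilon>) * c1 * real n ^ 2}"
      and cd: "\<forall>u\<in>V. \<forall>v\<in>V. u \<noteq> v \<longrightarrow> real (card (pair_link G u v)) > c2 * real n"
    for V :: "'b set" and G n
  proof -
    let ?R = "\<lambda>x y z. {x, y, z} \<in> G"
    have "\<bar>deg V ?R v - 2 * c1 * (real (card V))\<^sup>2\<bar> \<le> \<epsilon> * (2 * c1) * (real (card V))\<^sup>2" if "v \<in> V" for v
      using dg that G(2) by (auto simp: deg_eq_card_vertex_link[OF G(1)] abs_le_iff algebra_simps)
    moreover have "codeg V ?R u v > c2 * real (card V)" if "u \<in> V" "v \<in> V" "u \<noteq> v" for u v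
      using cd that G(2) by (simp add: codeg_eq_card_pair_link[OF G(1)])
    moreover have "finite V" using G(1) by (simp add: three_graph_def)
    ultimately have "\<exists>T. tiling ?R (card X) (card Y) (card Z) V T \<and> card (V - \<Union>T) \<le> C"
      using T edge_rel_three_graph[OF G(1)] G(2,3) by simp
    then show ?thesis using tiling_packing[OF F] by metis
  qed
  then show ?thesis using e
    by (intro exI[of _ \<epsilon>] exI[of _ C] exI[of _ "Suc n0"]) simp
qed

theorem theorem5p14:
  fixes VF :: "'a set" and F :: "'a set set" and X Y Z :: "'a set"
    and c1 c2 :: real
  assumes "three_partite VF F X Y Z"
    and "\<not> (card X = card Y \<and> card Y = card Z)"
    and "0 < c1" "c1 < 1" "0 < c2" "c2 < 1"
  shows "\<exists>(\<epsilon>::real) (C::nat) (n0::nat). \<epsilon> > 0 \<and> C > 0 \<and> n0 > 0 \<and>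
    (\<forall>(V::'b set) (G::'b set set) (n::nat).
       three_graph V G \<and> card V = n \<and> n > n0 \<and>
       (\<forall>v\<in>V. real (card (vertex_link G v))
                  \<in> {(1 - \<epsilon>) * c1 * real n ^ 2 .. (1 + \<epsilon>) * c1 * real n ^ 2}) \<and>
       (\<forall>u\<in>V. \<forall>v\<in>V. u \<noteq> v \<longrightarrow> real (card (pair_link G u v)) > c2 * real n)
       \<longrightarrow> (\<exists>P. is_packing VF F V G P \<and> card (V - covered P) \<le> C))"
proof -
  have perm: "three_partite VF F Y X Z" "three_partite VF F Y Z X" "three_partite VF F Z Y X"
    using assms(1) by (auto simp: three_partite_def)
  \<comment> \<open>If both neighbours of \<open>Y\<close> had its size, all three sizes would
    agree. In each case the parts are reordered so that a larger one precedes a smaller one; the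
    remaining part is arbitrary.\<close>
  consider "card X > card Y" | "card Y > card X" | "card Y > card Z" | "card Z > card Y"
    using assms(2) by linarith
  then show ?thesis
    using packing_up_to_constant[OF assms(1) _ assms(3,5)] packing_up_to_constant[OF perm(1) _ assms(3,5)]
      packing_up_to_constant[OF perm(2) _ assms(3,5)] packing_up_to_constant[OF perm(3) _ assms(3,5)]
    by cases simp_all
qed

end
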